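(* Let $H\Gamma=(V,E,r,s)$ be a finite hypergraph, let $w\in V$ be a vertex that is not a sink, and let $H\Gamma$ be locally ultra at $w$. Let $\{e\in E\mid w\in s(e)\}=\mathcal E_1\cup\dots\cup\mathcal E_n$ be a partition into finitely many nonempty sets, and let $H\Gamma_O$ be the hypergraph obtained by outsplitting $H\Gamma$ at $w$ (move O) with respect to this partition. Then $C^*(H\Gamma)\cong C^*(H\Gamma_O)$.
   Context: A (finite directed) hypergraph $H\Gamma=(V,E,r,s)$ consists of finite sets $V$ (vertices) and $E$ (edges) and maps $r,s:E\to\mathcal P(V)\setminus\{\emptyset\}$ (range and source), where $\mathcal P(V)$ is the power set. A vertex $v$ is a sink if $v\notin s(e)$ for all $e\in E$. The hypergraph $C^*$-algebra $C^*(H\Gamma)$ is the universal $C^*$-algebra generated by mutually orthogonal projections $p_v$ ($v\in V$) and partial isometries $s_e$ ($e\in E$) such that: (HR1) $s_e^*s_f=\delta_{ef}\sum_{v\in r(e)}p_v$ for all $e,f\in E$; (HR2a) $s_es_e^*\le\sum_{v\in s(e)}p_v$ for all $e\in E$; (HR2b) $p_v\le\sum_{e\in E,\,v\in s(e)}s_es_e^*$ for all $v\in V$ that are not sinks. $H\Gamma$ is locally ultra at $w$ if for all $e\in E$, $w\in s(e)$ implies $s(e)=\{w\}$. Given a partition $\{e\in E\mid w\in s(e)\}=\mathcal E_1\cup\dots\cup\mathcal E_n$ into nonempty (disjoint) sets, the outsplit hypergraph $H\Gamma_O=(V_O,E_O,r_O,s_O)$ is: $V_O=(V\setminus\{w\})\cup\{w^1,\dots,w^n\}$;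 $E_O=\{e^1\mid e\in E,\ w\notin r(e)\}\cup\{e^1,\dots,e^n\mid e\in E,\ w\in r(e)\}$; $r_O(e^1)=r(e)$ if $w\notin r(e)$, $r_O(e^1)=(r(e)\setminus\{w\})\cup\{w^1\}$ if $w\in r(e)$, and $r_O(e^i)=\{w^i\}$ if $i>1$ and $w\in r(e)$; $s_O(e^i)=s(e)$ if $w\notin s(e)$, and $s_O(e^i)=(s(e)\setminus\{w\})\cup\{w^j\}$ if $w\in s(e)$ and $e\in\mathcal E_j$. *)

theory Defs
  imports
    Complex_Main
    "HOL-Library.Poly_Mapping"
    "HOL-Library.Disjoint_Sets"
    "HOL-Algebra.FiniteProduct"
begin

section \<open>Complex algebras with involution and norm\<close>

text \<open>
  C*-algebras need not be unital, and the ones below are quotients depending on term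
  parameters; hence a carrier-based record without a unit.
\<close>

record 'a cstar_alg = "'a partial_object" +
  czero :: 'a
  cadd :: "'a \<Rightarrow> 'a \<Rightarrow> 'a"
  cscale :: "complex \<Rightarrow> 'a \<Rightarrow> 'a"
  cmult :: "'a \<Rightarrow> 'a \<Rightarrow> 'a"
  cstar :: "'a \<Rightarrow> 'a"
  cnorm :: "'a \<Rightarrow> real"

definition csum :: "'b cstar_alg \<Rightarrow> ('i \<Rightarrow> 'b) \<Rightarrow> 'i set \<Rightarrow> 'b" where
  "csum B f I = finprod \<lparr>carrier = carrier B, mult = cadd B, one = czero B\<rparr> f I"

text \<open>
  The order of a C*-algebra: \<open>a \<le> b\<close> iff \<open>b - a\<close> is positive, and the positive elements of a
  C*-algebra are the squares of its self-adjoint elements.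
\<close>

definition cpositive :: "'b cstar_alg \<Rightarrow> 'b \<Rightarrow> bool" where
  "cpositive B x \<longleftrightarrow> (\<exists>h\<in>carrier B. cstar B h = h \<and> x = cmult B h h)"

definition cle :: "'b cstar_alg \<Rightarrow> 'b \<Rightarrow> 'b \<Rightarrow> bool" where
  "cle B a b \<longleftrightarrow> cpositive B (cadd B b (cscale B (-1) a))"

definition is_projection :: "'b cstar_alg \<Rightarrow> 'b \<Rightarrow> bool" where
  "is_projection B p \<longleftrightarrow> p \<in> carrier B \<and> cstar B p = p \<and> cmult B p p = p"

definition is_partial_isometry :: "'b cstar_alg \<Rightarrow> 'b \<Rightarrow> bool" where
  "is_partial_isometry B s \<longleftrightarrow> s \<in> carrier B \<and> cmult B (cmult B s (cstar B s)) s = s"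

text \<open>*-isomorphisms; between C*-algebras they are automatically isometric.\<close>

definition star_iso :: "'a cstar_alg \<Rightarrow> 'b cstar_alg \<Rightarrow> ('a \<Rightarrow> 'b) \<Rightarrow> bool" where
  "star_iso A B \<phi> \<longleftrightarrow>
     bij_betw \<phi> (carrier A) (carrier B) \<and>
     (\<forall>x\<in>carrier A. \<forall>y\<in>carrier A. \<phi> (cadd A x y) = cadd B (\<phi> x) (\<phi> y)) \<and>
     (\<forall>c. \<forall>x\<in>carrier A. \<phi> (cscale A c x) = cscale B c (\<phi> x)) \<and>
     (\<forall>x\<in>carrier A. \<forall>y\<in>carrier A. \<phi> (cmult A x y) = cmult B (\<phi> x) (\<phi> y)) \<and>
     (\<forall>x\<in>carrier A. \<phi> (cstar A x) = cstar B (\<phi> x))"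

definition cstar_isomorphic :: "'a cstar_alg \<Rightarrow> 'b cstar_alg \<Rightarrow> bool" (infix "\<cong>\<^sub>*" 50) where
  "A \<cong>\<^sub>* B \<longleftrightarrow> (\<exists>\<phi>. star_iso A B \<phi>)"


section \<open>The free *-algebra\<close>

text \<open>
  A word is a list of letters \<open>(g, b)\<close>, standing for the generator \<open>g\<close> if \<open>b = False\<close> and for
  its adjoint if \<open>b = True\<close>.  Words form an additively written monoid under concatenation, so
  that the convolution product of finitely supported functions on words is the
  multiplication of noncommutative polynomials.
\<close>

datatype 'g star_word = Star_Word (letters: "('g \<times> bool) list")

instantiation star_word :: (type) monoid_add
begin

definition "0 = Star_Word []"

definition "u + v = Star_Word (letters u @ letters v)"

instance
  by standard (simp_all add: zero_star_word_def plus_star_word_def)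

end

definition word_star :: "'g star_word \<Rightarrow> 'g star_word" where
  "word_star u = Star_Word (rev (map (\<lambda>(g, b). (g, \<not> b)) (letters u)))"

type_synonym 'g star_poly = "'g star_word \<Rightarrow>\<^sub>0 complex"

definition poly_scale :: "complex \<Rightarrow> 'g star_poly \<Rightarrow> 'g star_poly" where
  "poly_scale c x = Poly_Mapping.map ((*) c) x"

definition poly_star :: "'g star_poly \<Rightarrow> 'g star_poly" where
  "poly_star x = Poly_Mapping.map cnj (Poly_Mapping.map_key word_star x)"

definition gen :: "'g \<Rightarrow> 'g star_poly" where
  "gen g = Poly_Mapping.single (Star_Word [(g, False)]) 1"

text \<open>The non-unital free *-algebra on \<open>X\<close>: polynomials in \<open>X\<close> without constant term.\<close>

definition free_star_alg :: "'g set \<Rightarrow> 'g star_poly set" where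
  "free_star_alg X =
     {x. \<forall>u\<in>Poly_Mapping.keys x. letters u \<noteq> [] \<and> fst ` set (letters u) \<subseteq> X}"


section \<open>C*-seminorms and Hausdorff completions\<close>

definition cstar_seminorm :: "'g star_poly set \<Rightarrow> ('g star_poly \<Rightarrow> real) \<Rightarrow> bool" where
  "cstar_seminorm A q \<longleftrightarrow>
     (\<forall>x\<in>A. 0 \<le> q x) \<and>
     (\<forall>x\<in>A. \<forall>y\<in>A. q (x + y) \<le> q x + q y) \<and>
     (\<forall>c. \<forall>x\<in>A. q (poly_scale c x) = cmod c * q x) \<and>
     (\<forall>x\<in>A. \<forall>y\<in>A. q (x * y) \<le> q x * q y) \<and>
     (\<forall>x\<in>A. q (poly_star x * x) = (q x)\<^sup>2)"

text \<open>
  The C*-algebra obtained from \<open>A\<close> by dividing out the null space of \<open>q\<close> and completing: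
  Cauchy sequences in \<open>A\<close> modulo sequences tending to zero.
\<close>

definition cauchy_seqs ::
  "'g star_poly set \<Rightarrow> ('g star_poly \<Rightarrow> real) \<Rightarrow> (nat \<Rightarrow> 'g star_poly) set" where
  "cauchy_seqs A q =
     {x. (\<forall>n. x n \<in> A) \<and> (\<forall>\<epsilon>>0. \<exists>N. \<forall>m\<ge>N. \<forall>n\<ge>N. q (x m - x n) < \<epsilon>)}"

definition null_rel ::
  "'g star_poly set \<Rightarrow> ('g star_poly \<Rightarrow> real) \<Rightarrow> (nat \<Rightarrow> 'g star_poly) rel" where
  "null_rel A q =
     {(x, y). x \<in> cauchy_seqs A q \<and> y \<in> cauchy_seqs A q \<and> (\<lambda>n. q (x n - y n)) \<longlonglongrightarrow> 0}"

definition seq_class ::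
  "'g star_poly set \<Rightarrow> ('g star_poly \<Rightarrow> real) \<Rightarrow> (nat \<Rightarrow> 'g star_poly) \<Rightarrow> (nat \<Rightarrow> 'g star_poly) set" where
  "seq_class A q x = null_rel A q `` {x}"

definition seq_rep :: "(nat \<Rightarrow> 'g star_poly) set \<Rightarrow> nat \<Rightarrow> 'g star_poly" where
  "seq_rep K = (SOME x. x \<in> K)"

definition completion ::
  "'g star_poly set \<Rightarrow> ('g star_poly \<Rightarrow> real) \<Rightarrow> (nat \<Rightarrow> 'g star_poly) set cstar_alg" where
  "completion A q =
     \<lparr>carrier = cauchy_seqs A q // null_rel A q,
      czero = seq_class A q (\<lambda>n. 0),
      cadd = (\<lambda>K L. seq_class A q (\<lambda>n. seq_rep K n + seq_rep L n)),
      cscale = (\<lambda>c K. seq_class A q (\<lambda>n. poly_scale c (seq_rep K n))),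
      cmult = (\<lambda>K L. seq_class A q (\<lambda>n. seq_rep K n * seq_rep L n)),
      cstar = (\<lambda>K. seq_class A q (\<lambda>n. poly_star (seq_rep K n))),
      cnorm = (\<lambda>K. lim (\<lambda>n. q (seq_rep K n)))\<rparr>"

definition embed ::
  "'g star_poly set \<Rightarrow> ('g star_poly \<Rightarrow> real) \<Rightarrow> 'g star_poly \<Rightarrow> (nat \<Rightarrow> 'g star_poly) set" where
  "embed A q x = seq_class A q (\<lambda>n. x)"


section \<open>Universal C*-algebras\<close>

text \<open>
  Relations on the generators \<open>X\<close> are given by a predicate \<open>R B f\<close>, read: the family \<open>f\<close> in the
  C*-algebra \<open>B\<close> satisfies the relations.  Up to the restriction to the C*-subalgebra that they
  generate, families \<open>f\<close> satisfying \<open>R\<close> in arbitrary C*-algebras correspond to C*-seminorms \<open>q\<close>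
  on the free *-algebra such that the generators satisfy \<open>R\<close> in the completion with respect
  to \<open>q\<close>.  The universal C*-algebra is the completion with respect to the supremum of these
  seminorms.  Seminorms take the place of the C*-algebras themselves because the latter
  cannot be quantified over all types.  The supremum is only meaningful for relations that
  bound the generators; the hypergraph relations do, since projections and partial
  isometries have norm at most 1.
\<close>

definition admissible_seminorms ::
  "'g set \<Rightarrow> ((nat \<Rightarrow> 'g star_poly) set cstar_alg \<Rightarrow> ('g \<Rightarrow> (nat \<Rightarrow> 'g star_poly) set) \<Rightarrow> bool)
    \<Rightarrow> ('g star_poly \<Rightarrow> real) set" where
  "admissible_seminorms X R =
     {q. cstar_seminorm (free_star_alg X) q \<and>
         R (completion (free_star_alg X) q) (\<lambda>g. embed (free_star_alg X) q (gen g))}"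

definition universal_seminorm ::
  "'g set \<Rightarrow> ((nat \<Rightarrow> 'g star_poly) set cstar_alg \<Rightarrow> ('g \<Rightarrow> (nat \<Rightarrow> 'g star_poly) set) \<Rightarrow> bool)
    \<Rightarrow> 'g star_poly \<Rightarrow> real" where
  "universal_seminorm X R x = (SUP q\<in>admissible_seminorms X R. q x)"

definition universal_cstar ::
  "'g set \<Rightarrow> ((nat \<Rightarrow> 'g star_poly) set cstar_alg \<Rightarrow> ('g \<Rightarrow> (nat \<Rightarrow> 'g star_poly) set) \<Rightarrow> bool)
    \<Rightarrow> (nat \<Rightarrow> 'g star_poly) set cstar_alg" where
  "universal_cstar X R = completion (free_star_alg X) (universal_seminorm X R)"


section \<open>Hypergraphs and their C*-algebras\<close>

record ('v, 'e) hypergraph =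
  verts :: "'v set"
  edges :: "'e set"
  rng :: "'e \<Rightarrow> 'v set"
  src :: "'e \<Rightarrow> 'v set"

locale finite_hypergraph =
  fixes H :: "('v, 'e) hypergraph"
  assumes finite_verts: "finite (verts H)"
    and finite_edges: "finite (edges H)"
    and rng_subset: "e \<in> edges H \<Longrightarrow> rng H e \<subseteq> verts H"
    and rng_nonempty: "e \<in> edges H \<Longrightarrow> rng H e \<noteq> {}"
    and src_subset: "e \<in> edges H \<Longrightarrow> src H e \<subseteq> verts H"
    and src_nonempty: "e \<in> edges H \<Longrightarrow> src H e \<noteq> {}"

definition is_sink :: "('v, 'e) hypergraph \<Rightarrow> 'v \<Rightarrow> bool" where
  "is_sink H v \<longleftrightarrow> (\<forall>e\<in>edges H. v \<notin> src H e)"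

definition hypergraph_family ::
  "('v, 'e) hypergraph \<Rightarrow> 'b cstar_alg \<Rightarrow> ('v \<Rightarrow> 'b) \<Rightarrow> ('e \<Rightarrow> 'b) \<Rightarrow> bool" where
  "hypergraph_family H B p s \<longleftrightarrow>
     (\<forall>v\<in>verts H. is_projection B (p v)) \<and>
     (\<forall>v\<in>verts H. \<forall>v'\<in>verts H. v \<noteq> v' \<longrightarrow> cmult B (p v) (p v') = czero B) \<and>
     (\<forall>e\<in>edges H. is_partial_isometry B (s e)) \<and>
     (\<forall>e\<in>edges H. \<forall>f\<in>edges H.
        cmult B (cstar B (s e)) (s f) = (if e = f then csum B p (rng H e) else czero B)) \<and>
     (\<forall>e\<in>edges H. cle B (cmult B (s e) (cstar B (s e))) (csum B p (src H e))) \<and>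
     (\<forall>v\<in>verts H. \<not> is_sink H v \<longrightarrow>
        cle B (p v) (csum B (\<lambda>e. cmult B (s e) (cstar B (s e))) {e \<in> edges H. v \<in> src H e}))"

datatype ('v, 'e) hgen = Vert 'v | Edge 'e

definition hypergraph_cstar ::
  "('v, 'e) hypergraph \<Rightarrow> (nat \<Rightarrow> ('v, 'e) hgen star_poly) set cstar_alg" where
  "hypergraph_cstar H =
     universal_cstar (Vert ` verts H \<union> Edge ` edges H)
       (\<lambda>B f. hypergraph_family H B (\<lambda>v. f (Vert v)) (\<lambda>e. f (Edge e)))"


section \<open>Outsplitting\<close>

definition locally_ultra :: "('v, 'e) hypergraph \<Rightarrow> 'v \<Rightarrow> bool" where
  "locally_ultra H w \<longleftrightarrow> (\<forall>e\<in>edges H. w \<in> src H e \<longrightarrow> src H e = {w})"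

text \<open>
  In the outsplit hypergraph, \<open>Inl v\<close> is the old vertex \<open>v\<close>, \<open>Inr i\<close> is \<open>w\<^sup>i\<close>, and \<open>(e, i)\<close> is
  \<open>e\<^sup>i\<close>.  If \<open>w \<in> src H e\<close>, the set \<open>{Inr j | ...}\<close> below is the singleton \<open>{w\<^sup>j}\<close> for
  the unique \<open>j\<close> such that \<open>e\<close> belongs to the \<open>j\<close>-th block of the partition.
\<close>

definition outsplit ::
  "('v, 'e) hypergraph \<Rightarrow> 'v \<Rightarrow> nat \<Rightarrow> (nat \<Rightarrow> 'e set) \<Rightarrow> ('v + nat, 'e \<times> nat) hypergraph" where
  "outsplit H w n \<E> =
     \<lparr>verts = Inl ` (verts H - {w}) \<union> Inr ` {1..n},
      edges = {(e, 1) | e. e \<in> edges H \<and> w \<notin> rng H e} \<union>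
              {(e, i) | e i. e \<in> edges H \<and> w \<in> rng H e \<and> i \<in> {1..n}},
      rng = (\<lambda>(e, i).
        if w \<notin> rng H e then Inl ` rng H e
        else if i = 1 then Inl ` (rng H e - {w}) \<union> {Inr 1}
        else {Inr i}),
      src = (\<lambda>(e, i).
        if w \<notin> src H e then Inl ` src H e
        else Inl ` (src H e - {w}) \<union> {Inr j | j. j \<in> {1..n} \<and> e \<in> \<E> j})\<rparr>"

end

theory Submission
  imports Defs
begin

text \<open>
  Relations hold in the completion of the free *-algebra iff the seminorm kills them, so that the
  hypergraph relations can be checked modulo the null space of a C*-seminorm.  Only the inequalities
  need an argument: if \<open>P\<close>, \<open>Q\<close> are projections and \<open>Q - P\<close> is the square of a self-adjoint
  element, then \<open>Q P = P\<close>.  Instead of spectral theory, this uses that \<open>exp (- t h\<^sup>2)\<close> is a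
  contraction for self-adjoint \<open>h\<close> and \<open>t \<ge> 0\<close>, and Liouville's theorem.

  Given a family \<open>(p, s)\<close> for the hypergraph, local ultraness at \<open>w\<close> and (HR2) give
  \<open>p\<^sub>w = \<Sum>\<^sub>j q\<^sub>j\<close>, where \<open>q\<^sub>j\<close> is the sum of \<open>s\<^sub>e s\<^sub>e\<^sup>*\<close> over the edges \<open>e\<close> in the
  \<open>j\<close>-th block.  Taking \<open>q\<^sub>j\<close> as the projection of \<open>w\<^sup>j\<close> and cutting \<open>s\<^sub>e\<close> down by the range
  projections of the edges \<open>e\<^sup>i\<close> gives a family for the outsplit hypergraph; summing over the
  copies of \<open>w\<close> and of \<open>e\<close> goes back.  The induced substitutions of generators are thus
  contractive for the universal seminorms and inverse to each other modulo null elements.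
\<close>

section \<open>The free *-algebra\<close>

text \<open>The order is witnessed by a square root in the completion, hence only by a Cauchy
  sequence of polynomials, and exponentials of polynomials are not polynomials. So
  \<open>exp (z D)\<close> is replaced by \<open>(1 + z D) ^ m\<close> and contractivity by bounds
  of the form \<open>1 + K * s\<^sup>2\<close>, whose second-order errors stay bounded after taking
  \<open>m\<close>-th powers at distance \<open>r / m\<close>. These expressions need a unit, which
  the algebra without constant terms does not contain; therefore seminorms are extended to all
  polynomials.

  The isomorphism is found without manipulating the completions: a substitution of generators pulls
  C*-seminorms back to C*-seminorms, so it suffices to check relations modulo null elements, for one
  seminorm at a time.

  Local ultraness rules out edges that leave \<open>w\<close> together with other vertices. The
  ranges of the edges leaving \<open>w\<close> then lie below the projection of \<open>w\<close>,
  and (HR2b) turns this into equality. In the outsplit hypergraph the same argument at each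
  \<open>w\<^sup>j\<close> recovers its projection from the edges alone, which is what makes the two
  translations inverse to each other.\<close>

lemma poly_mapping_add_induct [case_names zero single add]:
  fixes x :: "'a \<Rightarrow>\<^sub>0 'b::comm_monoid_add"
  assumes zero: "P 0"
    and single: "\<And>k c. P (Poly_Mapping.single k c)"
    and add: "\<And>x y. P x \<Longrightarrow> P y \<Longrightarrow> P (x + y)"
  shows "P x"
proof (induction x rule: Poly_Mapping.update_induct)
  case const
  show ?case by (rule zero)
next
  case (update f a b)
  have "Poly_Mapping.update a b f = f + Poly_Mapping.single a b"
    using update by (intro poly_mapping_eqI)
      (auto simp: lookup_add lookup_update lookup_single when_def in_keys_iff)
  then show ?case using add single update by metis
qed

section \<open>Scalars and the involution on noncommutative polynomials\<close>

lemma poly_scale_eq: "poly_scale c x = Poly_Mapping.single 0 c * x"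
  by (simp add: poly_scale_def mult_map_scale_conv_mult)

lemma lookup_poly_scale [simp]: "Poly_Mapping.lookup (poly_scale c x) u = c * Poly_Mapping.lookup x u"
  unfolding poly_scale_def by (simp add: Poly_Mapping.map.rep_eq when_def)

lemma single_0_mult_commute:
  fixes x :: "'g star_poly"
  shows "x * Poly_Mapping.single 0 c = Poly_Mapping.single 0 c * x"
  by (induction x rule: poly_mapping_add_induct) (simp_all add: mult_single algebra_simps)

lemma poly_scale_single [simp]: "poly_scale c (Poly_Mapping.single u d) = Poly_Mapping.single u (c * d)"
  by (simp add: poly_scale_eq mult_single)

lemma poly_scale_mult_left: "poly_scale c x * y = poly_scale c (x * y)"
  and poly_scale_mult_right: "x * poly_scale c y = poly_scale c (x * y)"
proof -
  show "poly_scale c x * y = poly_scale c (x * y)"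
    by (simp add: poly_scale_eq mult.assoc)
  show "x * poly_scale c y = poly_scale c (x * y)"
    by (metis poly_scale_eq mult.assoc single_0_mult_commute)
qed

interpretation poly_scale: vector_space poly_scale
  by standard (rule poly_mapping_eqI; simp add: lookup_add algebra_simps)+

lemma poly_scale_minus_one [simp]: "poly_scale (- 1) x = - x"
  by (rule poly_mapping_eqI) simp

lemma letters_zero [simp]: "letters 0 = []"
  and letters_add [simp]: "letters (u + v) = letters u @ letters v"
  by (simp_all add: zero_star_word_def plus_star_word_def)

lemma word_star_add: "word_star (u + v) = word_star v + word_star u"
  by (simp add: word_star_def plus_star_word_def)

lemma word_star_0 [simp]: "word_star 0 = 0"
  by (simp add: word_star_def zero_star_word_def)

lemma letters_word_star: "letters (word_star u) = rev (map (\<lambda>(g, b). (g, \<not> b)) (letters u))"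
  by (simp add: word_star_def)

lemma word_star_word_star [simp]: "word_star (word_star u) = u"
  by (cases u) (simp add: word_star_def rev_map case_prod_unfold o_def)

text \<open>\<open>map_key\<close> is precomposition for injective key maps only, so this comes
  before reading off the coefficients of \<open>poly_star\<close>.\<close>

lemma inj_word_star: "inj word_star"
  by (metis injI word_star_word_star)

lemma lookup_poly_star: "Poly_Mapping.lookup (poly_star x) u = cnj (Poly_Mapping.lookup x (word_star u))"
  unfolding poly_star_def
  by (simp add: Poly_Mapping.map.rep_eq Poly_Mapping.map_key.rep_eq[OF inj_word_star] when_def)

lemma poly_star_single [simp]:
  "poly_star (Poly_Mapping.single u c) = Poly_Mapping.single (word_star u) (cnj c)"
  by (rule poly_mapping_eqI) (auto simp: lookup_poly_star lookup_single when_def)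

lemma poly_star_zero [simp]: "poly_star 0 = 0"
  and poly_star_add [simp]: "poly_star (x + y) = poly_star x + poly_star y"
  and poly_star_diff [simp]: "poly_star (x - y) = poly_star x - poly_star y"
  and poly_star_scale [simp]: "poly_star (poly_scale c x) = poly_scale (cnj c) (poly_star x)"
  and poly_star_star [simp]: "poly_star (poly_star x) = x"
  by (rule poly_mapping_eqI; simp add: lookup_poly_star lookup_add lookup_minus)+

lemma poly_star_one [simp]: "poly_star 1 = 1"
  by (simp flip: single_one)

lemma poly_star_sum [simp]: "poly_star (sum f I) = (\<Sum>i\<in>I. poly_star (f i))"
  by (induction I rule: infinite_finite_induct) simp_all

lemma poly_star_mult [simp]: "poly_star (x * y) = poly_star y * poly_star x"
proof (induction x rule: poly_mapping_add_induct)
  case (single u c)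
  show ?case
    by (induction y rule: poly_mapping_add_induct)
      (simp_all add: mult_single word_star_add algebra_simps)
qed (simp_all add: algebra_simps)

text \<open>The universal property of the free *-algebra.\<close>

definition word_eval :: "('g \<Rightarrow> 'h star_poly) \<Rightarrow> 'g star_word \<Rightarrow> 'h star_poly" where
  "word_eval f u = prod_list (map (\<lambda>(g, b). if b then poly_star (f g) else f g) (letters u))"

definition poly_subst :: "('g \<Rightarrow> 'h star_poly) \<Rightarrow> 'g star_poly \<Rightarrow> 'h star_poly" where
  "poly_subst f x = (\<Sum>u\<in>Poly_Mapping.keys x. poly_scale (Poly_Mapping.lookup x u) (word_eval f u))"

lemma word_eval_0 [simp]: "word_eval f 0 = 1"
  and word_eval_add: "word_eval f (u + v) = word_eval f u * word_eval f v"
  by (simp_all add: word_eval_def)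

lemma prod_list_rev_poly_star: "prod_list (rev (map poly_star xs)) = poly_star (prod_list xs)"
  by (induction xs) simp_all

lemma word_eval_star: "word_eval f (word_star u) = poly_star (word_eval f u)"
proof -
  have "word_eval f (word_star u)
      = prod_list (rev (map poly_star (map (\<lambda>(g, b). if b then poly_star (f g) else f g) (letters u))))"
    by (simp add: word_eval_def letters_word_star rev_map[symmetric] case_prod_unfold o_def)
      (rule arg_cong[where f = "\<lambda>xs. prod_list (rev xs)"], simp)
  then show ?thesis by (simp only: prod_list_rev_poly_star word_eval_def)
qed

lemma poly_subst_superset:
  assumes "finite K" "Poly_Mapping.keys x \<subseteq> K"
  shows "poly_subst f x = (\<Sum>u\<in>K. poly_scale (Poly_Mapping.lookup x u) (word_eval f u))"
  unfolding poly_subst_def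
  using assms by (intro sum.mono_neutral_left) (auto simp: in_keys_iff)

lemma poly_subst_zero [simp]: "poly_subst f 0 = 0"
  by (simp add: poly_subst_def)

lemma poly_subst_single [simp]: "poly_subst f (Poly_Mapping.single u c) = poly_scale c (word_eval f u)"
  by (cases "c = 0") (simp_all add: poly_subst_def)

lemma poly_subst_add [simp]: "poly_subst f (x + y) = poly_subst f x + poly_subst f y"
proof -
  let ?K = "Poly_Mapping.keys x \<union> Poly_Mapping.keys y"
  have "Poly_Mapping.keys (x + y) \<subseteq> ?K" by (rule keys_add)
  then show ?thesis
    by (simp add: poly_subst_superset[of ?K] lookup_add poly_scale.scale_left_distrib sum.distrib)
qed

lemma poly_subst_scale [simp]: "poly_subst f (poly_scale c x) = poly_scale c (poly_subst f x)"
  by (induction x rule: poly_mapping_add_induct) (simp_all add: poly_scale.scale_right_distrib)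

lemma poly_subst_diff [simp]: "poly_subst f (x - y) = poly_subst f x - poly_subst f y"
  using poly_subst_add[of f "x - y" y] by (simp add: algebra_simps)

lemma poly_subst_sum [simp]: "poly_subst f (sum g I) = (\<Sum>i\<in>I. poly_subst f (g i))"
  by (induction I rule: infinite_finite_induct) simp_all

lemma poly_subst_mult [simp]: "poly_subst f (x * y) = poly_subst f x * poly_subst f y"
proof (induction x rule: poly_mapping_add_induct)
  case (single u c)
  show ?case
    by (induction y rule: poly_mapping_add_induct)
      (simp_all add: mult_single word_eval_add distrib_left poly_scale_mult_left poly_scale_mult_right mult.commute)
qed (simp_all add: distrib_right)

lemma poly_subst_star [simp]: "poly_subst f (poly_star x) = poly_star (poly_subst f x)"
  by (induction x rule: poly_mapping_add_induct) (simp_all add: word_eval_star)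

lemma poly_subst_gen [simp]: "poly_subst f (gen g) = f g"
  by (simp add: gen_def word_eval_def)

section \<open>The subalgebra of polynomials without constant term\<close>

lemma free_star_alg_zero [simp]: "0 \<in> free_star_alg X"
  by (simp add: free_star_alg_def)

lemma free_star_alg_add [simp]:
  "x \<in> free_star_alg X \<Longrightarrow> y \<in> free_star_alg X \<Longrightarrow> x + y \<in> free_star_alg X"
  using keys_add[of x y] by (auto simp: free_star_alg_def)

lemma free_star_alg_scale [simp]: "x \<in> free_star_alg X \<Longrightarrow> poly_scale c x \<in> free_star_alg X"
  by (auto simp: free_star_alg_def in_keys_iff)

lemma free_star_alg_uminus [simp]: "x \<in> free_star_alg X \<Longrightarrow> - x \<in> free_star_alg X"
  using free_star_alg_scale[of x X "-1"] by simp

lemma free_star_alg_diff [simp]: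
  "x \<in> free_star_alg X \<Longrightarrow> y \<in> free_star_alg X \<Longrightarrow> x - y \<in> free_star_alg X"
  using free_star_alg_add[of x X "- y"] by simp

lemma free_star_alg_sum [simp]:
  "(\<And>i. i \<in> I \<Longrightarrow> f i \<in> free_star_alg X) \<Longrightarrow> sum f I \<in> free_star_alg X"
  by (induction I rule: infinite_finite_induct) simp_all

lemma free_star_alg_mult [simp]:
  "x \<in> free_star_alg X \<Longrightarrow> y \<in> free_star_alg X \<Longrightarrow> x * y \<in> free_star_alg X"
  using keys_mult[of x y] by (fastforce simp: free_star_alg_def)

lemma free_star_alg_star [simp]: "x \<in> free_star_alg X \<Longrightarrow> poly_star x \<in> free_star_alg X"
  unfolding free_star_alg_def
proof safe
  fix u
  assume x: "\<forall>u\<in>Poly_Mapping.keys x. letters u \<noteq> [] \<and> fst ` set (letters u) \<subseteq> X"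
    and u: "u \<in> Poly_Mapping.keys (poly_star x)"
  then have "word_star u \<in> Poly_Mapping.keys x"
    by (simp add: in_keys_iff lookup_poly_star)
  with x have *: "letters (word_star u) \<noteq> []" "fst ` set (letters (word_star u)) \<subseteq> X" by auto
  then show "letters u = [] \<Longrightarrow> False" by (simp add: letters_word_star)
  fix g b assume "(g, b) \<in> set (letters u)"
  then have "(g, \<not> b) \<in> set (letters (word_star u))" by (force simp: letters_word_star)
  with * show "fst (g, b) \<in> X" by force
qed

lemma free_star_alg_gen [simp]: "gen g \<in> free_star_alg X \<longleftrightarrow> g \<in> X"
  by (simp add: free_star_alg_def gen_def)

text \<open>Constants are excluded, so words are built from single letters by induction on nonempty
  lists. The cases carry membership because admissible seminorms satisfy their laws only on this
  subalgebra.\<close>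

lemma free_star_alg_induct [consumes 1, case_names gen star scale add mult zero]:
  assumes x: "x \<in> free_star_alg X"
    and gen: "\<And>g. g \<in> X \<Longrightarrow> P (gen g)"
    and star: "\<And>g. g \<in> X \<Longrightarrow> P (poly_star (gen g))"
    and scale: "\<And>c x. x \<in> free_star_alg X \<Longrightarrow> P x \<Longrightarrow> P (poly_scale c x)"
    and add: "\<And>x y. x \<in> free_star_alg X \<Longrightarrow> y \<in> free_star_alg X \<Longrightarrow> P x \<Longrightarrow> P y \<Longrightarrow> P (x + y)"
    and mult: "\<And>x y. x \<in> free_star_alg X \<Longrightarrow> y \<in> free_star_alg X \<Longrightarrow> P x \<Longrightarrow> P y \<Longrightarrow> P (x * y)"
    and zero: "P 0"
  shows "P x"
proof -
  have letter: "P (Poly_Mapping.single (Star_Word [(g, b)]) 1) \<and>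
      Poly_Mapping.single (Star_Word [(g, b)]) (1::complex) \<in> free_star_alg X" if "g \<in> X" for g b
    using gen[OF that] star[OF that] that
    by (cases b) (simp_all add: gen_def word_star_def free_star_alg_def)
  have word: "P (Poly_Mapping.single (Star_Word l) 1) \<and>
      Poly_Mapping.single (Star_Word l) (1::complex) \<in> free_star_alg X"
    if "l \<noteq> []" "fst ` set l \<subseteq> X" for l
    using that
  proof (induction l rule: list_nonempty_induct)
    case (single a)
    then show ?case using letter by (cases a) auto
  next
    case (cons a l)
    obtain g b where a: "a = (g, b)" by (cases a)
    have "Poly_Mapping.single (Star_Word (a # l)) (1::complex)
        = Poly_Mapping.single (Star_Word [(g, b)]) 1 * Poly_Mapping.single (Star_Word l) 1"
      by (simp add: mult_single plus_star_word_def a)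
    moreover have "g \<in> X" using cons a by auto
    ultimately show ?case
      using cons letter[of g b] mult[of "Poly_Mapping.single (Star_Word [(g, b)]) 1" "Poly_Mapping.single (Star_Word l) 1"] by auto
  qed
  have "x \<in> free_star_alg X \<longrightarrow> P x"
  proof (induction x rule: Poly_Mapping.update_induct)
    case const
    then show ?case using zero by simp
  next
    case (update f u c)
    \<comment> \<open>The coefficient is pulled out so that the \<open>scale\<close> case can supply
      it.\<close>
    have eq: "Poly_Mapping.update u c f = f + poly_scale c (Poly_Mapping.single u 1)"
      using update by (intro poly_mapping_eqI)
        (auto simp: lookup_add lookup_update lookup_single when_def in_keys_iff)
    show ?case
    proof
      assume "Poly_Mapping.update u c f \<in> free_star_alg X"
      then have u: "letters u \<noteq> []" "fst ` set (letters u) \<subseteq> X" and f: "f \<in> free_star_alg X"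
        using update(1,2) by (auto simp: free_star_alg_def keys_update)
      from word[OF u] have "P (poly_scale c (Poly_Mapping.single u 1))"
          "poly_scale c (Poly_Mapping.single u 1) \<in> free_star_alg X"
        using scale[of "Poly_Mapping.single u 1" c] free_star_alg_scale[of "Poly_Mapping.single u 1" X c] by auto
      then show "P (Poly_Mapping.update u c f)"
        unfolding eq using add f update(3) by blast
    qed
  qed
  with x show ?thesis by blast
qed

lemma poly_subst_free_star_alg:
  assumes "x \<in> free_star_alg X" and "\<And>g. g \<in> X \<Longrightarrow> f g \<in> free_star_alg Y"
  shows "poly_subst f x \<in> free_star_alg Y"
  using assms(1) by (induction rule: free_star_alg_induct) (simp_all add: assms(2))

lemma poly_subst_id:
  assumes "x \<in> free_star_alg X" and "\<And>g. g \<in> X \<Longrightarrow> f g = gen g"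
  shows "poly_subst f x = x"
  using assms(1) by (induction rule: free_star_alg_induct) (simp_all add: assms(2))

section \<open>C*-seminorms and the order of projections\<close>

locale cstar_seminormed =
  fixes N :: "'g star_poly \<Rightarrow> real"
  assumes cstar_seminorm: "cstar_seminorm UNIV N"
begin

section \<open>Norm estimates from the C*-identity\<close>

lemma nonneg [simp]: "0 \<le> N x"
  and triangle: "N (x + y) \<le> N x + N y"
  and scale [simp]: "N (poly_scale c x) = cmod c * N x"
  and mult_le: "N (x * y) \<le> N x * N y"
  and cstar_identity: "N (poly_star x * x) = (N x)\<^sup>2"
  using cstar_seminorm by (auto simp: cstar_seminorm_def)

lemma zero [simp]: "N 0 = 0"
  using scale[of 0 0] by simp

lemma uminus [simp]: "N (- x) = N x"
  using scale[of "-1" x] by simp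

lemma minus_commute: "N (x - y) = N (y - x)"
  using uminus[of "x - y"] by simp

lemma triangle_diff: "N (x - y) \<le> N x + N y"
  using triangle[of x "- y"] by simp

lemma star [simp]: "N (poly_star x) = N x"
proof -
  have *: "N x \<le> N (poly_star x)" for x
  proof (cases "N x = 0")
    case False
    have "N x * N x \<le> N (poly_star x) * N x"
      using mult_le[of "poly_star x" x] by (simp add: cstar_identity power2_eq_square)
    with False show ?thesis
      by (metis mult_le_cancel_right nonneg order_le_less not_less)
  qed simp
  show ?thesis using *[of x] *[of "poly_star x"] by simp
qed

text \<open>The C*-identity makes \<open>N 1\<close> idempotent, hence 0 or 1. The value 0 does
  occur, namely for the zero seminorm.\<close>

lemma one_le: "N 1 \<le> 1"
proof -
  have "N 1 = N 1 * N 1"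
    using cstar_identity[of 1] by (simp add: power2_eq_square)
  then show ?thesis by (metis mult_cancel_right1 nonneg order_refl zero_le_one)
qed

lemma power_le: "N (x ^ k) \<le> N x ^ k"
proof (induction k)
  case (Suc k)
  have "N (x * x ^ k) \<le> N x * N (x ^ k)" by (rule mult_le)
  also have "\<dots> \<le> N x * N x ^ k" by (intro mult_left_mono Suc nonneg)
  finally show ?case by simp
qed (simp add: one_le)

lemma sum_le: "N (sum f I) \<le> (\<Sum>i\<in>I. N (f i))"
proof (induction I rule: infinite_finite_induct)
  case (insert i I)
  then show ?case using triangle[of "f i" "sum f I"] by simp
qed simp_all

section \<open>Calculus modulo the null space\<close>

text \<open>Equality in the quotient by the null space, kept as a relation on polynomials because
  \<open>N\<close> is a locale parameter and ring identities can then be proved exactly before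
  passing to the quotient.\<close>

definition null_cong (infix "\<doteq>" 50) where
  "x \<doteq> y \<longleftrightarrow> N (x - y) = 0"

lemma null_iff: "N x = 0 \<longleftrightarrow> x \<doteq> 0"
  by (simp add: null_cong_def)

lemma null_cong_iff: "x \<doteq> y \<longleftrightarrow> x - y \<doteq> 0"
  by (simp add: null_cong_def)

lemma null_cong_refl [simp, intro!]: "x \<doteq> x"
  by (simp add: null_cong_def)

lemma null_cong_sym: "x \<doteq> y \<Longrightarrow> y \<doteq> x"
  by (simp add: null_cong_def minus_commute)

lemma null_cong_trans [trans]: "x \<doteq> y \<Longrightarrow> y \<doteq> z \<Longrightarrow> x \<doteq> z"
  using triangle[of "x - y" "y - z"] nonneg[of "x - z"] by (auto simp: null_cong_def)

lemma null_cong_add: "x \<doteq> x' \<Longrightarrow> y \<doteq> y' \<Longrightarrow> x + y \<doteq> x' + y'"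
  using triangle[of "x - x'" "y - y'"] nonneg[of "x + y - (x' + y')"]
  by (auto simp: null_cong_def algebra_simps)

lemma null_cong_scale: "x \<doteq> x' \<Longrightarrow> poly_scale c x \<doteq> poly_scale c x'"
  using scale[of c "x - x'"] by (simp add: null_cong_def poly_scale.scale_right_diff_distrib)

lemma null_cong_uminus: "x \<doteq> x' \<Longrightarrow> - x \<doteq> - x'"
  using null_cong_scale[of x x' "-1"] by simp

lemma null_cong_diff: "x \<doteq> x' \<Longrightarrow> y \<doteq> y' \<Longrightarrow> x - y \<doteq> x' - y'"
  using null_cong_add[OF _ null_cong_uminus, of x x' y y'] by simp

lemma null_cong_star: "x \<doteq> x' \<Longrightarrow> poly_star x \<doteq> poly_star x'"
  using star[of "x - x'"] by (simp add: null_cong_def)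

lemma null_mult_left: "x \<doteq> 0 \<Longrightarrow> y * x \<doteq> 0"
  and null_mult_right: "x \<doteq> 0 \<Longrightarrow> x * y \<doteq> 0"
  using mult_le[of y x] mult_le[of x y] nonneg[of "y * x"] nonneg[of "x * y"]
  by (auto simp: null_cong_def)

lemma null_cong_mult: "x \<doteq> x' \<Longrightarrow> y \<doteq> y' \<Longrightarrow> x * y \<doteq> x' * y'"
proof -
  assume "x \<doteq> x'" "y \<doteq> y'"
  then have "(x - x') * y + x' * (y - y') \<doteq> 0 + 0"
    by (intro null_cong_add null_mult_left null_mult_right) (simp_all flip: null_cong_iff)
  then show ?thesis by (subst null_cong_iff) (simp add: algebra_simps)
qed

lemma null_cong_mult_left: "x \<doteq> x' \<Longrightarrow> y * x \<doteq> y * x'"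
  and null_cong_mult_right: "x \<doteq> x' \<Longrightarrow> x * y \<doteq> x' * y"
  by (simp_all add: null_cong_mult)

lemma null_cong_sum: "(\<And>i. i \<in> I \<Longrightarrow> f i \<doteq> g i) \<Longrightarrow> sum f I \<doteq> sum g I"
  by (induction I rule: infinite_finite_induct) (auto intro: null_cong_add)

lemmas null_cong_intros = null_cong_add null_cong_diff null_cong_uminus null_cong_mult
  null_cong_star null_cong_scale null_cong_sum

lemma seminorm_cong: "x \<doteq> y \<Longrightarrow> N x = N y"
  using triangle[of y "x - y"] triangle[of x "y - x"] by (simp add: null_cong_def minus_commute)

lemma star_mult_self_null: "poly_star x * x \<doteq> 0 \<Longrightarrow> x \<doteq> 0"
  using cstar_identity[of x] by (simp flip: null_iff)

section \<open>Growth estimates replacing the exponential function\<close>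

text \<open>Cauchy's estimate, by averaging over roots of unity.\<close>

lemma coefficient_le:
  assumes k: "k < M" and r: "0 \<le> r"
    and le: "\<And>z. cmod z = r \<Longrightarrow> N (\<Sum>i<M. poly_scale (z ^ i) (a i)) \<le> B"
  shows "r ^ k * N (a k) \<le> B"
proof -
  \<comment> \<open>A primitive \<open>M\<close>-th root of unity; the samples at
    \<open>r * w ^ j\<close> replace a contour integral by a finite average.\<close>
  define w where "w = cis (2 * pi / M)"
  have orth: "(\<Sum>j<M. w ^ (j * i) * cnj w ^ (j * k)) = (if i = k then of_nat M else 0)" if "i < M" for i
  proof -
    define z where "z = w ^ i * cnj w ^ k"
    have z: "z = cis (2 * pi * (real i - real k) / M)"
      by (simp add: z_def w_def cis_cnj Complex.DeMoivre cis_mult algebra_simps diff_divide_distrib)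
    have sum: "(\<Sum>j<M. w ^ (j * i) * cnj w ^ (j * k)) = (\<Sum>j<M. z ^ j)"
      by (simp add: z_def power_mult_distrib mult.commute flip: power_mult)
    show ?thesis
    proof (cases "i = k")
      case True
      then have "z = 1" by (simp add: z)
      with True sum show ?thesis by simp
    next
      case False
      have "z ^ M = cis (2 * pi * of_int (int i - int k))"
        using k by (simp add: z Complex.DeMoivre)
      then have "z ^ M = 1" by (simp only: cis_multiple_2pi Ints_of_int)
      \<comment> \<open>\<open>z = 1\<close> would make \<open>i - k\<close> a multiple of
        \<open>M\<close>, impossible for distinct indices below \<open>M\<close>.\<close>
      moreover have "z \<noteq> 1"
      proof
        assume "z = 1"
        then have "cos (2 * pi * (real i - real k) / M) = 1"
          by (simp add: z complex_eq_iff)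
        then obtain l :: int where "2 * pi * (real i - real k) / M = of_int l * 2 * pi"
          by (auto simp: cos_one_2pi_int)
        then have "2 * pi * (real i - real k) = 2 * pi * (of_int l * real M)"
          using k by (simp add: field_simps)
        then have "real i - real k = of_int l * real M"
          by (metis mult_cancel_left pi_neq_zero zero_neq_numeral mult_eq_0_iff)
        then have "real_of_int (int i - int k) = real_of_int (l * int M)" by simp
        then have l: "int i - int k = l * int M" by (simp only: of_int_eq_iff)
        have "\<bar>int i - int k\<bar> < int M" using k \<open>i < M\<close> by auto
        then have "\<bar>l\<bar> * int M < 1 * int M" by (simp add: l abs_mult)
        then have "\<bar>l\<bar> < 1" by (simp only: mult_less_cancel_right)
        with l False show False by simp
      qed
      ultimately show ?thesis
        using False sum geometric_sum[of z M] by simp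
    qed
  qed
  let ?f = "\<lambda>z. \<Sum>i<M. poly_scale (z ^ i) (a i)"
  \<comment> \<open>Discrete Fourier inversion: all exponents are below \<open>M\<close>, so no
    other coefficient is aliased onto the \<open>k\<close>-th one.\<close>
  have "(\<Sum>j<M. poly_scale (cnj w ^ (j * k)) (?f (of_real r * w ^ j)))
      = (\<Sum>i<M. \<Sum>j<M. poly_scale (of_real r ^ i * (w ^ (j * i) * cnj w ^ (j * k))) (a i))"
    by (subst sum.swap)
      (simp add: poly_scale.scale_sum_right power_mult_distrib power_mult mult.assoc mult.left_commute mult.commute)
  also have "\<dots> = (\<Sum>i<M. poly_scale (of_real r ^ i * (\<Sum>j<M. w ^ (j * i) * cnj w ^ (j * k))) (a i))"
    by (simp add: poly_scale.scale_sum_left sum_distrib_left)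
  also have "\<dots> = (\<Sum>i<M. if i = k then poly_scale (of_real r ^ k * of_nat M) (a k) else 0)"
    by (intro sum.cong) (auto simp: orth)
  also have "\<dots> = poly_scale (of_real r ^ k * of_nat M) (a k)"
    using k by simp
  finally have eq: "(\<Sum>j<M. poly_scale (cnj w ^ (j * k)) (?f (of_real r * w ^ j)))
      = poly_scale (of_real r ^ k * of_nat M) (a k)" .
  have w: "cmod w = 1" by (simp add: w_def)
  have "r ^ k * real M * N (a k) = N (\<Sum>j<M. poly_scale (cnj w ^ (j * k)) (?f (of_real r * w ^ j)))"
    using r by (simp add: eq norm_mult norm_power)
  also have "\<dots> \<le> (\<Sum>j<M. N (poly_scale (cnj w ^ (j * k)) (?f (of_real r * w ^ j))))"
    by (rule sum_le)
  also have "\<dots> \<le> (\<Sum>j<M. B)"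
    by (rule sum_mono) (use r in \<open>simp add: w norm_power norm_mult le\<close>)
  finally show ?thesis using k by (simp add: mult.commute mult.left_commute)
qed

text \<open>The linear coefficient carries the factor \<open>m\<close> that will compensate for a
  circle of radius \<open>r / m\<close>; the constant one serves the induction. The coefficients are
  independent of \<open>z\<close>, as \<open>coefficient_le\<close> requires.\<close>

lemma power_one_plus_expansion:
  "\<exists>c. c 0 = 1 \<and> c 1 = of_nat m * D \<and>
    (\<forall>z. (1 + poly_scale z D) ^ m = (\<Sum>k<Suc m. poly_scale (z ^ k) (c k)))"
proof (induction m)
  case 0
  show ?case by (rule exI[of _ "\<lambda>k. if k = 0 then 1 else 0"]) simp
next
  case (Suc m)
  then obtain c where c: "c 0 = 1" "c 1 = of_nat m * D"
    "\<And>z. (1 + poly_scale z D) ^ m = (\<Sum>k<Suc m. poly_scale (z ^ k) (c k))" by blast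
  \<comment> \<open>Pascal's rule for multiplication by \<open>1 + z D\<close> on the left; the
    first guard drops \<open>c (Suc m)\<close>, which lies outside the expansion given by the
    induction hypothesis.\<close>
  define c' where "c' k = (if k < Suc m then c k else 0) + (if k = 0 then 0 else D * c (k - 1))" for k
  have "(1 + poly_scale z D) ^ Suc m = (\<Sum>k<Suc (Suc m). poly_scale (z ^ k) (c' k))" for z
  proof -
    have "(\<Sum>k<Suc (Suc m). poly_scale (z ^ k) (c' k))
      = (\<Sum>k<Suc (Suc m). poly_scale (z ^ k) (if k < Suc m then c k else 0))
        + (\<Sum>k<Suc (Suc m). poly_scale (z ^ k) (if k = 0 then 0 else D * c (k - 1)))"
      unfolding c'_def by (simp only: poly_scale.scale_right_distrib sum.distrib)
    also have "(\<Sum>k<Suc (Suc m). poly_scale (z ^ k) (if k < Suc m then c k else 0))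
        = (\<Sum>k<Suc m. poly_scale (z ^ k) (c k))"
      by (subst sum.lessThan_Suc) simp
    also have "(\<Sum>k<Suc (Suc m). poly_scale (z ^ k) (if k = 0 then 0 else D * c (k - 1)))
        = (\<Sum>k<Suc m. poly_scale (z ^ Suc k) (D * c k))"
      by (subst sum.lessThan_Suc_shift) simp
    also have "\<dots> = (\<Sum>k<Suc m. poly_scale (z * z ^ k) (D * c k))" by (simp only: power_Suc)
    also have "\<dots> = poly_scale z D * (\<Sum>k<Suc m. poly_scale (z ^ k) (c k))"
      by (simp only: sum_distrib_left poly_scale_mult_left poly_scale_mult_right
          poly_scale.scale_scale mult.commute)
    finally show ?thesis by (simp only: power_Suc c(3) distrib_right mult_1_left)
  qed
  moreover have "c' 0 = 1" by (simp add: c'_def c)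
  moreover have "c' 1 = of_nat (Suc m) * D"
    using c by (cases m) (simp_all add: c'_def algebra_simps)
  ultimately show ?case by blast
qed

text \<open>\<open>1 - s y\<^sup>2\<close> is the average of \<open>1 \<plusminus> i t y - t\<^sup>2 y\<^sup>2 / 2\<close>, the Taylor polynomials of
  the unitaries \<open>exp (\<plusminus> i t y)\<close>, where \<open>t\<^sup>2 = 2 s\<close>.\<close>

lemma one_minus_square_le:
  assumes y: "poly_star y = y" and s: "0 \<le> s"
  shows "N (1 - poly_scale (of_real s) (y * y)) \<le> 1 + s\<^sup>2 * N y ^ 4"
proof -
  define t where "t = sqrt (2 * s)"
  have t: "t * t = 2 * s" using s by (simp add: t_def)
  define V where "V c = 1 + poly_scale (c * of_real t) y - poly_scale (of_real s) (y * y)" for c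
  have *: "N (V c) \<le> 1 + s\<^sup>2 * N y ^ 4" if c: "c = \<i> \<or> c = - \<i>" for c
  proof -
    have cc: "c * c = -1" "cnj c = - c" using c by auto
    \<comment> \<open>The terms of first and second order in \<open>t\<close> cancel, as
      \<open>c\<close> is imaginary and \<open>t * t = 2 * s\<close>; only the term with
      \<open>s\<^sup>2\<close> survives.\<close>
    have "poly_star (V c) * V c = 1 + poly_scale (of_real (s\<^sup>2)) (y * y * (y * y))"
    proof -
      have coeff: "c * of_real t * (c * of_real t) = - 2 * of_real s"
      proof -
        have "c * of_real t * (c * of_real t) = (c * c) * of_real (t * t)" by (simp add: algebra_simps)
        then show ?thesis by (simp add: cc t)
      qed
      define Y where "Y = poly_scale (c * of_real t) y"
      define Z where "Z = poly_scale (of_real s) (y * y)"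
      have star: "poly_star (V c) = 1 - Y - Z"
        using y cc by (simp add: V_def Y_def Z_def)
      have YY: "Y * Y = - Z - Z"
        unfolding Y_def Z_def poly_scale_mult_left poly_scale_mult_right poly_scale.scale_scale coeff
        by (rule poly_mapping_eqI) (simp add: lookup_minus)
      have YZ: "Y * Z = Z * Y"
        unfolding Y_def Z_def by (simp add: poly_scale_mult_left poly_scale_mult_right mult.assoc mult.commute)
      have "(1 - Y - Z) * (1 + Y - Z) = 1 + Z * Z - Y * Y + Y * Z - Z * Y - Z - Z"
        by (simp add: algebra_simps)
      also have "\<dots> = 1 + Z * Z"
        by (simp add: YY YZ)
      finally show ?thesis
        by (simp add: star) (simp add: V_def Y_def Z_def poly_scale_mult_left poly_scale_mult_right power2_eq_square)
    qed
    then have "(N (V c))\<^sup>2 = N (1 + poly_scale (of_real (s\<^sup>2)) (y * y * (y * y)))"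
      by (metis cstar_identity)
    also have "\<dots> \<le> N 1 + N (poly_scale (of_real (s\<^sup>2)) (y * y * (y * y)))" by (rule triangle)
    also have "\<dots> \<le> 1 + s\<^sup>2 * N y ^ 4"
      using power_le[of y 4] one_le
      by (auto intro!: add_mono mult_left_mono simp: power4_eq_xxxx mult.assoc norm_power)
    finally have "(N (V c))\<^sup>2 \<le> 1 + s\<^sup>2 * N y ^ 4" .
    \<comment> \<open>The bound is at least 1, so it may be replaced by its square, which avoids a
      root.\<close>
    also have "\<dots> \<le> (1 + s\<^sup>2 * N y ^ 4)\<^sup>2"
      by (rule self_le_power) simp_all
    finally show ?thesis
      by (rule power2_le_imp_le) simp
  qed
  have "V \<i> + V (- \<i>) = poly_scale 2 (1 - poly_scale (of_real s) (y * y))"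
    by (rule poly_mapping_eqI) (simp add: V_def lookup_add lookup_minus)
  then have "2 * N (1 - poly_scale (of_real s) (y * y)) = N (V \<i> + V (- \<i>))" by simp
  also have "\<dots> \<le> N (V \<i>) + N (V (- \<i>))" by (rule triangle)
  also have "\<dots> \<le> 2 * (1 + s\<^sup>2 * N y ^ 4)" using *[of \<i>] *[of "- \<i>"] by simp
  finally show ?thesis by simp
qed

text \<open>A square root of \<open>D\<close> may exist only in the completion. It is represented
  here by a bounded sequence of self-adjoint polynomials; the estimate for a single square is
  uniform along it and survives the limit.\<close>

lemma one_minus_limit_of_squares_le:
  assumes y: "\<And>k. poly_star (y k) = y k" and bound: "\<And>k. N (y k) \<le> M"
    and lim: "(\<lambda>k. N (D - y k * y k)) \<longlonglongrightarrow> 0" and s: "0 \<le> s"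
  shows "N (1 - poly_scale (of_real s) D) \<le> 1 + M ^ 4 * s\<^sup>2"
proof (rule LIMSEQ_le_const)
  have "(\<lambda>k. 1 + M ^ 4 * s\<^sup>2 + s * N (D - y k * y k)) \<longlonglongrightarrow> 1 + M ^ 4 * s\<^sup>2 + s * 0"
    by (intro tendsto_intros lim)
  then show "(\<lambda>k. 1 + M ^ 4 * s\<^sup>2 + s * N (D - y k * y k)) \<longlonglongrightarrow> 1 + M ^ 4 * s\<^sup>2" by simp
  show "\<exists>K. \<forall>k\<ge>K. N (1 - poly_scale (of_real s) D) \<le> 1 + M ^ 4 * s\<^sup>2 + s * N (D - y k * y k)"
  proof (intro exI allI impI)
    fix k :: nat
    have "N (1 - poly_scale (of_real s) D)
        = N ((1 - poly_scale (of_real s) (y k * y k)) - poly_scale (of_real s) (D - y k * y k))"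
      by (simp add: poly_scale.scale_right_diff_distrib)
    also have "\<dots> \<le> N (1 - poly_scale (of_real s) (y k * y k)) + s * N (D - y k * y k)"
      using triangle_diff[of "1 - poly_scale (of_real s) (y k * y k)" "poly_scale (of_real s) (D - y k * y k)"] s
      by simp
    also have "N (1 - poly_scale (of_real s) (y k * y k)) \<le> 1 + s\<^sup>2 * N (y k) ^ 4"
      by (rule one_minus_square_le[OF y s])
    also have "s\<^sup>2 * N (y k) ^ 4 \<le> s\<^sup>2 * M ^ 4"
      by (intro mult_left_mono power_mono bound) auto
    finally show "N (1 - poly_scale (of_real s) D) \<le> 1 + M ^ 4 * s\<^sup>2 + s * N (D - y k * y k)"
      by (simp add: mult.commute)
  qed
qed

end

section \<open>The Liouville argument and the comparison of projections\<close>

context cstar_seminormed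
begin

text \<open>By the C*-identity the squared norm is that of \<open>1 + 2 Re z D\<close> plus a
  multiple of \<open>(cmod z)\<^sup>2\<close>. The first part is controlled by \<open>pos\<close>
  with \<open>s = - 2 * Re z\<close>. This is the infinitesimal form of \<open>exp (z D)\<close>
  being a contraction on the left half plane.\<close>

lemma one_plus_scale_le:
  assumes D: "poly_star D \<doteq> D"
    and pos: "\<And>s. 0 \<le> s \<Longrightarrow> N (1 - poly_scale (of_real s) D) \<le> 1 + K * s\<^sup>2"
    and K: "0 \<le> K" and z: "Re z \<le> 0"
  shows "N (1 + poly_scale z D) \<le> 1 + (4 * K + (N D)\<^sup>2) * (cmod z)\<^sup>2"
proof -
  let ?L = "1 + (4 * K + (N D)\<^sup>2) * (cmod z)\<^sup>2"
  let ?Y = "poly_scale (of_real ((cmod z)\<^sup>2)) (poly_star D * D)"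
  have "poly_star (1 + poly_scale z D) * (1 + poly_scale z D)
      = 1 + poly_scale z D + poly_scale (cnj z) (poly_star D) + ?Y"
    by (simp add: algebra_simps poly_scale_mult_left poly_scale_mult_right
        complex_norm_square del: of_real_power)
  also have "\<dots> \<doteq> 1 + poly_scale z D + poly_scale (cnj z) D + ?Y"
    by (intro null_cong_add null_cong_scale D null_cong_refl)
  also have "\<dots> = (1 - poly_scale (of_real (- 2 * Re z)) D) + ?Y"
    by (rule poly_mapping_eqI) (simp add: lookup_add lookup_minus complex_eq_iff algebra_simps)
  finally have "(N (1 + poly_scale z D))\<^sup>2 = N ((1 - poly_scale (of_real (- 2 * Re z)) D) + ?Y)"
    using seminorm_cong cstar_identity by metis
  also have "\<dots> \<le> N (1 - poly_scale (of_real (- 2 * Re z)) D) + N ?Y" by (rule triangle)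
  also have "N ?Y = (N D)\<^sup>2 * (cmod z)\<^sup>2"
    by (simp add: cstar_identity norm_power del: of_real_power)
  also have "N (1 - poly_scale (of_real (- 2 * Re z)) D) \<le> 1 + K * (- 2 * Re z)\<^sup>2"
    using z by (intro pos) simp
  \<comment> \<open>The \<open>4 * K\<close> in the constant comes from
    \<open>(2 * Re z)\<^sup>2 \<le> 4 * (cmod z)\<^sup>2\<close>.\<close>
  also have "\<dots> \<le> 1 + K * (4 * (cmod z)\<^sup>2)"
    using K by (intro add_left_mono mult_left_mono) (simp_all add: power_mult_distrib cmod_power2)
  finally have "(N (1 + poly_scale z D))\<^sup>2 \<le> ?L" by (simp add: algebra_simps)
  also have "\<dots> \<le> ?L\<^sup>2" using K by (intro self_le_power) simp_all
  finally show ?thesis using K by (rule_tac power2_le_imp_le) simp_all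
qed

text \<open>An element \<open>D\<close> that is positive in the sense of the assumption \<open>pos\<close>, and that
  anticommutes with \<open>E\<close>, satisfies \<open>E\<^sup>2 D = 0\<close>: since \<open>E\<^sup>2 exp (z D) = E exp (- z D) E\<close>,
  this entire function is bounded on both half planes, hence constant by Liouville's theorem.\<close>

lemma anticommuting_null:
  assumes D: "poly_star D \<doteq> D"
    and pos: "\<And>s. 0 \<le> s \<Longrightarrow> N (1 - poly_scale (of_real s) D) \<le> 1 + K * s\<^sup>2"
    and K: "0 \<le> K"
    and ED: "E * D \<doteq> - (D * E)"
  shows "E * E * D \<doteq> 0"
proof -
  define L where "L = 4 * K + (N D)\<^sup>2"
  have L: "0 \<le> L" using K by (simp add: L_def)
  have le: "N ((1 + poly_scale z D) ^ m) \<le> (1 + L * (cmod z)\<^sup>2) ^ m" if "Re z \<le> 0" for z m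
    using power_mono[OF one_plus_scale_le[OF D pos K that], of m] power_le[of "1 + poly_scale z D" m]
    by (simp add: L_def)
  \<comment> \<open>Polynomial form of \<open>E exp (z D) = exp (- z D) E\<close>.\<close>
  have comm: "E * (1 + poly_scale z D) ^ m \<doteq> (1 + poly_scale (- z) D) ^ m * E" for z m
  proof (induction m)
    case (Suc m)
    have "E * (1 + poly_scale z D) ^ Suc m = (E + poly_scale z (E * D)) * (1 + poly_scale z D) ^ m"
      by (simp add: algebra_simps poly_scale_mult_left poly_scale_mult_right)
    also have "\<dots> \<doteq> (E + poly_scale z (- (D * E))) * (1 + poly_scale z D) ^ m"
      by (intro null_cong_intros ED null_cong_refl)
    also have "\<dots> = (1 + poly_scale (- z) D) * (E * (1 + poly_scale z D) ^ m)"
      by (simp add: algebra_simps poly_scale_mult_left poly_scale_mult_right)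
    also have "\<dots> \<doteq> (1 + poly_scale (- z) D) * ((1 + poly_scale (- z) D) ^ m * E)"
      by (intro null_cong_intros Suc null_cong_refl)
    finally show ?case by (simp add: mult.assoc)
  qed simp
  \<comment> \<open>On the right half plane one of the two factors \<open>E\<close> is moved across
    the power; this flips the sign of \<open>z\<close> and gives access to the bound on the left
    half plane.\<close>
  have bound: "N (E * E * (1 + poly_scale z D) ^ m) \<le> (N E)\<^sup>2 * (1 + L * (cmod z)\<^sup>2) ^ m" for z m
  proof (cases "Re z \<le> 0")
    case True
    have "N (E * E * (1 + poly_scale z D) ^ m) \<le> N (E * E) * N ((1 + poly_scale z D) ^ m)"
      by (rule mult_le)
    also have "\<dots> \<le> (N E)\<^sup>2 * (1 + L * (cmod z)\<^sup>2) ^ m"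
      using mult_le[of E E] le[OF True] by (intro mult_mono) (simp_all add: power2_eq_square)
    finally show ?thesis .
  next
    case False
    have "E * E * (1 + poly_scale z D) ^ m \<doteq> E * ((1 + poly_scale (- z) D) ^ m * E)"
      unfolding mult.assoc by (intro null_cong_mult comm null_cong_refl)
    then have "N (E * E * (1 + poly_scale z D) ^ m) = N (E * ((1 + poly_scale (- z) D) ^ m * E))"
      by (rule seminorm_cong)
    also have "\<dots> \<le> N E * (N ((1 + poly_scale (- z) D) ^ m) * N E)"
      by (intro order_trans[OF mult_le] mult_left_mono mult_le nonneg)
    also have "\<dots> \<le> N E * ((1 + L * (cmod z)\<^sup>2) ^ m * N E)"
      using le[of "- z" m] False by (intro mult_left_mono mult_right_mono) simp_all
    finally show ?thesis by (simp add: power2_eq_square algebra_simps)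
  qed
  have main: "r * N (E * E * D) \<le> (N E)\<^sup>2 * exp 1" if r: "0 < r" for r
  proof -
    \<comment> \<open>A large \<open>m\<close> keeps \<open>(1 + L * (r / m)\<^sup>2) ^ m\<close>
      below \<open>exp 1\<close>; the \<open>max\<close> forces \<open>m\<close> to be
      positive.\<close>
    obtain m :: nat where m: "L * r\<^sup>2 < real m" "0 < m"
      using reals_Archimedean2[of "max 0 (L * r\<^sup>2)"] by auto
    obtain c where c: "c 1 = of_nat m * D"
      "\<And>z. (1 + poly_scale z D) ^ m = (\<Sum>k<Suc m. poly_scale (z ^ k) (c k))"
      using power_one_plus_expansion[of m D] by blast
    have scale_nat: "of_nat m * D = poly_scale (of_nat m) D"
      by (simp add: poly_scale_eq)
    \<comment> \<open>The linear coefficient is \<open>m\<close> times \<open>E * E * D\<close>, so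
      the radius \<open>r / m\<close> leaves exactly the factor \<open>r\<close>.\<close>
    have "(r / m) ^ 1 * N (E * E * c 1) \<le> (N E)\<^sup>2 * exp 1"
    proof (rule coefficient_le[where M = "Suc m" and a = "\<lambda>k. E * E * c k"])
      fix z assume z: "cmod z = r / m"
      have "N (\<Sum>i<Suc m. poly_scale (z ^ i) (E * E * c i)) = N (E * E * (1 + poly_scale z D) ^ m)"
        by (simp only: c(2) sum_distrib_left poly_scale_mult_right)
      also have "\<dots> \<le> (N E)\<^sup>2 * (1 + L * (r / m)\<^sup>2) ^ m"
        using bound[of z m] by (simp add: z)
      also have "(1 + L * (r / m)\<^sup>2) ^ m \<le> exp (L * (r / m)\<^sup>2) ^ m"
        using L by (intro power_mono) auto
      also have "\<dots> = exp (L * r\<^sup>2 / m)"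
        using m by (simp add: power2_eq_square field_simps flip: exp_of_nat_mult)
      also have "\<dots> \<le> exp 1" using m by simp
      finally show "N (\<Sum>i<Suc m. poly_scale (z ^ i) (E * E * c i)) \<le> (N E)\<^sup>2 * exp 1"
        by (simp add: mult_left_mono)
    qed (use r m in auto)
    then show ?thesis
      using m by (simp add: c(1)[unfolded One_nat_def] scale_nat poly_scale_mult_right)
  qed
  have "N (E * E * D) = 0"
  proof (rule ccontr)
    assume "N (E * E * D) \<noteq> 0"
    then have p: "0 < N (E * E * D)" using nonneg[of "E * E * D"] by linarith
    \<comment> \<open>With this radius the left-hand side of \<open>main\<close> exceeds the
      right-hand side by 1.\<close>
    then have "0 < ((N E)\<^sup>2 * exp 1 + 1) / N (E * E * D)"
      by (intro divide_pos_pos) (auto intro: add_nonneg_pos)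
    from main[OF this] p show False by simp
  qed
  then show ?thesis by (simp add: null_iff)
qed

text \<open>For projections \<open>P\<close>, \<open>Q\<close>, the difference \<open>D = Q - P\<close> anticommutes with
  \<open>E = 1 - P - Q\<close>, and \<open>D\<^sup>2 + E\<^sup>2 = 1\<close>.  Hence \<open>D\<^sup>3 = D\<close>, so that \<open>D\<close> acts as \<open>-1\<close>
  on \<open>D\<^sup>2 - D\<close>, which must therefore vanish.\<close>

lemma projection_le:
  assumes P: "poly_star P \<doteq> P" "P * P \<doteq> P" and Q: "poly_star Q \<doteq> Q" "Q * Q \<doteq> Q"
    and K: "0 \<le> K"
    and pos: "\<And>s. 0 \<le> s \<Longrightarrow> N (1 - poly_scale (of_real s) (Q - P)) \<le> 1 + K * s\<^sup>2"
  shows "Q * P \<doteq> P"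
proof -
  \<comment> \<open>\<open>p\<close> and \<open>q\<close> are the defects of idempotence; with them
    the identities below hold exactly in the polynomial ring.\<close>
  define D E p q where "D = Q - P" and "E = 1 - P - Q" and "p = P * P - P" and "q = Q * Q - Q"
  have p: "p \<doteq> 0" and q: "q \<doteq> 0"
    using P Q by (simp_all add: p_def q_def flip: null_cong_iff)
  have D: "poly_star D \<doteq> D" unfolding D_def using P Q by (simp add: null_cong_diff)
  have "E * D - (- (D * E)) = (p + p) - (q + q)"
    by (simp add: D_def E_def p_def q_def algebra_simps)
  also have "\<dots> \<doteq> (0 + 0) - (0 + 0)" by (intro null_cong_intros p q)
  finally have ED: "E * D \<doteq> - (D * E)" by (subst null_cong_iff) simp
  have EED: "E * E * D \<doteq> 0"
    using anticommuting_null[OF D _ K ED] pos by (simp add: D_def)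
  have "D * D * D - D = ((p + p) + (q + q)) * D - E * E * D"
    by (simp add: D_def E_def p_def q_def algebra_simps)
  also have "\<dots> \<doteq> ((0 + 0) + (0 + 0)) * D - 0" by (intro null_cong_intros p q EED null_cong_refl)
  finally have D3: "D * D * D - D \<doteq> 0" by simp
  define R where "R = D * D - D"
  have "R \<doteq> 0"
  proof -
    \<comment> \<open>Any \<open>s > 0\<close> with \<open>K * s < 1\<close> would do:
      \<open>1 - s D\<close> acts on \<open>R\<close> as \<open>1 + s\<close>, whereas its norm is
      at most \<open>1 + K * s\<^sup>2\<close>.\<close>
    define s where "s = 1 / (K + 1)"
    have s: "0 < s" using K by (simp add: s_def)
    have "(1 - poly_scale (of_real s) D) * R = poly_scale (of_real (1 + s)) R - poly_scale (of_real s) (D * D * D - D)"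
      by (simp add: R_def algebra_simps poly_scale_mult_left poly_scale_mult_right
          poly_scale.scale_left_distrib poly_scale.scale_right_diff_distrib)
    also have "\<dots> \<doteq> poly_scale (of_real (1 + s)) R - poly_scale (of_real s) 0"
      by (intro null_cong_intros D3 null_cong_refl)
    finally have "N ((1 - poly_scale (of_real s) D) * R) = N (poly_scale (of_real (1 + s)) R)"
      by (simp add: seminorm_cong)
    also have "\<dots> = (1 + s) * N R" using s by (simp del: of_real_add)
    finally have "(1 + s) * N R \<le> N (1 - poly_scale (of_real s) D) * N R"
      using mult_le by metis
    also have "\<dots> \<le> (1 + K * s\<^sup>2) * N R"
      using pos[of s] s by (intro mult_right_mono) (auto simp: D_def)
    finally have "s * N R \<le> s * (K * s * N R)" by (simp add: algebra_simps power2_eq_square)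
    then have "N R \<le> K * s * N R" using s by simp
    then have "(K + 1) * N R \<le> K * N R" using K by (simp add: s_def field_simps)
    then have "N R \<le> 0" by (simp add: algebra_simps)
    then show ?thesis using nonneg[of R] by (simp add: null_cong_def)
  qed
  \<comment> \<open>Compressing \<open>R\<close> by \<open>P\<close> leaves twice
    \<open>P - P * Q * P\<close>, which is also \<open>poly_star (P - Q * P) * (P - Q * P)\<close>
    modulo null elements; the C*-identity then applies.\<close>
  then have "P * R * P \<doteq> 0" by (intro null_mult_left null_mult_right)
  then have "0 \<doteq> P * R * P" by (rule null_cong_sym)
  also have "P * R * P = P * (Q * Q) * P - P * Q * (P * P) - (P * P) * Q * P + (P * P) * (P * P)
      - P * Q * P + (P * P) * P"
    by (simp add: R_def D_def algebra_simps)
  also have "\<dots> \<doteq> P * Q * P - P * Q * P - P * Q * P + P * P - P * Q * P + P * P"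
    by (intro null_cong_intros P Q null_cong_refl)
  also have "\<dots> \<doteq> P * Q * P - P * Q * P - P * Q * P + P - P * Q * P + P"
    by (intro null_cong_add null_cong_diff P null_cong_refl)
  also have "\<dots> = poly_scale 2 (P - P * Q * P)"
    by (rule poly_mapping_eqI) (simp add: lookup_add lookup_minus)
  finally have "N (poly_scale 2 (P - P * Q * P)) = 0"
    using seminorm_cong by fastforce
  then have PQP: "P - P * Q * P \<doteq> 0" by (simp add: null_iff)
  have "poly_star (P - Q * P) * (P - Q * P) = (poly_star P - poly_star P * poly_star Q) * (P - Q * P)"
    by simp
  also have "\<dots> \<doteq> (P - P * Q) * (P - Q * P)"
    by (intro null_cong_intros P Q null_cong_refl)
  also have "\<dots> = P * P - P * Q * P - P * Q * P + P * (Q * Q) * P"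
    by (simp add: algebra_simps)
  also have "\<dots> \<doteq> P - P * Q * P - P * Q * P + P * Q * P"
    by (intro null_cong_intros P Q null_cong_refl)
  also have "\<dots> = P - P * Q * P" by simp
  also note PQP
  finally have "P - Q * P \<doteq> 0" by (rule star_mult_self_null)
  then have "P \<doteq> Q * P" by (simp flip: null_cong_iff)
  then show ?thesis by (rule null_cong_sym)
qed

end

section \<open>Passing from the non-unital algebra to all polynomials\<close>

text \<open>The operator norm of left multiplication by \<open>y\<close> on the non-unital algebra extends a
  C*-seminorm to all polynomials.  Generators outside \<open>X\<close> are sent to zero first.\<close>

lemma cstar_seminorm_extension:
  assumes q: "cstar_seminorm (free_star_alg X) q"
  obtains N where "cstar_seminormed N" "\<And>x. x \<in> free_star_alg X \<Longrightarrow> N x = q x"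
proof -
  define A where "A = free_star_alg X"
  note q = q[folded A_def]
  have nonneg: "0 \<le> q x" and triangle: "y \<in> A \<Longrightarrow> q (x + y) \<le> q x + q y"
    and scale: "q (poly_scale c x) = cmod c * q x" and mult: "y \<in> A \<Longrightarrow> q (x * y) \<le> q x * q y"
    and cstar: "q (poly_star x * x) = (q x)\<^sup>2"
    if "x \<in> A" for x y c
    using q that by (auto simp: cstar_seminorm_def)
  have [simp]: "0 \<in> A" "x \<in> A \<Longrightarrow> y \<in> A \<Longrightarrow> x + y \<in> A" "x \<in> A \<Longrightarrow> y \<in> A \<Longrightarrow> x * y \<in> A"
    "x \<in> A \<Longrightarrow> poly_scale c x \<in> A" "x \<in> A \<Longrightarrow> poly_star x \<in> A" for x y c
    by (simp_all add: A_def)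
  have q0: "q 0 = 0" using scale[of 0 0] by simp
  have star: "q (poly_star x) = q x" if "x \<in> A" for x
  proof -
    have *: "q x \<le> q (poly_star x)" if x: "x \<in> A" for x
    proof (cases "q x = 0")
      case False
      have "q x * q x \<le> q (poly_star x) * q x"
        using mult[of "poly_star x" x] x by (simp add: cstar power2_eq_square)
      with False show ?thesis
        by (metis mult_le_cancel_right nonneg order_le_less not_less x)
    qed (use nonneg that x in simp)
    show ?thesis using *[of x] *[of "poly_star x"] that by simp
  qed
  \<comment> \<open>The left multipliers that are bounded on \<open>A\<close>. They form an algebra
    containing \<open>A\<close> and \<open>1\<close>, hence every polynomial in the generators from
    \<open>X\<close>.\<close>
  define M where "M = {y. \<exists>C. \<forall>a\<in>A. y * a \<in> A \<and> q (y * a) \<le> C * q a}"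
  have MA: "y * a \<in> A" if "y \<in> M" "a \<in> A" for y a
    using that by (auto simp: M_def)
  have M_scale: "poly_scale c y \<in> M" if y: "y \<in> M" for c y
  proof -
    obtain C where C: "\<And>a. a \<in> A \<Longrightarrow> y * a \<in> A \<and> q (y * a) \<le> C * q a" using y by (auto simp: M_def)
    have "\<forall>a\<in>A. poly_scale c y * a \<in> A \<and> q (poly_scale c y * a) \<le> (cmod c * C) * q a"
      using C by (simp add: poly_scale_mult_left scale mult.assoc mult_left_mono)
    then show ?thesis unfolding M_def by blast
  qed
  have M_add: "y + z \<in> M" if y: "y \<in> M" and z: "z \<in> M" for y z
  proof -
    obtain C where C: "\<And>a. a \<in> A \<Longrightarrow> y * a \<in> A \<and> q (y * a) \<le> C * q a" using y by (auto simp: M_def)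
    obtain C' where C': "\<And>a. a \<in> A \<Longrightarrow> z * a \<in> A \<and> q (z * a) \<le> C' * q a" using z by (auto simp: M_def)
    have "(y + z) * a \<in> A \<and> q ((y + z) * a) \<le> (C + C') * q a" if "a \<in> A" for a
      using C[OF that] C'[OF that] triangle[of "y * a" "z * a"] by (simp add: distrib_right)
    then show ?thesis unfolding M_def by blast
  qed
  have M_mult: "y * z \<in> M" if y: "y \<in> M" and z: "z \<in> M" for y z
  proof -
    obtain C where C: "\<And>a. a \<in> A \<Longrightarrow> y * a \<in> A \<and> q (y * a) \<le> C * q a" using y by (auto simp: M_def)
    obtain C' where C': "\<And>a. a \<in> A \<Longrightarrow> z * a \<in> A \<and> q (z * a) \<le> C' * q a" using z by (auto simp: M_def)
    have "y * z * a \<in> A \<and> q (y * z * a) \<le> (\<bar>C\<bar> * C') * q a" if a: "a \<in> A" for a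
    proof -
      have "q (y * (z * a)) \<le> C * q (z * a)" using C C' a by blast
      also have "\<dots> \<le> \<bar>C\<bar> * q (z * a)" using C' a nonneg by (intro mult_right_mono) auto
      also have "\<dots> \<le> \<bar>C\<bar> * (C' * q a)" using C' a by (intro mult_left_mono) auto
      finally show ?thesis using C C' a by (simp add: mult.assoc)
    qed
    then show ?thesis unfolding M_def by blast
  qed
  have M_A: "y \<in> M" if "y \<in> A" for y
    unfolding M_def using that mult[of y] by auto
  have M_1: "1 \<in> M" by (auto simp: M_def intro!: exI[of _ 1])
  have M_0: "0 \<in> M" by (rule M_A) simp
  define \<kappa> where "\<kappa> = poly_subst (\<lambda>g. if g \<in> X then gen g else 0)"
  have \<kappa>_hom [simp]: "\<kappa> (x + y) = \<kappa> x + \<kappa> y" "\<kappa> (poly_scale c x) = poly_scale c (\<kappa> x)"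
    "\<kappa> (x * y) = \<kappa> x * \<kappa> y" "\<kappa> (poly_star x) = poly_star (\<kappa> x)" for x y c
    by (simp_all add: \<kappa>_def)
  have \<kappa>_A: "\<kappa> x = x" if "x \<in> A" for x
    using that unfolding \<kappa>_def A_def by (rule poly_subst_id) simp
  have \<kappa>_M: "\<kappa> x \<in> M" for x
  proof (induction x rule: poly_mapping_add_induct)
    case zero
    then show ?case by (simp add: \<kappa>_def M_0)
  next
    case (add x y)
    then show ?case by (simp add: M_add)
  next
    case (single u c)
    have "prod_list (map (\<lambda>(g, b). if b then poly_star (if g \<in> X then gen g else 0)
        else if g \<in> X then gen g else 0) l) \<in> M" for l
    proof (induction l)
      case (Cons a l)
      have "(case a of (g, b) \<Rightarrow> if b then poly_star (if g \<in> X then gen g else 0)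
          else if g \<in> X then gen g else 0) \<in> M"
        by (rule M_A) (simp add: A_def split: prod.split)
      from M_mult[OF this Cons] show ?case by simp
    qed (simp add: M_1)
    then show ?case by (simp add: \<kappa>_def word_eval_def M_scale)
  qed
  define B where "B = {a \<in> A. q a \<le> 1}"
  define opn where "opn y = (SUP a\<in>B. q (y * a))" for y
  have B0: "0 \<in> B" by (simp add: B_def q0)
  have bdd: "bdd_above ((\<lambda>a. q (y * a)) ` B)" if y: "y \<in> M" for y
  proof -
    obtain C where C: "\<And>a. a \<in> A \<Longrightarrow> y * a \<in> A \<and> q (y * a) \<le> C * q a" using y by (auto simp: M_def)
    have "q (y * a) \<le> \<bar>C\<bar>" if "a \<in> B" for a
    proof -
      have "q (y * a) \<le> C * q a" using C that by (auto simp: B_def)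
      also have "\<dots> \<le> \<bar>C\<bar> * 1" using that nonneg by (intro mult_mono) (auto simp: B_def)
      finally show ?thesis by simp
    qed
    then show ?thesis by (auto intro!: bdd_aboveI2)
  qed
  have opn_upper: "q (y * a) \<le> opn y" if "y \<in> M" "a \<in> B" for y a
    unfolding opn_def using that bdd by (intro cSUP_upper) auto
  have opn_least: "opn y \<le> C" if "\<And>a. a \<in> B \<Longrightarrow> q (y * a) \<le> C" for y C
    unfolding opn_def using that B0 by (intro cSUP_least) auto
  have opn_nonneg: "0 \<le> opn y" if "y \<in> M" for y
    using opn_upper[OF that B0] by (simp add: q0)
  have opn_mult: "q (y * a) \<le> opn y * q a" if y: "y \<in> M" and a: "a \<in> A" for y a
  proof (cases "q a = 0")
    case True
    \<comment> \<open>\<open>a\<close> cannot be normalised in this case, but any multiplier bound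
      already forces the value to vanish.\<close>
    obtain C where "q (y * a) \<le> C * q a" using y a by (auto simp: M_def)
    with True show ?thesis by simp
  next
    case False
    with nonneg[OF a] have pos: "0 < q a" by simp
    have "poly_scale (of_real (1 / q a)) a \<in> B"
      using a pos by (simp add: B_def scale norm_divide del: of_real_divide)
    from opn_upper[OF y this] show ?thesis
      using pos MA[OF y a] by (simp add: poly_scale_mult_right scale norm_divide field_simps del: of_real_divide)
  qed
  define N where "N x = opn (\<kappa> x)" for x
  \<comment> \<open>As for operators on a Hilbert space: the square of
    \<open>q (\<kappa> x * a)\<close> is the norm of \<open>a\<close> star times \<open>x\<close>
    star \<open>x\<close> times \<open>a\<close>, and \<open>a\<close> has norm at most 1.\<close>
  have N_cstar_le: "(N x)\<^sup>2 \<le> N (poly_star x * x)" for x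
  proof -
    have "q (\<kappa> x * a) \<le> sqrt (N (poly_star x * x))" if a: "a \<in> B" for a
    proof (rule real_le_rsqrt)
      have aA: "a \<in> A" and qa: "q a \<le> 1" "0 \<le> q a" using a nonneg by (auto simp: B_def)
      have *: "\<kappa> x * a \<in> A" "\<kappa> (poly_star x * x) * a \<in> A" using MA[OF \<kappa>_M aA] by blast+
      have "(q (\<kappa> x * a))\<^sup>2 = q (poly_star a * (\<kappa> (poly_star x * x) * a))"
        using cstar[OF *(1)] by (simp add: mult.assoc)
      also have "\<dots> \<le> q (poly_star a) * q (\<kappa> (poly_star x * x) * a)"
        using mult aA * by simp
      also have "\<dots> \<le> 1 * q (\<kappa> (poly_star x * x) * a)"
        using qa nonneg[OF *(2)] by (intro mult_right_mono) (simp_all add: star[OF aA])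
      also have "\<dots> \<le> N (poly_star x * x)"
        using opn_upper[OF \<kappa>_M a] by (simp only: N_def mult_1)
      finally show "(q (\<kappa> x * a))\<^sup>2 \<le> N (poly_star x * x)" .
    qed
    then have "N x \<le> sqrt (N (poly_star x * x))" unfolding N_def[of x] by (rule opn_least)
    moreover have "0 \<le> N x" "0 \<le> N (poly_star x * x)" unfolding N_def by (rule opn_nonneg, rule \<kappa>_M)+
    ultimately show ?thesis by (metis power_mono real_sqrt_pow2)
  qed
  have N_mult: "N (x * y) \<le> N x * N y" for x y
    unfolding N_def
  proof (rule opn_least)
    fix a assume a: "a \<in> B"
    then have aA: "a \<in> A" by (simp add: B_def)
    have "q (\<kappa> x * (\<kappa> y * a)) \<le> opn (\<kappa> x) * q (\<kappa> y * a)" by (intro opn_mult \<kappa>_M MA aA)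
    also have "\<dots> \<le> opn (\<kappa> x) * opn (\<kappa> y)"
      by (intro mult_left_mono opn_upper opn_nonneg \<kappa>_M a)
    finally show "q (\<kappa> (x * y) * a) \<le> opn (\<kappa> x) * opn (\<kappa> y)" by (simp add: mult.assoc)
  qed
  have N_nonneg: "0 \<le> N x" for x unfolding N_def by (intro opn_nonneg \<kappa>_M)
  have N_add: "N (x + y) \<le> N x + N y" for x y
    unfolding N_def
  proof (rule opn_least)
    fix a assume a: "a \<in> B"
    then have aA: "a \<in> A" by (simp add: B_def)
    have "q (\<kappa> x * a + \<kappa> y * a) \<le> q (\<kappa> x * a) + q (\<kappa> y * a)" by (intro triangle MA \<kappa>_M aA)
    also have "\<dots> \<le> opn (\<kappa> x) + opn (\<kappa> y)" by (intro add_mono opn_upper \<kappa>_M a)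
    finally show "q (\<kappa> (x + y) * a) \<le> opn (\<kappa> x) + opn (\<kappa> y)" by (simp add: distrib_right)
  qed
  have N_scale_le: "N (poly_scale c x) \<le> cmod c * N x" for c x
    unfolding N_def
  proof (rule opn_least)
    fix a assume a: "a \<in> B"
    then have aA: "a \<in> A" by (simp add: B_def)
    show "q (\<kappa> (poly_scale c x) * a) \<le> cmod c * opn (\<kappa> x)"
      using opn_upper[OF \<kappa>_M a, of x] MA[OF \<kappa>_M aA, of x]
      by (simp add: poly_scale_mult_left scale mult_left_mono)
  qed
  have N_scale: "N (poly_scale c x) = cmod c * N x" for c x
  proof (cases "c = 0")
    case True
    then show ?thesis using N_scale_le[of 0 x] N_nonneg[of "poly_scale 0 x"] by simp
  next
    case False
    then have "N x \<le> cmod (1 / c) * N (poly_scale c x)"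
      using N_scale_le[of "1 / c" "poly_scale c x"] by simp
    then have "cmod c * N x \<le> N (poly_scale c x)"
      using False by (simp add: norm_divide field_simps)
    then show ?thesis using N_scale_le[of c x] by simp
  qed
  have N_star_le: "N x \<le> N (poly_star x)" for x
  proof (cases "N x = 0")
    case False
    have "N x * N x \<le> N (poly_star x) * N x"
      using N_cstar_le[of x] N_mult[of "poly_star x" x] by (simp add: power2_eq_square)
    with False show ?thesis
      by (metis mult_le_cancel_right N_nonneg order_le_less not_less)
  qed (simp add: N_nonneg)
  have N_star: "N (poly_star x) = N x" for x
    using N_star_le[of x] N_star_le[of "poly_star x"] by simp
  have N_cstar: "N (poly_star x * x) = (N x)\<^sup>2" for x
    using N_cstar_le[of x] N_mult[of "poly_star x" x] by (simp add: power2_eq_square N_star)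
  have "cstar_seminormed N"
    by standard (simp add: cstar_seminorm_def N_nonneg N_add N_scale N_mult N_cstar)
  moreover have "N x = q x" if x: "x \<in> free_star_alg X" for x
  proof (rule antisym)
    have xA: "x \<in> A" using x by (simp add: A_def)
    have "q (x * a) \<le> q x" if "a \<in> B" for a
    proof -
      have "q (x * a) \<le> q x * q a" using mult[OF xA] that by (auto simp: B_def)
      also have "\<dots> \<le> q x * 1" using that nonneg[OF xA] by (intro mult_left_mono) (auto simp: B_def)
      finally show ?thesis by simp
    qed
    then show "N x \<le> q x" unfolding N_def \<kappa>_A[OF xA] by (rule opn_least)
    show "q x \<le> N x"
    proof (cases "q x = 0")
      case False
      with nonneg[OF xA] have pos: "0 < q x" by simp
      \<comment> \<open>Left multiplication by \<open>x\<close> attains its norm at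
        \<open>poly_star x\<close>, by the C*-identity.\<close>
      have "q (x * poly_star x) \<le> N x * q (poly_star x)"
        using opn_mult[OF M_A[OF xA], of "poly_star x"] xA by (simp add: N_def \<kappa>_A)
      moreover have "q (x * poly_star x) = q x * q x"
        using cstar[of "poly_star x"] xA by (simp add: star power2_eq_square)
      ultimately show ?thesis using pos xA by (simp add: star)
    qed (simp add: N_nonneg)
  qed
  ultimately show thesis by (rule that)
qed

section \<open>Completions\<close>

context cstar_seminormed
begin

lemma abs_diff_le: "\<bar>N x - N y\<bar> \<le> N (x - y)"
  using triangle[of "x - y" y] triangle[of "y - x" x] by (simp add: minus_commute)

end

text \<open>The completion is built from \<open>q\<close>, which is controlled only on polynomials
  without constant term; \<open>N\<close> extends it and satisfies the laws everywhere, in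
  particular for expressions with \<open>1\<close>.\<close>

locale cstar_completion = cstar_seminormed N for N :: "'g star_poly \<Rightarrow> real" +
  fixes X :: "'g set" and q :: "'g star_poly \<Rightarrow> real"
  assumes agree: "x \<in> free_star_alg X \<Longrightarrow> q x = N x"
begin

abbreviation A where "A \<equiv> free_star_alg X"
abbreviation C where "C \<equiv> completion A q"
abbreviation cl where "cl \<equiv> seq_class A q"
abbreviation emb where "emb \<equiv> embed A q"

lemma cauchy_seqs_iff:
  "x \<in> cauchy_seqs A q \<longleftrightarrow>
    (\<forall>n. x n \<in> A) \<and> (\<forall>\<epsilon>>0. \<exists>K. \<forall>m\<ge>K. \<forall>n\<ge>K. N (x m - x n) < \<epsilon>)"
  unfolding cauchy_seqs_def by (auto simp: agree)

lemma cauchy_seqs_in [simp]: "x \<in> cauchy_seqs A q \<Longrightarrow> x n \<in> A"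
  by (simp add: cauchy_seqs_iff)

lemma null_rel_iff:
  "(x, y) \<in> null_rel A q \<longleftrightarrow>
    x \<in> cauchy_seqs A q \<and> y \<in> cauchy_seqs A q \<and> (\<lambda>n. N (x n - y n)) \<longlonglongrightarrow> 0"
  unfolding null_rel_def by (auto simp: agree cauchy_seqs_iff)

lemma null_seq_le: "(\<And>n. N (x n) \<le> g n) \<Longrightarrow> g \<longlonglongrightarrow> 0 \<Longrightarrow> (\<lambda>n. N (x n)) \<longlonglongrightarrow> 0"
  by (rule tendsto_sandwich[of "\<lambda>n. 0" _ _ g]) simp_all

lemma null_seq_add:
  "(\<lambda>n. N (x n)) \<longlonglongrightarrow> 0 \<Longrightarrow> (\<lambda>n. N (y n)) \<longlonglongrightarrow> 0 \<Longrightarrow> (\<lambda>n. N (x n + y n)) \<longlonglongrightarrow> 0"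
  by (rule null_seq_le[where g = "\<lambda>n. N (x n) + N (y n)"])
    (auto intro!: triangle tendsto_add_zero)

lemma equiv_null_rel: "equiv (cauchy_seqs A q) (null_rel A q)"
proof (rule equivI)
  show "null_rel A q \<subseteq> cauchy_seqs A q \<times> cauchy_seqs A q"
    by (auto simp: null_rel_def)
  show "refl_on (cauchy_seqs A q) (null_rel A q)"
    by (auto simp: refl_on_def null_rel_iff)
  show "sym (null_rel A q)"
    by (auto simp: sym_def null_rel_iff minus_commute)
  show "trans (null_rel A q)"
  proof (rule transI)
    fix x y z assume "(x, y) \<in> null_rel A q" "(y, z) \<in> null_rel A q"
    then show "(x, z) \<in> null_rel A q"
      using null_seq_add[of "\<lambda>n. x n - y n" "\<lambda>n. y n - z n"] by (auto simp: null_rel_iff)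
  qed
qed

lemma carrier_C: "carrier C = cauchy_seqs A q // null_rel A q"
  by (simp add: completion_def)

lemma cl_carrier [simp]: "x \<in> cauchy_seqs A q \<Longrightarrow> cl x \<in> carrier C"
  by (auto simp: carrier_C seq_class_def intro: quotientI)

lemma cl_eq_iff:
  "x \<in> cauchy_seqs A q \<Longrightarrow> y \<in> cauchy_seqs A q \<Longrightarrow>
    cl x = cl y \<longleftrightarrow> (\<lambda>n. N (x n - y n)) \<longlonglongrightarrow> 0"
  unfolding seq_class_def by (subst eq_equiv_class_iff[OF equiv_null_rel]) (auto simp: null_rel_iff)

lemma seq_rep:
  assumes "K \<in> carrier C"
  shows "seq_rep K \<in> cauchy_seqs A q" and "cl (seq_rep K) = K"
proof -
  have K: "K \<in> cauchy_seqs A q // null_rel A q" using assms by (simp add: carrier_C)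
  then have "seq_rep K \<in> K"
    unfolding seq_rep_def by (rule some_in_eq[THEN iffD2, OF in_quotient_imp_non_empty[OF equiv_null_rel]])
  with K show "seq_rep K \<in> cauchy_seqs A q" "cl (seq_rep K) = K"
    using in_quotient_imp_subset[OF equiv_null_rel K] equiv_null_rel
    by (auto simp: seq_class_def elim!: quotientE dest: equiv_class_eq)
qed

lemma carrier_cases:
  assumes "K \<in> carrier C"
  obtains x where "x \<in> cauchy_seqs A q" "K = cl x"
  using seq_rep[OF assms] by metis

text \<open>The operations of \<open>completion\<close> act on chosen representatives. They are
  independent of the choice because the chosen sequence differs from the given one by a null
  sequence.\<close>

lemma seq_rep_cl:
  assumes "x \<in> cauchy_seqs A q"
  shows "seq_rep (cl x) \<in> cauchy_seqs A q" "(\<lambda>n. N (seq_rep (cl x) n - x n)) \<longlonglongrightarrow> 0"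
  using seq_rep[OF cl_carrier[OF assms]] cl_eq_iff assms by blast+

lemma cauchy_seqs_bounded:
  assumes "x \<in> cauchy_seqs A q"
  obtains M where "0 < M" "\<And>n. N (x n) \<le> M"
proof -
  have "Cauchy (\<lambda>n. N (x n))"
    unfolding Cauchy_def dist_real_def
    using assms abs_diff_le unfolding cauchy_seqs_iff by (meson order_le_less_trans)
  then obtain M where "0 < M" "\<And>n. norm (N (x n)) \<le> M"
    using Bseq_def[of "\<lambda>n. N (x n)"] Cauchy_Bseq by blast
  then show thesis by (intro that[of M]) (simp_all add: abs_le_iff)
qed

lemma cauchy_seqs_const [simp]: "x \<in> A \<Longrightarrow> (\<lambda>n. x) \<in> cauchy_seqs A q"
  by (simp add: cauchy_seqs_iff)

text \<open>A common criterion for sums, scalings, adjoints and products; the unary operations use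
  it with \<open>d = 0\<close>.\<close>

lemma cauchy_seqs_dominated:
  assumes x: "x \<in> cauchy_seqs A q" and y: "y \<in> cauchy_seqs A q" and z: "\<And>n. z n \<in> A"
    and le: "\<And>m n. N (z m - z n) \<le> c * N (x m - x n) + d * N (y m - y n)"
    and c: "0 \<le> c" and d: "0 \<le> d"
  shows "z \<in> cauchy_seqs A q"
  unfolding cauchy_seqs_iff
proof (intro conjI allI impI)
  fix \<epsilon> :: real assume \<epsilon>: "0 < \<epsilon>"
  \<comment> \<open>The extra 1 in the denominator covers \<open>c = d = 0\<close> and makes the
    final inequality strict.\<close>
  define \<delta> where "\<delta> = \<epsilon> / (c + d + 1)"
  have \<delta>: "0 < \<delta>" using \<epsilon> c d by (simp add: \<delta>_def)
  obtain K where K: "\<And>m n. m \<ge> K \<Longrightarrow> n \<ge> K \<Longrightarrow> N (x m - x n) < \<delta>"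
    using x \<delta> unfolding cauchy_seqs_iff by meson
  obtain L where L: "\<And>m n. m \<ge> L \<Longrightarrow> n \<ge> L \<Longrightarrow> N (y m - y n) < \<delta>"
    using y \<delta> unfolding cauchy_seqs_iff by meson
  show "\<exists>K. \<forall>m\<ge>K. \<forall>n\<ge>K. N (z m - z n) < \<epsilon>"
  proof (intro exI[of _ "max K L"] allI impI)
    fix m n assume "max K L \<le> m" "max K L \<le> n"
    then have "c * N (x m - x n) + d * N (y m - y n) \<le> c * \<delta> + d * \<delta>"
      using K[of m n] L[of m n] c d by (intro add_mono mult_left_mono) auto
    also have "\<dots> < (c + d + 1) * \<delta>" using \<delta> by (simp add: algebra_simps)
    also have "\<dots> = \<epsilon>" using c d by (simp add: \<delta>_def)
    finally show "N (z m - z n) < \<epsilon>" using le[of m n] by simp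
  qed
qed (rule z)

lemma cauchy_seqs_add [simp]:
  assumes "x \<in> cauchy_seqs A q" "y \<in> cauchy_seqs A q"
  shows "(\<lambda>n. x n + y n) \<in> cauchy_seqs A q"
proof (rule cauchy_seqs_dominated[OF assms, of _ 1 1])
  fix m n
  show "N ((x m + y m) - (x n + y n)) \<le> 1 * N (x m - x n) + 1 * N (y m - y n)"
    using triangle[of "x m - x n" "y m - y n"] by (simp add: algebra_simps)
qed (use assms in simp_all)

lemma cauchy_seqs_scale [simp]:
  assumes "x \<in> cauchy_seqs A q"
  shows "(\<lambda>n. poly_scale c (x n)) \<in> cauchy_seqs A q"
  by (rule cauchy_seqs_dominated[OF assms assms, of _ "cmod c" 0])
    (use assms in \<open>simp_all flip: poly_scale.scale_right_diff_distrib\<close>)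

lemma cauchy_seqs_star [simp]:
  assumes "x \<in> cauchy_seqs A q"
  shows "(\<lambda>n. poly_star (x n)) \<in> cauchy_seqs A q"
  by (rule cauchy_seqs_dominated[OF assms assms, of _ 1 0])
    (use assms in \<open>simp_all flip: poly_star_diff\<close>)

lemma cauchy_seqs_mult [simp]:
  assumes x: "x \<in> cauchy_seqs A q" and y: "y \<in> cauchy_seqs A q"
  shows "(\<lambda>n. x n * y n) \<in> cauchy_seqs A q"
proof -
  obtain M where M: "0 < M" "\<And>n. N (x n) \<le> M" using cauchy_seqs_bounded[OF x] by blast
  obtain M' where M': "0 < M'" "\<And>n. N (y n) \<le> M'" using cauchy_seqs_bounded[OF y] by blast
  show ?thesis
  proof (rule cauchy_seqs_dominated[OF x y, of _ M' M])
    fix m n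
    have "N (x m * y m - x n * y n) = N ((x m - x n) * y m + x n * (y m - y n))"
      by (simp add: algebra_simps)
    also have "\<dots> \<le> N (x m - x n) * N (y m) + N (x n) * N (y m - y n)"
      by (intro order_trans[OF triangle] add_mono mult_le)
    also have "\<dots> \<le> N (x m - x n) * M' + M * N (y m - y n)"
      by (intro add_mono mult_left_mono mult_right_mono M M') simp_all
    finally show "N (x m * y m - x n * y n) \<le> M' * N (x m - x n) + M * N (y m - y n)"
      by (simp add: mult.commute)
  qed (use x y M M' in auto)
qed

lemma null_seq_mult:
  assumes x: "x \<in> cauchy_seqs A q" and x': "x' \<in> cauchy_seqs A q"
    and y: "y \<in> cauchy_seqs A q" and y': "y' \<in> cauchy_seqs A q"
    and xx': "(\<lambda>n. N (x' n - x n)) \<longlonglongrightarrow> 0" and yy': "(\<lambda>n. N (y' n - y n)) \<longlonglongrightarrow> 0"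
  shows "(\<lambda>n. N (x' n * y' n - x n * y n)) \<longlonglongrightarrow> 0"
proof -
  obtain M where M: "0 < M" "\<And>n. N (x n) \<le> M" using cauchy_seqs_bounded[OF x] by blast
  obtain M' where M': "0 < M'" "\<And>n. N (y' n) \<le> M'" using cauchy_seqs_bounded[OF y'] by blast
  show ?thesis
  proof (rule null_seq_le[where g = "\<lambda>n. N (x' n - x n) * M' + M * N (y' n - y n)"])
    show "N (x' n * y' n - x n * y n) \<le> N (x' n - x n) * M' + M * N (y' n - y n)" for n
    proof -
      have "N (x' n * y' n - x n * y n) = N ((x' n - x n) * y' n + x n * (y' n - y n))"
        by (simp add: algebra_simps)
      also have "\<dots> \<le> N (x' n - x n) * N (y' n) + N (x n) * N (y' n - y n)"
        by (intro order_trans[OF triangle] add_mono mult_le)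
      also have "\<dots> \<le> N (x' n - x n) * M' + M * N (y' n - y n)"
        by (intro add_mono mult_left_mono mult_right_mono M M') simp_all
      finally show ?thesis .
    qed
    show "(\<lambda>n. N (x' n - x n) * M' + M * N (y' n - y n)) \<longlonglongrightarrow> 0"
      by (intro tendsto_add_zero tendsto_mult_left_zero tendsto_mult_right_zero xx' yy')
  qed
qed

section \<open>Operations and order in the completion, on classes and on embedded
  polynomials\<close>

lemma cadd_cl [simp]:
  assumes "x \<in> cauchy_seqs A q" "y \<in> cauchy_seqs A q"
  shows "cadd C (cl x) (cl y) = cl (\<lambda>n. x n + y n)"
  using null_seq_add[OF seq_rep_cl(2)[OF assms(1)] seq_rep_cl(2)[OF assms(2)]] assms
  by (simp add: completion_def cl_eq_iff seq_rep_cl add_diff_add)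

lemma cscale_cl [simp]:
  assumes "x \<in> cauchy_seqs A q"
  shows "cscale C c (cl x) = cl (\<lambda>n. poly_scale c (x n))"
  using tendsto_mult_right_zero[OF seq_rep_cl(2)[OF assms], of "cmod c"] assms
  by (simp add: completion_def cl_eq_iff seq_rep_cl flip: poly_scale.scale_right_diff_distrib)

lemma cstar_cl [simp]:
  assumes "x \<in> cauchy_seqs A q"
  shows "cstar C (cl x) = cl (\<lambda>n. poly_star (x n))"
  using seq_rep_cl[OF assms] assms
  by (simp add: completion_def cl_eq_iff flip: poly_star_diff)

lemma cmult_cl [simp]:
  assumes "x \<in> cauchy_seqs A q" "y \<in> cauchy_seqs A q"
  shows "cmult C (cl x) (cl y) = cl (\<lambda>n. x n * y n)"
  using null_seq_mult[OF assms(1) seq_rep_cl(1)[OF assms(1)] assms(2) seq_rep_cl(1)[OF assms(2)]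
      seq_rep_cl(2)[OF assms(1)] seq_rep_cl(2)[OF assms(2)]] assms
  by (simp add: completion_def cl_eq_iff seq_rep_cl)

lemma czero_cl: "czero C = cl (\<lambda>n. 0)"
  by (simp add: completion_def)

lemma emb_carrier [simp]: "x \<in> A \<Longrightarrow> emb x \<in> carrier C"
  by (simp add: embed_def)

lemma emb_eq_iff: "x \<in> A \<Longrightarrow> y \<in> A \<Longrightarrow> emb x = emb y \<longleftrightarrow> x \<doteq> y"
  by (simp add: embed_def cl_eq_iff null_cong_def LIMSEQ_const_iff)

lemma emb_simps [simp]:
  "x \<in> A \<Longrightarrow> y \<in> A \<Longrightarrow> cadd C (emb x) (emb y) = emb (x + y)"
  "x \<in> A \<Longrightarrow> y \<in> A \<Longrightarrow> cmult C (emb x) (emb y) = emb (x * y)"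
  "x \<in> A \<Longrightarrow> cscale C c (emb x) = emb (poly_scale c x)"
  "x \<in> A \<Longrightarrow> cstar C (emb x) = emb (poly_star x)"
  "czero C = emb 0"
  by (simp_all add: embed_def czero_cl)

text \<open>\<open>csum\<close> is a \<open>finprod\<close> over this structure, so its evaluation
  rests on these laws.\<close>

lemma comm_monoid_C: "comm_monoid \<lparr>carrier = carrier C, mult = cadd C, one = czero C\<rparr>"
proof (rule comm_monoidI, simp_all only: partial_object.simps monoid.simps)
  show "czero C \<in> carrier C" by simp
  fix K L J assume K: "K \<in> carrier C" and L: "L \<in> carrier C"
  obtain x where x: "x \<in> cauchy_seqs A q" "K = cl x" using carrier_cases[OF K] .
  obtain y where y: "y \<in> cauchy_seqs A q" "L = cl y" using carrier_cases[OF L] .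
  show "cadd C K L \<in> carrier C" "cadd C K L = cadd C L K" "cadd C (czero C) K = K"
    using x y by (simp_all add: czero_cl add.commute del: emb_simps(5))
  assume J: "J \<in> carrier C"
  obtain z where z: "z \<in> cauchy_seqs A q" "J = cl z" using carrier_cases[OF J] .
  show "cadd C (cadd C K L) J = cadd C K (cadd C L J)"
    using x y z by (simp add: add.assoc)
qed

lemma csum_emb:
  assumes "\<And>i. i \<in> I \<Longrightarrow> f i \<in> A"
  shows "csum C (\<lambda>i. emb (f i)) I = emb (sum f I)"
proof -
  interpret C: comm_monoid "\<lparr>carrier = carrier C, mult = cadd C, one = emb 0\<rparr>"
    by (rule comm_monoid_C[unfolded emb_simps(5)])
  show ?thesis
    using assms unfolding csum_def emb_simps(5)
  proof (induction I rule: infinite_finite_induct)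
    case (insert i I)
    have "finprod \<lparr>carrier = carrier C, mult = cadd C, one = emb 0\<rparr> (\<lambda>i. emb (f i)) (insert i I)
       = cadd C (emb (f i)) (finprod \<lparr>carrier = carrier C, mult = cadd C, one = emb 0\<rparr> (\<lambda>i. emb (f i)) I)"
      using insert.hyps insert.prems by (subst C.finprod_insert) auto
    then show ?case using insert by simp
  qed (simp_all add: C.finprod_infinite)
qed

text \<open>If \<open>Q * P \<doteq> P\<close>, then \<open>Q - P\<close> is a projection and hence
  its own self-adjoint square root. Conversely, polynomials approximating a square root in the
  completion provide the hypothesis of \<open>projection_le\<close>, with the fourth power of their
  common bound as \<open>K\<close>.\<close>

lemma cle_emb_iff:
  assumes P: "P \<in> A" "poly_star P \<doteq> P" "P * P \<doteq> P"
    and Q: "Q \<in> A" "poly_star Q \<doteq> Q" "Q * Q \<doteq> Q"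
  shows "cle C (emb P) (emb Q) \<longleftrightarrow> Q * P \<doteq> P"
proof
  assume QP: "Q * P \<doteq> P"
  have PQ: "P * Q \<doteq> P"
  proof -
    have "P * Q \<doteq> poly_star P * poly_star Q"
      by (intro null_cong_mult null_cong_sym[OF P(2)] null_cong_sym[OF Q(2)])
    also have "\<dots> = poly_star (Q * P)" by simp
    also have "\<dots> \<doteq> poly_star P" by (intro null_cong_star QP)
    also have "\<dots> \<doteq> P" by (rule P)
    finally show ?thesis .
  qed
  have "(Q - P) * (Q - P) = Q * Q - Q * P - P * Q + P * P" by (simp add: algebra_simps)
  also have "\<dots> \<doteq> Q - P - P + P" by (intro null_cong_add null_cong_diff P Q PQ QP)
  finally have "(Q - P) * (Q - P) \<doteq> Q - P" by simp
  then have "emb (Q - P) = cmult C (emb (Q - P)) (emb (Q - P))"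
    using P(1) Q(1) by (simp add: emb_eq_iff null_cong_sym)
  moreover have "cstar C (emb (Q - P)) = emb (Q - P)"
    using P(1) Q(1) null_cong_diff[OF Q(2) P(2)] by (simp add: emb_eq_iff)
  moreover have "emb (Q - P) \<in> carrier C" using P(1) Q(1) by simp
  ultimately have "cpositive C (emb (Q - P))"
    unfolding cpositive_def by blast
  then show "cle C (emb P) (emb Q)"
    using P(1) Q(1) by (simp add: cle_def)
next
  assume "cle C (emb P) (emb Q)"
  then obtain h where h: "h \<in> carrier C" "cstar C h = h" "emb (Q - P) = cmult C h h"
    using P(1) Q(1) by (auto simp: cle_def cpositive_def)
  obtain x where x: "x \<in> cauchy_seqs A q" "h = cl x" using carrier_cases[OF h(1)] .
  \<comment> \<open>A representative of a self-adjoint class is self-adjoint only up to a null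
    sequence; its real part is so exactly.\<close>
  define y where "y n = poly_scale (1 / 2) (x n + poly_star (x n))" for n
  have y: "y \<in> cauchy_seqs A q" using x unfolding y_def by simp
  have "(\<lambda>n. N (poly_star (x n) - x n)) \<longlonglongrightarrow> 0"
    using h(2) x by (simp add: cl_eq_iff)
  then have "(\<lambda>n. N (poly_scale (1 / 2) (poly_star (x n) - x n))) \<longlonglongrightarrow> 0"
    using tendsto_mult_right_zero[of "\<lambda>n. N (poly_star (x n) - x n)" sequentially "1/2"] by simp
  moreover have "poly_scale (1 / 2) (poly_star (x n) - x n) = y n - x n" for n
    by (rule poly_mapping_eqI) (simp add: y_def lookup_add lookup_minus field_simps)
  ultimately have yx: "(\<lambda>n. N (y n - x n)) \<longlonglongrightarrow> 0" by simp
  have "(\<lambda>n. N ((Q - P) - x n * x n)) \<longlonglongrightarrow> 0"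
    using h(3) x P(1) Q(1) by (simp add: embed_def cl_eq_iff)
  moreover have "(\<lambda>n. N (x n * x n - y n * y n)) \<longlonglongrightarrow> 0"
    using null_seq_mult[OF x(1) y x(1) y yx yx] by (simp add: minus_commute)
  ultimately have "(\<lambda>n. N (((Q - P) - x n * x n) + (x n * x n - y n * y n))) \<longlonglongrightarrow> 0"
    by (rule null_seq_add)
  then have lim: "(\<lambda>n. N ((Q - P) - y n * y n)) \<longlonglongrightarrow> 0" by simp
  obtain M where M: "0 < M" "\<And>n. N (y n) \<le> M" using cauchy_seqs_bounded[OF y] by blast
  have star: "poly_star (y n) = y n" for n by (simp add: y_def add.commute)
  show "Q * P \<doteq> P"
    by (rule projection_le[OF P(2,3) Q(2,3), of "M ^ 4"])
      (simp, rule one_minus_limit_of_squares_le[OF star M(2) lim])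
qed

end

text \<open>Isometry makes the substitution well defined and injective on classes. Preimages are
  required up to null elements and not merely approximately, so that Cauchy sequences lift term by
  term, without a diagonal argument.\<close>

lemma completion_iso:
  assumes "cstar_completion N X q" and "cstar_completion N' X' q'"
    and f: "\<And>g. g \<in> X \<Longrightarrow> f g \<in> free_star_alg X'"
    and isometric: "\<And>x. x \<in> free_star_alg X \<Longrightarrow> N' (poly_subst f x) = N x"
    and dense: "\<And>y. y \<in> free_star_alg X' \<Longrightarrow> \<exists>x\<in>free_star_alg X. N' (poly_subst f x - y) = 0"
  shows "completion (free_star_alg X) q \<cong>\<^sub>* completion (free_star_alg X') q'"
proof -
  interpret S: cstar_completion N X q by fact
  interpret T: cstar_completion N' X' q' by fact
  have in_A: "poly_subst f x \<in> T.A" if "x \<in> S.A" for x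
    using that f by (rule poly_subst_free_star_alg)
  have cauchy: "(\<lambda>n. poly_subst f (x n)) \<in> cauchy_seqs T.A q'" if "x \<in> cauchy_seqs S.A q" for x
  proof -
    have "N' (poly_subst f (x m) - poly_subst f (x n)) = N (x m - x n)" for m n
      using isometric[of "x m - x n"] that by simp
    with that show ?thesis
      unfolding T.cauchy_seqs_iff by (simp add: in_A) (simp add: S.cauchy_seqs_iff)
  qed
  define \<Phi> where "\<Phi> K = T.cl (\<lambda>n. poly_subst f (seq_rep K n))" for K
  have \<Phi>_cl: "\<Phi> (S.cl x) = T.cl (\<lambda>n. poly_subst f (x n))" if x: "x \<in> cauchy_seqs S.A q" for x
  proof -
    have "N' (poly_subst f (seq_rep (S.cl x) n) - poly_subst f (x n)) = N (seq_rep (S.cl x) n - x n)" for n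
      using isometric[of "seq_rep (S.cl x) n - x n"] x S.seq_rep_cl(1)[OF x] by simp
    then show ?thesis
      unfolding \<Phi>_def using S.seq_rep_cl[OF x] x by (simp add: T.cl_eq_iff cauchy)
  qed
  have "bij_betw \<Phi> (carrier S.C) (carrier T.C)"
    unfolding bij_betw_def
  proof
    show "inj_on \<Phi> (carrier S.C)"
    proof (rule inj_onI)
      fix K L assume K: "K \<in> carrier S.C" and L: "L \<in> carrier S.C" and eq: "\<Phi> K = \<Phi> L"
      obtain x where x: "x \<in> cauchy_seqs S.A q" "K = S.cl x" using S.carrier_cases[OF K] .
      obtain y where y: "y \<in> cauchy_seqs S.A q" "L = S.cl y" using S.carrier_cases[OF L] .
      have "N' (poly_subst f (x n) - poly_subst f (y n)) = N (x n - y n)" for n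
        using isometric[of "x n - y n"] x y by simp
      with eq show "K = L" by (simp add: x y \<Phi>_cl T.cl_eq_iff S.cl_eq_iff cauchy)
    qed
    show "\<Phi> ` carrier S.C = carrier T.C"
    proof (intro equalityI subsetI)
      fix L assume "L \<in> \<Phi> ` carrier S.C"
      then show "L \<in> carrier T.C" by (auto elim!: S.carrier_cases simp: \<Phi>_cl cauchy)
    next
      fix L assume L: "L \<in> carrier T.C"
      obtain y where y: "y \<in> cauchy_seqs T.A q'" "L = T.cl y" using T.carrier_cases[OF L] .
      have "\<forall>n. \<exists>x. x \<in> S.A \<and> N' (poly_subst f x - y n) = 0"
        using dense y(1) by (meson T.cauchy_seqs_in)
      then obtain x where x: "\<And>n. x n \<in> S.A" "\<And>n. N' (poly_subst f (x n) - y n) = 0" by metis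
      have "N (x m - x n) = N' (y m - y n)" for m n
      proof -
        have "T.null_cong (poly_subst f (x m) - poly_subst f (x n)) (y m - y n)"
          using x by (intro T.null_cong_diff) (simp_all add: T.null_cong_def)
        then show ?thesis
          using T.seminorm_cong isometric[of "x m - x n"] x by simp
      qed
      then have xc: "x \<in> cauchy_seqs S.A q"
        using x y unfolding S.cauchy_seqs_iff T.cauchy_seqs_iff by simp
      have "\<Phi> (S.cl x) = L"
        using y x by (simp add: \<Phi>_cl xc T.cl_eq_iff cauchy)
      then show "L \<in> \<Phi> ` carrier S.C" using S.cl_carrier[OF xc] by blast
    qed
  qed
  moreover have "\<Phi> (cadd S.C K L) = cadd T.C (\<Phi> K) (\<Phi> L)" "\<Phi> (cmult S.C K L) = cmult T.C (\<Phi> K) (\<Phi> L)"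
    if "K \<in> carrier S.C" "L \<in> carrier S.C" for K L
    using that by (auto elim!: S.carrier_cases simp: \<Phi>_cl cauchy)
  moreover have "\<Phi> (cscale S.C c K) = cscale T.C c (\<Phi> K)" "\<Phi> (cstar S.C K) = cstar T.C (\<Phi> K)"
    if "K \<in> carrier S.C" for K c
    using that by (auto elim!: S.carrier_cases simp: \<Phi>_cl cauchy)
  ultimately have "star_iso S.C T.C \<Phi>" by (simp add: star_iso_def)
  then show ?thesis unfolding cstar_isomorphic_def by blast
qed

section \<open>The universal seminorm of a hypergraph\<close>

abbreviation hgens :: "('v, 'e) hypergraph \<Rightarrow> ('v, 'e) hgen set" where
  "hgens H \<equiv> Vert ` verts H \<union> Edge ` edges H"

context cstar_seminormed
begin

definition orthogonal_projections :: "'i set \<Rightarrow> ('i \<Rightarrow> 'g star_poly) \<Rightarrow> bool" where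
  "orthogonal_projections I p \<longleftrightarrow>
    (\<forall>i\<in>I. poly_star (p i) \<doteq> p i) \<and> (\<forall>i\<in>I. \<forall>j\<in>I. p i * p j \<doteq> (if i = j then p i else 0))"

text \<open>\<open>poly_star s * s\<close> is idempotent modulo null elements, so applying the
  C*-identity twice gives \<open>(N s) ^ 4 = (N s)\<^sup>2\<close>.\<close>

lemma partial_isometry_le_one:
  assumes "s * poly_star s * s \<doteq> s"
  shows "N s \<le> 1"
proof -
  have "(N s)\<^sup>2 * (N s)\<^sup>2 = (N (poly_star s * s))\<^sup>2"
    by (simp add: cstar_identity power2_eq_square)
  also have "\<dots> = N (poly_star (poly_star s * s) * (poly_star s * s))"
    by (simp only: cstar_identity)
  also have "\<dots> = N (poly_star s * (s * poly_star s * s))"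
    by (simp add: mult.assoc)
  also have "\<dots> = N (poly_star s * s)"
    by (intro seminorm_cong null_cong_mult null_cong_refl assms)
  also have "\<dots> = (N s)\<^sup>2" by (simp only: cstar_identity)
  finally have "(N s)\<^sup>2 = 0 \<or> (N s)\<^sup>2 = 1"
    by (metis mult_cancel_left mult.right_neutral)
  then show ?thesis using nonneg[of s] by (auto simp: power2_eq_1_iff)
qed

lemma orthogonal_projectionsD:
  assumes "orthogonal_projections I p" "i \<in> I"
  shows "poly_star (p i) \<doteq> p i" "p i * p i \<doteq> p i"
    and "j \<in> I \<Longrightarrow> i \<noteq> j \<Longrightarrow> p i * p j \<doteq> 0"
  using assms by (auto simp: orthogonal_projections_def) (metis null_cong_refl)+

text \<open>Such sums multiply like indicator functions, which reduces later identities for vertex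
  and range projections to intersections of sets.\<close>

lemma orthogonal_sums:
  assumes p: "orthogonal_projections I p" and S: "S \<subseteq> I" "finite S" and T: "T \<subseteq> I" "finite T"
  shows "sum p S * sum p T \<doteq> sum p (S \<inter> T)"
proof -
  have "sum p S * sum p T = (\<Sum>i\<in>S. \<Sum>j\<in>T. p i * p j)" by (rule sum_product)
  also have "\<dots> \<doteq> (\<Sum>i\<in>S. \<Sum>j\<in>T. if i = j then p i else 0)"
    using p S T unfolding orthogonal_projections_def by (intro null_cong_sum) blast
  also have "\<dots> = (\<Sum>i\<in>S. if i \<in> T then p i else 0)" using T by simp
  also have "\<dots> = sum p (S \<inter> T)" using S by (simp add: sum.inter_restrict)
  finally show ?thesis .
qed

lemma orthogonal_sum_star:
  assumes "orthogonal_projections I p" "S \<subseteq> I"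
  shows "poly_star (sum p S) \<doteq> sum p S"
  unfolding poly_star_sum using assms by (intro null_cong_sum orthogonal_projectionsD(1)[OF assms(1)]) auto

lemma orthogonal_sum_mult:
  assumes "orthogonal_projections I p" "S \<subseteq> I" "finite S" "i \<in> I"
  shows "sum p S * p i \<doteq> (if i \<in> S then p i else 0)"
  using orthogonal_sums[OF assms(1-3), of "{i}"] assms by auto

text \<open>By \<open>projection_le\<close>, the inequalities (HR2a) and (HR2b), which relate projections, amount
  to equations.\<close>

definition null_family ::
  "('v, 'e) hypergraph \<Rightarrow> ('v \<Rightarrow> 'g star_poly) \<Rightarrow> ('e \<Rightarrow> 'g star_poly) \<Rightarrow> bool" where
  "null_family H p s \<longleftrightarrow>
     orthogonal_projections (verts H) p \<and>
     (\<forall>e\<in>edges H. s e * poly_star (s e) * s e \<doteq> s e) \<and>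
     (\<forall>e\<in>edges H. \<forall>f\<in>edges H. poly_star (s e) * s f \<doteq> (if e = f then sum p (rng H e) else 0)) \<and>
     (\<forall>e\<in>edges H. sum p (src H e) * s e \<doteq> s e) \<and>
     (\<forall>v\<in>verts H. \<not> is_sink H v \<longrightarrow>
        (\<Sum>e\<in>{e \<in> edges H. v \<in> src H e}. s e * poly_star (s e)) * p v \<doteq> p v)"

lemma range_projections:
  assumes pi: "\<And>e. e \<in> I \<Longrightarrow> s e * poly_star (s e) * s e \<doteq> s e"
    and orth: "\<And>e f. e \<in> I \<Longrightarrow> f \<in> I \<Longrightarrow> e \<noteq> f \<Longrightarrow> poly_star (s e) * s f \<doteq> 0"
  shows "orthogonal_projections I (\<lambda>e. s e * poly_star (s e))"
proof -
  have "s e * poly_star (s e) * (s f * poly_star (s f)) \<doteq> (if e = f then s e * poly_star (s e) else 0)"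
    if e: "e \<in> I" and f: "f \<in> I" for e f
  proof (cases "e = f")
    case True
    have "s e * poly_star (s e) * s e * poly_star (s e) \<doteq> s e * poly_star (s e)"
      by (intro null_cong_mult pi e null_cong_refl)
    with True show ?thesis by (simp add: mult.assoc)
  next
    case False
    have "s e * (poly_star (s e) * s f) * poly_star (s f) \<doteq> s e * 0 * poly_star (s f)"
      by (intro null_cong_mult orth e f False null_cong_refl)
    with False show ?thesis by (simp add: mult.assoc)
  qed
  then show ?thesis by (simp add: orthogonal_projections_def)
qed

end

section \<open>The hypergraph relations in a completion\<close>

context cstar_completion
begin

lemma is_projection_emb: "P \<in> A \<Longrightarrow> is_projection C (emb P) \<longleftrightarrow> poly_star P \<doteq> P \<and> P * P \<doteq> P"
  by (simp add: is_projection_def emb_eq_iff)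

lemma is_partial_isometry_emb: "S \<in> A \<Longrightarrow> is_partial_isometry C (emb S) \<longleftrightarrow> S * poly_star S * S \<doteq> S"
  by (simp add: is_partial_isometry_def emb_eq_iff)

text \<open>\<open>cle_emb_iff\<close> applies to projections only. The relations other than (HR2a)
  and (HR2b) are collected in \<open>B\<close>; they make vertex sums and range sums projections, so
  the inequalities are translated under \<open>B\<close>, which both sides contain.\<close>

lemma hypergraph_family_emb_iff:
  assumes H: "finite_hypergraph H"
    and p: "\<And>v. v \<in> verts H \<Longrightarrow> p v \<in> A" and s: "\<And>e. e \<in> edges H \<Longrightarrow> s e \<in> A"
  shows "hypergraph_family H C (\<lambda>v. emb (p v)) (\<lambda>e. emb (s e)) \<longleftrightarrow> null_family H p s"
proof -
  interpret H: finite_hypergraph H by fact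
  have rng: "rng H e \<subseteq> verts H" "finite (rng H e)" and src: "src H e \<subseteq> verts H" "finite (src H e)"
    if "e \<in> edges H" for e
    using that H.rng_subset H.src_subset H.finite_verts finite_subset by metis+
  have sums: "csum C (\<lambda>v. emb (p v)) S = emb (sum p S)" "sum p S \<in> A" if "S \<subseteq> verts H" for S
    using that p by (auto intro!: csum_emb free_star_alg_sum)
  have range_sum: "csum C (\<lambda>e. cmult C (emb (s e)) (cstar C (emb (s e)))) F
      = emb (\<Sum>e\<in>F. s e * poly_star (s e))"
      "(\<Sum>e\<in>F. s e * poly_star (s e)) \<in> A" if F: "F \<subseteq> edges H" for F
  proof -
    have "csum C (\<lambda>e. cmult C (emb (s e)) (cstar C (emb (s e)))) F = csum C (\<lambda>e. emb (s e * poly_star (s e))) F"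
      unfolding csum_def
    proof (rule comm_monoid.finprod_cong'[OF comm_monoid_C refl])
      show "(\<lambda>e. emb (s e * poly_star (s e))) \<in> F \<rightarrow> carrier \<lparr>carrier = carrier C, mult = cadd C, one = czero C\<rparr>"
        using F s by auto
    qed (use F s in auto)
    also have "\<dots> = emb (\<Sum>e\<in>F. s e * poly_star (s e))"
      using F s by (intro csum_emb) auto
    finally show "csum C (\<lambda>e. cmult C (emb (s e)) (cstar C (emb (s e)))) F
      = emb (\<Sum>e\<in>F. s e * poly_star (s e))" .
    show "(\<Sum>e\<in>F. s e * poly_star (s e)) \<in> A" using F s by (intro free_star_alg_sum) auto
  qed
  define B where "B \<longleftrightarrow> orthogonal_projections (verts H) p \<and>
     (\<forall>e\<in>edges H. s e * poly_star (s e) * s e \<doteq> s e) \<and>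
     (\<forall>e\<in>edges H. \<forall>f\<in>edges H. poly_star (s e) * s f \<doteq> (if e = f then sum p (rng H e) else 0))"
  have B_pi: "s e * poly_star (s e) * s e \<doteq> s e" if B "e \<in> edges H" for e
    using that by (simp add: B_def)
  have B_orth: "poly_star (s e) * s f \<doteq> 0" if B "e \<in> edges H" "f \<in> edges H" "e \<noteq> f" for e f
  proof -
    have "poly_star (s e) * s f \<doteq> (if e = f then sum p (rng H e) else 0)"
      using that(1-3) unfolding B_def by blast
    with that(4) show ?thesis by simp
  qed
  have verts: "(\<forall>v\<in>verts H. is_projection C (emb (p v))) \<and>
     (\<forall>v\<in>verts H. \<forall>v'\<in>verts H. v \<noteq> v' \<longrightarrow> cmult C (emb (p v)) (emb (p v')) = czero C) \<longleftrightarrow>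
     orthogonal_projections (verts H) p"
    using p by (auto simp: orthogonal_projections_def is_projection_emb emb_eq_iff)
  have edges: "(\<forall>e\<in>edges H. is_partial_isometry C (emb (s e))) \<longleftrightarrow>
      (\<forall>e\<in>edges H. s e * poly_star (s e) * s e \<doteq> s e)"
    using s by (auto simp: is_partial_isometry_emb)
  have HR1: "cmult C (cstar C (emb (s e))) (emb (s f))
        = (if e = f then csum C (\<lambda>v. emb (p v)) (rng H e) else czero C) \<longleftrightarrow>
      poly_star (s e) * s f \<doteq> (if e = f then sum p (rng H e) else 0)"
    if "e \<in> edges H" "f \<in> edges H" for e f
    using that s rng sums by (simp add: emb_eq_iff)
  have HR2a: "cle C (cmult C (emb (s e)) (cstar C (emb (s e)))) (csum C (\<lambda>v. emb (p v)) (src H e)) \<longleftrightarrow>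
      sum p (src H e) * s e \<doteq> s e" if B and e: "e \<in> edges H" for e
  proof -
    have orth: "orthogonal_projections (verts H) p" and pi: "s e * poly_star (s e) * s e \<doteq> s e"
      using that by (auto simp: B_def)
    let ?P = "sum p (src H e)"
    have range: "orthogonal_projections {e} (\<lambda>e. s e * poly_star (s e))"
      using pi by (intro range_projections) auto
    have "cle C (cmult C (emb (s e)) (cstar C (emb (s e)))) (csum C (\<lambda>v. emb (p v)) (src H e)) \<longleftrightarrow>
      cle C (emb (s e * poly_star (s e))) (emb ?P)"
      using s[OF e] sums[OF src(1)[OF e]] by simp
    also have "\<dots> \<longleftrightarrow> ?P * (s e * poly_star (s e)) \<doteq> s e * poly_star (s e)"
    proof (rule cle_emb_iff)
      show "?P * ?P \<doteq> ?P" "poly_star ?P \<doteq> ?P"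
        using orthogonal_sums[OF orth src[OF e] src[OF e]] orthogonal_sum_star[OF orth src(1)[OF e]] by simp_all
    qed (use orthogonal_projectionsD(1,2)[OF range] s e sums(2)[OF src(1)[OF e]] in auto)
    \<comment> \<open>Multiplying on the right by \<open>s e\<close> or by its adjoint passes
      between the two forms, \<open>s e\<close> being a partial isometry.\<close>
    also have "\<dots> \<longleftrightarrow> ?P * s e \<doteq> s e"
    proof
      assume *: "?P * (s e * poly_star (s e)) \<doteq> s e * poly_star (s e)"
      have "?P * s e \<doteq> ?P * (s e * poly_star (s e) * s e)"
        by (intro null_cong_mult null_cong_refl null_cong_sym[OF pi])
      also have "\<dots> = ?P * (s e * poly_star (s e)) * s e" by (simp add: mult.assoc)
      also have "\<dots> \<doteq> s e * poly_star (s e) * s e" by (intro null_cong_mult * null_cong_refl)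
      also note pi
      finally show "?P * s e \<doteq> s e" .
    next
      assume "?P * s e \<doteq> s e"
      from null_cong_mult[OF this null_cong_refl, of "poly_star (s e)"]
      show "?P * (s e * poly_star (s e)) \<doteq> s e * poly_star (s e)" by (simp add: mult.assoc)
    qed
    finally show ?thesis .
  qed
  have HR2b: "cle C (emb (p v)) (csum C (\<lambda>e. cmult C (emb (s e)) (cstar C (emb (s e)))) F) \<longleftrightarrow>
      (\<Sum>e\<in>F. s e * poly_star (s e)) * p v \<doteq> p v"
    if B and v: "v \<in> verts H" and F: "F \<subseteq> edges H" for v F
  proof -
    have orth: "orthogonal_projections (verts H) p" using that by (auto simp: B_def)
    have range: "orthogonal_projections F (\<lambda>e. s e * poly_star (s e))"
      using \<open>B\<close> F by (intro range_projections B_pi B_orth) auto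
    have fin: "finite F" using F H.finite_edges finite_subset by blast
    show ?thesis
      unfolding range_sum(1)[OF F]
    proof (rule cle_emb_iff)
      show "(\<Sum>e\<in>F. s e * poly_star (s e)) * (\<Sum>e\<in>F. s e * poly_star (s e)) \<doteq> (\<Sum>e\<in>F. s e * poly_star (s e))"
        using orthogonal_sums[OF range order_refl fin order_refl fin] by simp
    qed (use orthogonal_projectionsD[OF orth v] p v range_sum(2)[OF F] orthogonal_sum_star[OF range] in auto)
  qed
  have "hypergraph_family H C (\<lambda>v. emb (p v)) (\<lambda>e. emb (s e)) \<longleftrightarrow> B \<and>
     (\<forall>e\<in>edges H. cle C (cmult C (emb (s e)) (cstar C (emb (s e)))) (csum C (\<lambda>v. emb (p v)) (src H e))) \<and>
     (\<forall>v\<in>verts H. \<not> is_sink H v \<longrightarrow> cle C (emb (p v))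
        (csum C (\<lambda>e. cmult C (emb (s e)) (cstar C (emb (s e)))) {e \<in> edges H. v \<in> src H e}))"
    unfolding hypergraph_family_def B_def edges verts[symmetric]
    by (simp only: HR1 conj_assoc cong: ball_cong)
  moreover have "null_family H p s \<longleftrightarrow> B \<and>
     (\<forall>e\<in>edges H. sum p (src H e) * s e \<doteq> s e) \<and>
     (\<forall>v\<in>verts H. \<not> is_sink H v \<longrightarrow>
        (\<Sum>e\<in>{e \<in> edges H. v \<in> src H e}. s e * poly_star (s e)) * p v \<doteq> p v)"
    unfolding null_family_def B_def by (simp only: conj_assoc)
  ultimately show ?thesis
    by (cases B) (simp_all only: HR2a HR2b Collect_restrict simp_thms cong: ball_cong)
qed

end

section \<open>The supremum of the admissible seminorms\<close>

text \<open>Under the hypergraph relations the generators have norm at most one, which bounds all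
  admissible seminorms simultaneously.\<close>

context
  fixes H :: "('v, 'e) hypergraph"
  assumes H: "finite_hypergraph H"
begin

abbreviation (input) "adm \<equiv> admissible_seminorms (hgens H)
  (\<lambda>B f. hypergraph_family H B (\<lambda>v. f (Vert v)) (\<lambda>e. f (Edge e)))"

abbreviation (input) "useminorm \<equiv> universal_seminorm (hgens H)
  (\<lambda>B f. hypergraph_family H B (\<lambda>v. f (Vert v)) (\<lambda>e. f (Edge e)))"

lemma admissible_if_null_family:
  assumes "cstar_seminormed N" "cstar_seminormed.null_family N H (gen \<circ> Vert) (gen \<circ> Edge)"
  shows "N \<in> adm"
proof -
  interpret cstar_completion N "hgens H" N
    using assms(1) by (simp add: cstar_completion_def cstar_completion_axioms_def)
  have "cstar_seminorm (free_star_alg (hgens H)) N"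
    using cstar_seminorm by (simp add: cstar_seminorm_def)
  moreover have "hypergraph_family H C (\<lambda>v. emb (gen (Vert v))) (\<lambda>e. emb (gen (Edge e)))"
    using hypergraph_family_emb_iff[OF H, of "gen \<circ> Vert" "gen \<circ> Edge"] assms(2) by simp
  ultimately show ?thesis by (simp add: admissible_seminorms_def)
qed

lemma null_family_if_admissible:
  assumes "q \<in> adm"
  obtains N where "cstar_seminormed N" "\<And>x. x \<in> free_star_alg (hgens H) \<Longrightarrow> N x = q x"
    "cstar_seminormed.null_family N H (gen \<circ> Vert) (gen \<circ> Edge)"
proof -
  obtain N where N: "cstar_seminormed N" "\<And>x. x \<in> free_star_alg (hgens H) \<Longrightarrow> N x = q x"
    using assms unfolding admissible_seminorms_def mem_Collect_eq by (metis cstar_seminorm_extension)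
  interpret cstar_completion N "hgens H" q
    using N by (simp add: cstar_completion_def cstar_completion_axioms_def)
  have "hypergraph_family H C (\<lambda>v. emb (gen (Vert v))) (\<lambda>e. emb (gen (Edge e)))"
    using assms by (simp add: admissible_seminorms_def)
  then have "null_family H (gen \<circ> Vert) (gen \<circ> Edge)"
    using hypergraph_family_emb_iff[OF H, of "gen \<circ> Vert" "gen \<circ> Edge"] by simp
  with N show thesis by (rule that)
qed

text \<open>The supremum is taken over a nonempty set; comparison with this seminorm also shows that
  it is nonnegative.\<close>

lemma zero_admissible: "(\<lambda>x. 0) \<in> adm"
proof (rule admissible_if_null_family)
  show zero: "cstar_seminormed (\<lambda>x. 0)" by standard (simp add: cstar_seminorm_def)
  show "cstar_seminormed.null_family (\<lambda>x. 0) H (gen \<circ> Vert) (gen \<circ> Edge)"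
    by (simp add: cstar_seminormed.null_family_def[OF zero]
        cstar_seminormed.orthogonal_projections_def[OF zero] cstar_seminormed.null_cong_def[OF zero])
qed

lemma admissible_properties:
  assumes "q \<in> adm" "x \<in> free_star_alg (hgens H)" "y \<in> free_star_alg (hgens H)"
  shows "0 \<le> q x" "q (x + y) \<le> q x + q y" "q (poly_scale c x) = cmod c * q x"
    "q (x * y) \<le> q x * q y" "q (poly_star x * x) = (q x)\<^sup>2"
  using assms by (simp_all add: admissible_seminorms_def cstar_seminorm_def)

text \<open>A projection is also a partial isometry, so \<open>partial_isometry_le_one\<close>
  covers both kinds of generators.\<close>

lemma admissible_gen_le_one:
  assumes q: "q \<in> adm" and g: "g \<in> hgens H"
  shows "q (gen g) \<le> 1" "q (poly_star (gen g)) \<le> 1"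
proof -
  obtain N where N: "cstar_seminormed N" "\<And>x. x \<in> free_star_alg (hgens H) \<Longrightarrow> N x = q x"
    and fam: "cstar_seminormed.null_family N H (gen \<circ> Vert) (gen \<circ> Edge)"
    using null_family_if_admissible[OF q] by blast
  interpret cstar_seminormed N by fact
  have "null_cong (gen g * poly_star (gen g) * gen g) (gen g)"
  proof (cases g)
    case (Vert v)
    then have *: "null_cong (poly_star (gen g)) (gen g)" "null_cong (gen g * gen g) (gen g)"
      using g fam orthogonal_projectionsD(1,2)[of "verts H" "gen \<circ> Vert" v] by (auto simp: null_family_def)
    have "null_cong (gen g * poly_star (gen g) * gen g) (gen g * gen g * gen g)"
      by (intro null_cong_mult * null_cong_refl)
    also have "null_cong \<dots> (gen g * gen g)" by (intro null_cong_mult * null_cong_refl)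
    also note *(2)
    finally show ?thesis .
  next
    case (Edge e)
    then show ?thesis using g fam by (auto simp: null_family_def)
  qed
  then have "N (gen g) \<le> 1" by (rule partial_isometry_le_one)
  then show "q (gen g) \<le> 1" "q (poly_star (gen g)) \<le> 1"
    using N(2)[of "gen g"] N(2)[of "poly_star (gen g)"] g by simp_all
qed

lemma admissible_bounded:
  assumes "x \<in> free_star_alg (hgens H)"
  shows "\<exists>C. \<forall>q\<in>adm. q x \<le> C"
  using assms
proof (induction rule: free_star_alg_induct)
  case (gen g)
  then show ?case using admissible_gen_le_one(1) by blast
next
  case (star g)
  then show ?case using admissible_gen_le_one(2) by blast
next
  case (scale c x)
  then obtain C where C: "\<And>q. q \<in> adm \<Longrightarrow> q x \<le> C" by blast
  have "q (poly_scale c x) \<le> cmod c * C" if "q \<in> adm" for q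
    using C[OF that] admissible_properties(3)[OF that scale(1,1)] by (simp add: mult_left_mono)
  then show ?case by blast
next
  case (add x y)
  then obtain C D where C: "\<And>q. q \<in> adm \<Longrightarrow> q x \<le> C" and D: "\<And>q. q \<in> adm \<Longrightarrow> q y \<le> D" by blast
  have "q (x + y) \<le> C + D" if "q \<in> adm" for q
    using C[OF that] D[OF that] admissible_properties(2)[OF that add(1,2)] by linarith
  then show ?case by blast
next
  case (mult x y)
  then obtain C D where C: "\<And>q. q \<in> adm \<Longrightarrow> q x \<le> C" and D: "\<And>q. q \<in> adm \<Longrightarrow> q y \<le> D" by blast
  have "q (x * y) \<le> C * D" if q: "q \<in> adm" for q
  proof -
    have "q x * q y \<le> C * D"
      using C[OF q] D[OF q] admissible_properties(1)[OF q mult(1,1)] admissible_properties(1)[OF q mult(2,2)]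
      by (intro mult_mono) auto
    then show ?thesis using admissible_properties(4)[OF q mult(1,2)] by linarith
  qed
  then show ?case by blast
next
  case zero
  have "q 0 \<le> 0" if "q \<in> adm" for q
    using admissible_properties(3)[OF that, of 0 0 0] by simp
  then show ?case by blast
qed

lemma universal_seminorm_upper:
  assumes "q \<in> adm" "x \<in> free_star_alg (hgens H)"
  shows "q x \<le> useminorm x"
proof -
  have "bdd_above ((\<lambda>q. q x) ` adm)"
    using admissible_bounded[OF assms(2)] by (auto simp: bdd_above_def)
  then show ?thesis unfolding universal_seminorm_def using assms(1) by (intro cSUP_upper)
qed

lemma universal_seminorm_least:
  assumes "\<And>q. q \<in> adm \<Longrightarrow> q x \<le> C"
  shows "useminorm x \<le> C"
  unfolding universal_seminorm_def using zero_admissible assms by (intro cSUP_least) auto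

lemma cstar_seminorm_universal: "cstar_seminorm (free_star_alg (hgens H)) useminorm"
proof -
  note upper = universal_seminorm_upper and least = universal_seminorm_least
    and props = admissible_properties
  have nonneg: "0 \<le> useminorm x" if "x \<in> free_star_alg (hgens H)" for x
    using upper[OF zero_admissible that] .
  have scale_le: "useminorm (poly_scale c x) \<le> cmod c * useminorm x"
    if "x \<in> free_star_alg (hgens H)" for c x
  proof (rule least)
    fix q assume q: "q \<in> adm"
    show "q (poly_scale c x) \<le> cmod c * useminorm x"
      using upper[OF q that] by (simp add: props(3)[OF q that that] mult_left_mono)
  qed
  have "useminorm (poly_scale c x) = cmod c * useminorm x"
    if x: "x \<in> free_star_alg (hgens H)" for c x
  proof (cases "c = 0")
    case True
    then show ?thesis using scale_le[OF x, of 0] nonneg[of "poly_scale 0 x"] by simp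
  next
    case False
    have "useminorm x \<le> cmod (1 / c) * useminorm (poly_scale c x)"
      using False scale_le[of "poly_scale c x" "1 / c"] x by simp
    then have "cmod c * useminorm x \<le> useminorm (poly_scale c x)"
      using False by (simp add: norm_divide field_simps)
    then show ?thesis using scale_le[OF x, of c] by simp
  qed
  moreover have "useminorm (x + y) \<le> useminorm x + useminorm y"
    if "x \<in> free_star_alg (hgens H)" "y \<in> free_star_alg (hgens H)" for x y
  proof (rule least)
    fix q assume q: "q \<in> adm"
    show "q (x + y) \<le> useminorm x + useminorm y"
      using props(2)[OF q that] upper[OF q that(1)] upper[OF q that(2)] by linarith
  qed
  moreover have "useminorm (x * y) \<le> useminorm x * useminorm y"
    if xy: "x \<in> free_star_alg (hgens H)" "y \<in> free_star_alg (hgens H)" for x y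
  proof (rule least)
    fix q assume q: "q \<in> adm"
    have "q x * q y \<le> useminorm x * useminorm y"
      using q xy by (intro mult_mono upper nonneg props(1)[OF q xy(2,2)])
    then show "q (x * y) \<le> useminorm x * useminorm y" using props(4)[OF q xy] by linarith
  qed
  moreover have "useminorm (poly_star x * x) = (useminorm x)\<^sup>2"
    if x: "x \<in> free_star_alg (hgens H)" for x
  proof (rule antisym)
    show "useminorm (poly_star x * x) \<le> (useminorm x)\<^sup>2"
    proof (rule least)
      fix q assume q: "q \<in> adm"
      show "q (poly_star x * x) \<le> (useminorm x)\<^sup>2"
        using upper[OF q x] props(1)[OF q x x] by (simp add: props(5)[OF q x x] power_mono)
    qed
    \<comment> \<open>Each \<open>q x\<close> is bounded by the root, so that squaring takes place
      after the supremum.\<close>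
    have "useminorm x \<le> sqrt (useminorm (poly_star x * x))"
    proof (rule least)
      fix q assume q: "q \<in> adm"
      show "q x \<le> sqrt (useminorm (poly_star x * x))"
        using upper[OF q, of "poly_star x * x"] x by (intro real_le_rsqrt) (simp add: props(5)[OF q x x])
    qed
    then have "(useminorm x)\<^sup>2 \<le> (sqrt (useminorm (poly_star x * x)))\<^sup>2"
      by (rule power_mono) (rule nonneg[OF x])
    also have "\<dots> = useminorm (poly_star x * x)"
      using nonneg[of "poly_star x * x"] x by (intro real_sqrt_pow2) simp
    finally show "(useminorm x)\<^sup>2 \<le> useminorm (poly_star x * x)" .
  qed
  ultimately show ?thesis by (simp add: cstar_seminorm_def nonneg)
qed

end

section \<open>Homomorphisms induced by substitutions of generators\<close>

text \<open>The universal property in terms of seminorms: a seminorm admissible for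
  \<open>H'\<close> pulls back along the substitution to one admissible for \<open>H\<close>, which
  the supremum for \<open>H\<close> dominates.\<close>

lemma universal_seminorm_subst_le:
  assumes H: "finite_hypergraph H" and H': "finite_hypergraph H'"
    and f: "\<And>g. g \<in> hgens H \<Longrightarrow> f g \<in> free_star_alg (hgens H')"
    and family: "\<And>N. cstar_seminormed N \<Longrightarrow>
      cstar_seminormed.null_family N H' (gen \<circ> Vert) (gen \<circ> Edge) \<Longrightarrow>
      cstar_seminormed.null_family N H (f \<circ> Vert) (f \<circ> Edge)"
    and x: "x \<in> free_star_alg (hgens H)"
  shows "universal_seminorm (hgens H') (\<lambda>B f. hypergraph_family H' B (\<lambda>v. f (Vert v)) (\<lambda>e. f (Edge e))) (poly_subst f x)
    \<le> universal_seminorm (hgens H) (\<lambda>B f. hypergraph_family H B (\<lambda>v. f (Vert v)) (\<lambda>e. f (Edge e))) x"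
proof (rule universal_seminorm_least[OF H'])
  fix q assume q: "q \<in> admissible_seminorms (hgens H') (\<lambda>B f. hypergraph_family H' B (\<lambda>v. f (Vert v)) (\<lambda>e. f (Edge e)))"
  then obtain N where N: "cstar_seminormed N" "\<And>y. y \<in> free_star_alg (hgens H') \<Longrightarrow> N y = q y"
    and fam: "cstar_seminormed.null_family N H' (gen \<circ> Vert) (gen \<circ> Edge)"
    using null_family_if_admissible[OF H' q] by blast
  interpret cstar_seminormed N by fact
  interpret sub: cstar_seminormed "N \<circ> poly_subst f"
    by standard (simp add: cstar_seminorm_def triangle mult_le cstar_identity)
  have cong: "sub.null_cong x y \<longleftrightarrow> null_cong (poly_subst f x) (poly_subst f y)" for x y
    by (simp add: sub.null_cong_def null_cong_def)
  have "null_family H (f \<circ> Vert) (f \<circ> Edge)" using family[OF N(1) fam] .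
  then have "sub.null_family H (gen \<circ> Vert) (gen \<circ> Edge)"
    by (simp add: sub.null_family_def null_family_def sub.orthogonal_projections_def
        orthogonal_projections_def cong if_distrib[of "poly_subst f"] cong: if_cong)
  then have "(N \<circ> poly_subst f) x \<le> universal_seminorm (hgens H)
      (\<lambda>B f. hypergraph_family H B (\<lambda>v. f (Vert v)) (\<lambda>e. f (Edge e))) x"
    by (intro universal_seminorm_upper[OF H] admissible_if_null_family[OF H] sub.cstar_seminormed_axioms x)
  moreover have "poly_subst f x \<in> free_star_alg (hgens H')"
    using x f by (rule poly_subst_free_star_alg)
  ultimately show "q (poly_subst f x) \<le> universal_seminorm (hgens H)
      (\<lambda>B f. hypergraph_family H B (\<lambda>v. f (Vert v)) (\<lambda>e. f (Edge e))) x"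
    by (simp add: N(2))
qed

text \<open>The round trip respects all operations, so it agrees with the identity modulo null
  elements as soon as it does on generators. The bound is uniform over admissible seminorms because
  it is 0 for each of them.\<close>

lemma universal_seminorm_inverse:
  assumes H: "finite_hypergraph H"
    and f: "\<And>g. g \<in> hgens H \<Longrightarrow> f g \<in> free_star_alg (hgens H')"
    and f': "\<And>g. g \<in> hgens H' \<Longrightarrow> f' g \<in> free_star_alg (hgens H)"
    and inverse: "\<And>N g. cstar_seminormed N \<Longrightarrow>
      cstar_seminormed.null_family N H (gen \<circ> Vert) (gen \<circ> Edge) \<Longrightarrow> g \<in> hgens H \<Longrightarrow>
      cstar_seminormed.null_cong N (poly_subst f' (f g)) (gen g)"
    and x: "x \<in> free_star_alg (hgens H)"
  shows "universal_seminorm (hgens H) (\<lambda>B f. hypergraph_family H B (\<lambda>v. f (Vert v)) (\<lambda>e. f (Edge e)))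
    (poly_subst f' (poly_subst f x) - x) \<le> 0"
proof (rule universal_seminorm_least[OF H])
  fix q assume q: "q \<in> admissible_seminorms (hgens H) (\<lambda>B f. hypergraph_family H B (\<lambda>v. f (Vert v)) (\<lambda>e. f (Edge e)))"
  then obtain N where N: "cstar_seminormed N" "\<And>y. y \<in> free_star_alg (hgens H) \<Longrightarrow> N y = q y"
    and fam: "cstar_seminormed.null_family N H (gen \<circ> Vert) (gen \<circ> Edge)"
    using null_family_if_admissible[OF H q] by blast
  interpret cstar_seminormed N by fact
  have "null_cong (poly_subst f' (poly_subst f x)) x"
    using x
  proof (induction rule: free_star_alg_induct)
    case (gen g)
    then show ?case using inverse[OF N(1) fam] by simp
  next
    case (star g)
    then show ?case using null_cong_star[OF inverse[OF N(1) fam]] by simp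
  qed (simp_all add: null_cong_add null_cong_mult null_cong_scale)
  moreover have "poly_subst f' (poly_subst f x) \<in> free_star_alg (hgens H)"
  proof (rule poly_subst_free_star_alg[OF _ f'])
    show "poly_subst f x \<in> free_star_alg (hgens H')"
      using x f by (rule poly_subst_free_star_alg)
  qed
  ultimately show "q (poly_subst f' (poly_subst f x) - x) \<le> 0"
    using x by (simp add: null_cong_def flip: N(2))
qed

text \<open>Two contractions that are inverse up to null elements are isometric, since
  \<open>N x = N (f' (f x)) \<le> N' (f x) \<le> N x\<close> when substitutions are written as maps.
  The preimage of \<open>y\<close> is \<open>f' y\<close>.\<close>

lemma hypergraph_cstar_isoI:
  assumes H: "finite_hypergraph H" and H': "finite_hypergraph H'"
    and f: "\<And>g. g \<in> hgens H \<Longrightarrow> f g \<in> free_star_alg (hgens H')"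
    and f': "\<And>g. g \<in> hgens H' \<Longrightarrow> f' g \<in> free_star_alg (hgens H)"
    and family: "\<And>N. cstar_seminormed N \<Longrightarrow>
      cstar_seminormed.null_family N H' (gen \<circ> Vert) (gen \<circ> Edge) \<Longrightarrow>
      cstar_seminormed.null_family N H (f \<circ> Vert) (f \<circ> Edge)"
    and family': "\<And>N. cstar_seminormed N \<Longrightarrow>
      cstar_seminormed.null_family N H (gen \<circ> Vert) (gen \<circ> Edge) \<Longrightarrow>
      cstar_seminormed.null_family N H' (f' \<circ> Vert) (f' \<circ> Edge)"
    and inverse: "\<And>N g. cstar_seminormed N \<Longrightarrow>
      cstar_seminormed.null_family N H (gen \<circ> Vert) (gen \<circ> Edge) \<Longrightarrow> g \<in> hgens H \<Longrightarrow>
      cstar_seminormed.null_cong N (poly_subst f' (f g)) (gen g)"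
    and inverse': "\<And>N g. cstar_seminormed N \<Longrightarrow>
      cstar_seminormed.null_family N H' (gen \<circ> Vert) (gen \<circ> Edge) \<Longrightarrow> g \<in> hgens H' \<Longrightarrow>
      cstar_seminormed.null_cong N (poly_subst f (f' g)) (gen g)"
  shows "hypergraph_cstar H \<cong>\<^sub>* hypergraph_cstar H'"
proof -
  let ?u = "universal_seminorm (hgens H) (\<lambda>B f. hypergraph_family H B (\<lambda>v. f (Vert v)) (\<lambda>e. f (Edge e)))"
  let ?u' = "universal_seminorm (hgens H') (\<lambda>B f. hypergraph_family H' B (\<lambda>v. f (Vert v)) (\<lambda>e. f (Edge e)))"
  obtain N where N: "cstar_seminormed N" "\<And>x. x \<in> free_star_alg (hgens H) \<Longrightarrow> N x = ?u x"
    by (rule cstar_seminorm_extension[OF cstar_seminorm_universal[OF H]]) (rule that)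
  obtain N' where N': "cstar_seminormed N'" "\<And>x. x \<in> free_star_alg (hgens H') \<Longrightarrow> N' x = ?u' x"
    by (rule cstar_seminorm_extension[OF cstar_seminorm_universal[OF H']]) (rule that)
  interpret S: cstar_completion N "hgens H" ?u
    using N by (intro cstar_completion.intro cstar_completion_axioms.intro) simp_all
  interpret T: cstar_completion N' "hgens H'" ?u'
    using N' by (intro cstar_completion.intro cstar_completion_axioms.intro) simp_all
  have in_T: "poly_subst f x \<in> T.A" if "x \<in> S.A" for x
    using that f by (rule poly_subst_free_star_alg)
  have in_S: "poly_subst f' y \<in> S.A" if "y \<in> T.A" for y
    using that f' by (rule poly_subst_free_star_alg)
  have le: "N' (poly_subst f x) \<le> N x" if "x \<in> S.A" for x
    using universal_seminorm_subst_le[OF H H' f family that] unfolding N(2)[OF that] N'(2)[OF in_T[OF that]] .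
  have le': "N (poly_subst f' y) \<le> N' y" if "y \<in> T.A" for y
    using universal_seminorm_subst_le[OF H' H f' family' that] unfolding N'(2)[OF that] N(2)[OF in_S[OF that]] .
  have inv: "S.null_cong (poly_subst f' (poly_subst f x)) x" if "x \<in> S.A" for x
  proof -
    have "poly_subst f' (poly_subst f x) - x \<in> S.A" using that in_S in_T by simp
    from N(2)[OF this] universal_seminorm_inverse[OF H f f' inverse that] show ?thesis
      unfolding S.null_cong_def by (intro antisym S.nonneg) simp
  qed
  have inv': "T.null_cong (poly_subst f (poly_subst f' y)) y" if "y \<in> T.A" for y
  proof -
    have "poly_subst f (poly_subst f' y) - y \<in> T.A" using that in_S in_T by simp
    from N'(2)[OF this] universal_seminorm_inverse[OF H' f' f inverse' that] show ?thesis
      unfolding T.null_cong_def by (intro antisym T.nonneg) simp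
  qed
  have "completion S.A ?u \<cong>\<^sub>* completion T.A ?u'"
  proof (rule completion_iso[of N _ _ N'])
    fix x assume x: "x \<in> S.A"
    have "N x = N (poly_subst f' (poly_subst f x))"
      using S.seminorm_cong[OF inv[OF x]] by simp
    also have "\<dots> \<le> N' (poly_subst f x)" by (rule le'[OF in_T[OF x]])
    finally show "N' (poly_subst f x) = N x" using le[OF x] by simp
  next
    fix y assume y: "y \<in> T.A"
    then show "\<exists>x\<in>S.A. N' (poly_subst f x - y) = 0"
      using inv'[OF y] in_S[OF y] unfolding T.null_cong_def by blast
  qed (rule S.cstar_completion_axioms T.cstar_completion_axioms f, assumption?)+
  then show ?thesis by (simp add: hypergraph_cstar_def universal_cstar_def)
qed

section \<open>Outsplitting\<close>

context cstar_seminormed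
begin

lemma null_familyD:
  assumes "null_family H p s"
  shows "orthogonal_projections (verts H) p"
    and "e \<in> edges H \<Longrightarrow> s e * poly_star (s e) * s e \<doteq> s e"
    and "e \<in> edges H \<Longrightarrow> poly_star (s e) * s e \<doteq> sum p (rng H e)"
    and "e \<in> edges H \<Longrightarrow> f \<in> edges H \<Longrightarrow> e \<noteq> f \<Longrightarrow> poly_star (s e) * s f \<doteq> 0"
    and "e \<in> edges H \<Longrightarrow> sum p (src H e) * s e \<doteq> s e"
    and "v \<in> verts H \<Longrightarrow> \<not> is_sink H v \<Longrightarrow>
      (\<Sum>e\<in>{e \<in> edges H. v \<in> src H e}. s e * poly_star (s e)) * p v \<doteq> p v"
proof -
  have *: "poly_star (s e) * s f \<doteq> (if e = f then sum p (rng H e) else 0)"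
    if "e \<in> edges H" "f \<in> edges H" for e f
    using assms that unfolding null_family_def by blast
  from *[of e e] show "e \<in> edges H \<Longrightarrow> poly_star (s e) * s e \<doteq> sum p (rng H e)" by simp
  from *[of e f] show "e \<in> edges H \<Longrightarrow> f \<in> edges H \<Longrightarrow> e \<noteq> f \<Longrightarrow> poly_star (s e) * s f \<doteq> 0" by simp
qed (use assms in \<open>simp_all add: null_family_def\<close>)

lemma null_family_mult_range:
  assumes "null_family H p s" "e \<in> edges H"
  shows "s e * sum p (rng H e) \<doteq> s e"
proof -
  have "s e * sum p (rng H e) \<doteq> s e * (poly_star (s e) * s e)"
    by (intro null_cong_mult null_cong_refl null_cong_sym[OF null_familyD(3)[OF assms]])
  also have "\<dots> = s e * poly_star (s e) * s e" by (simp add: mult.assoc)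
  also note null_familyD(2)[OF assms]
  finally show ?thesis .
qed

lemma null_family_ranges:
  assumes "null_family H p s"
  shows "orthogonal_projections (edges H) (\<lambda>e. s e * poly_star (s e))"
  by (intro range_projections null_familyD(2,4)[OF assms])

text \<open>The adjoint form of (HR2a), used to bound sums of range projections from above.\<close>

lemma null_family_range_mult_source:
  assumes s: "null_family H p s" "e \<in> edges H" and P: "poly_star P \<doteq> P" "P * s e \<doteq> s e"
  shows "s e * poly_star (s e) * P \<doteq> s e * poly_star (s e)"
proof -
  have "s e * poly_star (s e) * P \<doteq> s e * poly_star (s e) * poly_star P"
    by (intro null_cong_mult null_cong_refl null_cong_sym[OF P(1)])
  also have "\<dots> = s e * poly_star (P * s e)" by (simp add: mult.assoc)
  also have "\<dots> \<doteq> s e * poly_star (s e)" by (intro null_cong_intros null_cong_refl P)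
  finally show ?thesis .
qed

lemma orthogonal_projectionsI:
  assumes "\<And>i. i \<in> I \<Longrightarrow> poly_star (p i) \<doteq> p i" "\<And>i. i \<in> I \<Longrightarrow> p i * p i \<doteq> p i"
    and "\<And>i j. i \<in> I \<Longrightarrow> j \<in> I \<Longrightarrow> i \<noteq> j \<Longrightarrow> p i * p j \<doteq> 0"
  shows "orthogonal_projections I p"
  using assms by (simp add: orthogonal_projections_def)

lemma mult_null_swap:
  assumes "x * y \<doteq> 0" "poly_star x \<doteq> x" "poly_star y \<doteq> y"
  shows "y * x \<doteq> 0"
proof -
  have "y * x \<doteq> poly_star y * poly_star x"
    by (intro null_cong_mult null_cong_sym[OF assms(2)] null_cong_sym[OF assms(3)])
  also have "\<dots> = poly_star (x * y)" by simp
  also have "\<dots> \<doteq> poly_star 0" by (intro null_cong_star assms)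
  finally show ?thesis by simp
qed

text \<open>Given (HR1), being a partial isometry amounts to absorbing
  \<open>sum p (rng H e)\<close> on the right, which is easier to verify for edges that are cut down
  or summed.\<close>

lemma null_familyI:
  assumes "orthogonal_projections (verts H) p"
    and "\<And>e. e \<in> edges H \<Longrightarrow> s e * sum p (rng H e) \<doteq> s e"
    and HR1: "\<And>e f. e \<in> edges H \<Longrightarrow> f \<in> edges H \<Longrightarrow>
      poly_star (s e) * s f \<doteq> (if e = f then sum p (rng H e) else 0)"
    and "\<And>e. e \<in> edges H \<Longrightarrow> sum p (src H e) * s e \<doteq> s e"
    and "\<And>v. v \<in> verts H \<Longrightarrow> \<not> is_sink H v \<Longrightarrow>
      (\<Sum>e\<in>{e \<in> edges H. v \<in> src H e}. s e * poly_star (s e)) * p v \<doteq> p v"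
  shows "null_family H p s"
proof -
  have "s e * poly_star (s e) * s e \<doteq> s e" if "e \<in> edges H" for e
  proof -
    have "s e * (poly_star (s e) * s e) \<doteq> s e * sum p (rng H e)"
      using HR1[OF that that] by (intro null_cong_mult null_cong_refl) simp
    also have "\<dots> \<doteq> s e" using that by (rule assms)
    finally show ?thesis by (simp add: mult.assoc)
  qed
  with assms show ?thesis by (simp add: null_family_def)
qed

end

section \<open>Combinatorics of the outsplit hypergraph\<close>

lemma is_sink_iff: "is_sink H v \<longleftrightarrow> {e \<in> edges H. v \<in> src H e} = {}"
  by (auto simp: is_sink_def)

locale outsplitting = finite_hypergraph H for H :: "('v, 'e) hypergraph" +
  fixes w :: 'v and n :: nat and \<E> :: "nat \<Rightarrow> 'e set"
  assumes w_verts: "w \<in> verts H" and not_sink: "\<not> is_sink H w" and ultra: "locally_ultra H w"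
    and blocks: "{e \<in> edges H. w \<in> src H e} = (\<Union>j\<in>{1..n}. \<E> j)"
    and disjoint: "disjoint_family_on \<E> {1..n}" and nonempty: "\<forall>j\<in>{1..n}. \<E> j \<noteq> {}"
begin

abbreviation H\<^sub>O where "H\<^sub>O \<equiv> outsplit H w n \<E>"

text \<open>The indices \<open>i\<close> for which the outsplit hypergraph has an edge \<open>e\<^sup>i\<close>.\<close>

definition idx :: "'e \<Rightarrow> nat set" where
  "idx e = (if w \<in> rng H e then {1..n} else {1})"

text \<open>The vertices of the outsplit hypergraph lying over \<open>S\<close> when every
  \<open>w\<^sup>j\<close> is mapped to \<open>w\<close>.\<close>

definition expand :: "'v set \<Rightarrow> ('v + nat) set" where
  "expand S = Inl ` (S - {w}) \<union> (if w \<in> S then Inr ` {1..n} else {})"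

lemma in_expand [simp]:
  "Inl v \<in> expand S \<longleftrightarrow> v \<in> S \<and> v \<noteq> w"
  "Inr j \<in> expand S \<longleftrightarrow> w \<in> S \<and> j \<in> {1..n}"
  by (auto simp: expand_def)

text \<open>\<open>w\<close> emits an edge, which belongs to some block; hence
  \<open>w\<^sup>1\<close>, to which edges \<open>e\<^sup>1\<close> may point, is a vertex.\<close>

lemma n_pos: "1 \<le> n"
proof -
  obtain e where "e \<in> edges H" "w \<in> src H e" using not_sink by (auto simp: is_sink_def)
  then have "e \<in> (\<Union>j\<in>{1..n}. \<E> j)" using blocks by blast
  then show ?thesis by auto
qed

lemma block_edges: "j \<in> {1..n} \<Longrightarrow> e \<in> \<E> j \<Longrightarrow> e \<in> edges H \<and> w \<in> src H e"
  using blocks by blast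

lemma block_subset: "j \<in> {1..n} \<Longrightarrow> \<E> j \<subseteq> edges H"
  using block_edges by blast

lemma finite_block: "j \<in> {1..n} \<Longrightarrow> finite (\<E> j)"
  using block_subset finite_edges finite_subset by blast

lemma block_unique: "i \<in> {1..n} \<Longrightarrow> j \<in> {1..n} \<Longrightarrow> e \<in> \<E> i \<Longrightarrow> e \<in> \<E> j \<Longrightarrow> i = j"
  using disjoint unfolding disjoint_family_on_def by blast

lemma src_eq: "e \<in> edges H \<Longrightarrow> w \<in> src H e \<Longrightarrow> src H e = {w}"
  using ultra by (simp add: locally_ultra_def)

lemma finite_idx [simp]: "finite (idx e)"
  by (simp add: idx_def)

lemma idx_nonempty [simp]: "idx e \<noteq> {}"
  using n_pos by (simp add: idx_def)

lemma verts_O: "verts H\<^sub>O = expand (verts H)"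
  using w_verts by (simp add: outsplit_def expand_def)

lemma verts_O_cases:
  assumes "x \<in> verts H\<^sub>O"
  obtains (Inl) v where "x = Inl v" "v \<in> verts H" "v \<noteq> w" | (Inr) j where "x = Inr j" "j \<in> {1..n}"
  using assms by (cases x) (auto simp: verts_O)

lemma edges_O: "edges H\<^sub>O = Sigma (edges H) idx"
  unfolding outsplit_def idx_def hypergraph.simps by (auto split: if_splits)

lemma rng_O: "rng H\<^sub>O (e, i) = (if w \<notin> rng H e then Inl ` rng H e
    else if i = 1 then Inl ` (rng H e - {w}) \<union> {Inr 1} else {Inr i})"
  by (simp add: outsplit_def)

lemma src_O: "e \<in> edges H \<Longrightarrow> w \<notin> src H e \<Longrightarrow> src H\<^sub>O (e, i) = Inl ` src H e"
  by (simp add: outsplit_def)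

lemma src_O_block:
  assumes j: "j \<in> {1..n}" "e \<in> \<E> j"
  shows "src H\<^sub>O (e, i) = {Inr j}"
proof -
  have e: "src H e = {w}" using block_edges[OF j] src_eq by blast
  have "{Inr k |k. k \<in> {1..n} \<and> e \<in> \<E> k} = {Inr j}"
    using j block_unique by blast
  with e show ?thesis by (simp add: outsplit_def)
qed

lemma expand_mono: "S \<subseteq> T \<Longrightarrow> expand S \<subseteq> expand T"
  by (auto simp: expand_def)

lemma finite_expand [simp]: "finite S \<Longrightarrow> finite (expand S)"
  by (simp add: expand_def)

lemma expand_UN: "expand S = (\<Union>v\<in>S. expand {v})"
proof (rule Set.set_eqI)
  show "x \<in> expand S \<longleftrightarrow> x \<in> (\<Union>v\<in>S. expand {v})" for x by (cases x) auto
qed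

lemma expand_disjoint: "v \<noteq> v' \<Longrightarrow> expand {v} \<inter> expand {v'} = {}"
  by (auto simp: expand_def split: if_splits)

text \<open>Together with \<open>rng_O_disjoint\<close>, this partitions the vertices over
  \<open>rng H e\<close> among the copies of \<open>e\<close>, so that cutting
  \<open>s\<^sub>e\<close> down to the copies loses nothing.\<close>

lemma rng_O_UN: "(\<Union>i\<in>idx e. rng H\<^sub>O (e, i)) = expand (rng H e)"
  using n_pos by (auto simp: rng_O idx_def expand_def split: if_splits)

lemma rng_O_disjoint: "i \<in> idx e \<Longrightarrow> j \<in> idx e \<Longrightarrow> i \<noteq> j \<Longrightarrow> rng H\<^sub>O (e, i) \<inter> rng H\<^sub>O (e, j) = {}"
  by (auto simp: rng_O idx_def split: if_splits)

lemma rng_O_subset: "i \<in> idx e \<Longrightarrow> rng H\<^sub>O (e, i) \<subseteq> expand (rng H e)"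
  using rng_O_UN by blast

lemma src_O_subset:
  assumes "e \<in> edges H"
  shows "src H\<^sub>O (e, i) \<subseteq> expand (src H e)"
proof (cases "w \<in> src H e")
  case True
  then obtain j where "j \<in> {1..n}" "e \<in> \<E> j" using blocks assms by blast
  with True show ?thesis by (auto simp: src_O_block expand_def)
next
  case False
  with assms show ?thesis by (auto simp: src_O expand_def)
qed

lemma src_O_nonempty:
  assumes "e \<in> edges H"
  shows "src H\<^sub>O (e, i) \<noteq> {}"
proof (cases "w \<in> src H e")
  case True
  then obtain j where "j \<in> {1..n}" "e \<in> \<E> j" using blocks assms by blast
  then show ?thesis by (simp add: src_O_block)
next
  case False
  with assms src_nonempty show ?thesis by (simp add: src_O)
qed

sublocale O: finite_hypergraph H\<^sub>O
proof
  show "finite (verts H\<^sub>O)" "finite (edges H\<^sub>O)"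
    using finite_verts finite_edges by (simp_all add: verts_O edges_O)
  fix x assume "x \<in> edges H\<^sub>O"
  then obtain e i where x: "x = (e, i)" "e \<in> edges H" "i \<in> idx e" by (auto simp: edges_O)
  show "rng H\<^sub>O x \<subseteq> verts H\<^sub>O"
    using x rng_O_subset[of i e] expand_mono[OF rng_subset[of e]] by (auto simp: verts_O)
  show "rng H\<^sub>O x \<noteq> {}"
    using x rng_nonempty[of e] by (simp add: rng_O)
  show "src H\<^sub>O x \<subseteq> verts H\<^sub>O"
    using x src_O_subset[of e i] expand_mono[OF src_subset[of e]] by (auto simp: verts_O)
  show "src H\<^sub>O x \<noteq> {}" using x src_O_nonempty by simp
qed

text \<open>An edge with \<open>w\<close> in its source has no other source vertex, by local
  ultraness. Outsplitting therefore only duplicates the edges that leave \<open>v\<close>.\<close>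

lemma emitted_Inl:
  assumes "v \<noteq> w"
  shows "{x \<in> edges H\<^sub>O. Inl v \<in> src H\<^sub>O x} = Sigma {e \<in> edges H. v \<in> src H e} idx"
proof -
  have "Inl v \<in> src H\<^sub>O (e, i) \<longleftrightarrow> v \<in> src H e" if e: "e \<in> edges H" for e i
  proof (cases "w \<in> src H e")
    case True
    then obtain j where "j \<in> {1..n}" "e \<in> \<E> j" using blocks e by blast
    then show ?thesis using src_eq[OF e True] assms by (simp add: src_O_block)
  qed (use e in \<open>auto simp: src_O\<close>)
  then show ?thesis by (auto simp: edges_O)
qed

lemma emitted_Inr:
  assumes j: "j \<in> {1..n}"
  shows "{x \<in> edges H\<^sub>O. Inr j \<in> src H\<^sub>O x} = Sigma (\<E> j) idx"
proof -
  have "Inr j \<in> src H\<^sub>O (e, i) \<longleftrightarrow> e \<in> \<E> j" if e: "e \<in> edges H" for e i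
  proof (cases "w \<in> src H e")
    case True
    then obtain k where "k \<in> {1..n}" "e \<in> \<E> k" using blocks e by blast
    then show ?thesis using block_unique[OF j, of k e] by (auto simp: src_O_block)
  qed (use e block_edges[OF j] in \<open>auto simp: src_O\<close>)
  then show ?thesis using block_edges[OF j] by (auto simp: edges_O)
qed

lemma is_sink_Inl: "v \<noteq> w \<Longrightarrow> is_sink H\<^sub>O (Inl v) \<longleftrightarrow> is_sink H v"
  by (simp add: is_sink_iff emitted_Inl Sigma_empty_iff del: Collect_empty_eq) simp

text \<open>Nonempty blocks make (HR2b) available at \<open>w\<^sup>j\<close>, which ties its
  projection to the ranges of the edges in the block.\<close>

lemma not_is_sink_Inr: "j \<in> {1..n} \<Longrightarrow> \<not> is_sink H\<^sub>O (Inr j)"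
  using nonempty by (simp add: is_sink_iff emitted_Inr Sigma_empty_iff del: Collect_empty_eq)

text \<open>The mutually inverse translations between families for the two hypergraphs.\<close>

fun split_vert :: "('v \<Rightarrow> 'g star_poly) \<Rightarrow> ('e \<Rightarrow> 'g star_poly) \<Rightarrow> 'v + nat \<Rightarrow> 'g star_poly" where
  "split_vert p s (Inl v) = p v"
| "split_vert p s (Inr j) = (\<Sum>e\<in>\<E> j. s e * poly_star (s e))"

definition split_edge :: "('v \<Rightarrow> 'g star_poly) \<Rightarrow> ('e \<Rightarrow> 'g star_poly) \<Rightarrow> 'e \<times> nat \<Rightarrow> 'g star_poly" where
  "split_edge p s x = s (fst x) * sum (split_vert p s) (rng H\<^sub>O x)"

definition merge_vert :: "('v + nat \<Rightarrow> 'g star_poly) \<Rightarrow> 'v \<Rightarrow> 'g star_poly" where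
  "merge_vert q v = sum q (expand {v})"

definition merge_edge :: "('e \<times> nat \<Rightarrow> 'g star_poly) \<Rightarrow> 'e \<Rightarrow> 'g star_poly" where
  "merge_edge t e = (\<Sum>i\<in>idx e. t (e, i))"

lemma sum_merge_vert:
  assumes "finite S"
  shows "sum (merge_vert q) S = sum q (expand S)"
  unfolding expand_UN[of S] merge_vert_def
  using assms expand_disjoint by (subst sum.UNION_disjoint) simp_all

lemma sum_rng_O:
  assumes "e \<in> edges H"
  shows "(\<Sum>i\<in>idx e. sum q (rng H\<^sub>O (e, i))) = sum q (expand (rng H e))"
proof -
  have "finite (rng H\<^sub>O (e, i))" if "i \<in> idx e" for i
    using that assms O.rng_subset[of "(e, i)"] O.finite_verts by (auto simp: edges_O intro: finite_subset)
  then show ?thesis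
    unfolding rng_O_UN[symmetric] using rng_O_disjoint by (subst sum.UNION_disjoint) auto
qed

end

section \<open>From families for the hypergraph to families for the outsplit one\<close>

locale outsplitting_seminormed = outsplitting H w n \<E> + cstar_seminormed N
  for H :: "('v, 'e) hypergraph" and w n \<E> and N :: "'g star_poly \<Rightarrow> real"
begin

lemma finite_rng: "e \<in> edges H \<Longrightarrow> finite (rng H e)"
  and finite_rng_O: "x \<in> edges H\<^sub>O \<Longrightarrow> finite (rng H\<^sub>O x)"
  by (erule finite_subset[OF rng_subset finite_verts] finite_subset[OF O.rng_subset O.finite_verts])+

context
  fixes p :: "'v \<Rightarrow> 'g star_poly" and s :: "'e \<Rightarrow> 'g star_poly"
  assumes fam: "null_family H p s"
begin

abbreviation (input) "q \<equiv> split_vert p s"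
abbreviation (input) "t \<equiv> split_edge p s"

lemma vert_w_eq: "sum q (expand {w}) \<doteq> p w"
proof -
  let ?R = "\<Sum>e\<in>{e \<in> edges H. w \<in> src H e}. s e * poly_star (s e)"
  have "sum q (expand {w}) = (\<Sum>j\<in>{1..n}. \<Sum>e\<in>\<E> j. s e * poly_star (s e))"
    by (simp add: expand_def sum.reindex)
  also have "\<dots> = ?R"
    unfolding blocks using finite_block disjoint
    by (intro sum.UNION_disjoint[symmetric]) (simp_all add: disjoint_family_on_def)
  also have "?R \<doteq> p w"
  proof -
    \<comment> \<open>(HR2a) for edges with source exactly \<open>{w}\<close> puts \<open>?R\<close>
      below \<open>p w\<close>; (HR2b) is the reverse comparison.\<close>
    have "?R * p w \<doteq> ?R"
      unfolding sum_distrib_right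
    proof (rule null_cong_sum)
      fix e assume "e \<in> {e \<in> edges H. w \<in> src H e}"
      then have e: "e \<in> edges H" "src H e = {w}" using src_eq by blast+
      have "p w * s e \<doteq> s e" using null_familyD(5)[OF fam e(1)] e by simp
      then show "s e * poly_star (s e) * p w \<doteq> s e * poly_star (s e)"
        by (intro null_family_range_mult_source[OF fam e(1)]
            orthogonal_projectionsD(1)[OF null_familyD(1)[OF fam] w_verts])
    qed
    then show ?thesis
      using null_cong_trans[OF null_cong_sym null_familyD(6)[OF fam w_verts not_sink]] by blast
  qed
  finally show ?thesis .
qed

lemma sum_split_vert_singleton: "sum q (expand {v}) \<doteq> p v"
proof (cases "v = w")
  case True
  then show ?thesis by (simp only: vert_w_eq)
next
  case False
  then show ?thesis by (simp add: expand_def)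
qed

lemma sum_split_vert:
  assumes "finite S"
  shows "sum q (expand S) \<doteq> sum p S"
  unfolding sum_merge_vert[OF assms, symmetric] merge_vert_def
  by (intro null_cong_sum sum_split_vert_singleton)

text \<open>The range projection of \<open>e\<close> is one of the orthogonal summands of
  \<open>q (Inr j)\<close>. This becomes (HR2a) for the copies of \<open>e\<close>.\<close>

lemma split_vert_Inr_mult:
  assumes j: "j \<in> {1..n}" and e: "e \<in> \<E> j"
  shows "q (Inr j) * s e \<doteq> s e"
proof -
  have eH: "e \<in> edges H" using block_edges[OF j e] by simp
  have "q (Inr j) * s e \<doteq> q (Inr j) * (s e * poly_star (s e) * s e)"
    by (intro null_cong_mult null_cong_refl null_cong_sym[OF null_familyD(2)[OF fam eH]])
  also have "\<dots> = q (Inr j) * (s e * poly_star (s e)) * s e" by (simp add: mult.assoc)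
  also have "\<dots> \<doteq> s e * poly_star (s e) * s e"
    using orthogonal_sum_mult[OF null_family_ranges[OF fam] block_subset[OF j] finite_block[OF j] eH] e
    by (intro null_cong_mult_right) simp
  also have "\<dots> \<doteq> s e" by (rule null_familyD(2)[OF fam eH])
  finally show ?thesis .
qed

text \<open>The ranges making up \<open>q (Inr j)\<close> lie below \<open>p w\<close>, which is
  orthogonal to \<open>p v\<close>.\<close>

lemma split_vert_Inl_Inr:
  assumes v: "v \<in> verts H" "v \<noteq> w" and j: "j \<in> {1..n}"
  shows "q (Inl v) * q (Inr j) \<doteq> 0"
proof -
  have "p v * (s e * poly_star (s e)) \<doteq> 0" if "e \<in> \<E> j" for e
  proof -
    have e: "e \<in> edges H" "src H e = {w}" using block_edges[OF j that] src_eq by blast+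
    have "p w * s e \<doteq> s e" using null_familyD(5)[OF fam e(1)] e by simp
    then have "p v * s e \<doteq> p v * (p w * s e)"
      by (rule null_cong_mult[OF null_cong_refl null_cong_sym])
    also have "\<dots> = p v * p w * s e" by (simp add: mult.assoc)
    also have "\<dots> \<doteq> 0 * s e"
      using orthogonal_projectionsD(3)[OF null_familyD(1)[OF fam] v(1) w_verts v(2)]
      by (intro null_cong_mult null_cong_refl)
    finally have "p v * s e \<doteq> 0" by simp
    then have "p v * s e * poly_star (s e) \<doteq> 0" by (rule null_mult_right)
    then show ?thesis by (simp add: mult.assoc)
  qed
  then have "(\<Sum>e\<in>\<E> j. p v * (s e * poly_star (s e))) \<doteq> (\<Sum>e\<in>\<E> j. 0)" by (rule null_cong_sum)
  then show ?thesis by (simp add: sum_distrib_left)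
qed

lemma split_vert_projections: "orthogonal_projections (verts H\<^sub>O) q"
proof (rule orthogonal_projectionsI)
  note p = orthogonal_projectionsD[OF null_familyD(1)[OF fam]]
  have star: "poly_star (q x) \<doteq> q x" if "x \<in> verts H\<^sub>O" for x
    using that p(1) by (cases x) (simp_all add: verts_O)
  then show "poly_star (q x) \<doteq> q x" if "x \<in> verts H\<^sub>O" for x using that .
  have range: "q (Inr i) * q (Inr j) \<doteq> (\<Sum>e\<in>\<E> i \<inter> \<E> j. s e * poly_star (s e))"
    if "i \<in> {1..n}" "j \<in> {1..n}" for i j
    unfolding split_vert.simps using that
    by (intro orthogonal_sums[OF null_family_ranges[OF fam]] block_subset finite_block)
  show "q x * q x \<doteq> q x" if x: "x \<in> verts H\<^sub>O" for x
    using x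
  proof (cases rule: verts_O_cases)
    case (Inl v)
    then show ?thesis using p(2) by simp
  next
    case (Inr j)
    then show ?thesis using range[of j j] by simp
  qed
  show "q x * q y \<doteq> 0" if x: "x \<in> verts H\<^sub>O" and y: "y \<in> verts H\<^sub>O" and "x \<noteq> y" for x y
    using x
  proof (cases rule: verts_O_cases)
    case xl: (Inl v)
    show ?thesis
      using y
    proof (cases rule: verts_O_cases)
      case (Inl v')
      then show ?thesis using xl \<open>x \<noteq> y\<close> p(3)[of v v'] by simp
    next
      case (Inr j)
      then show ?thesis using xl split_vert_Inl_Inr[of v j] by simp
    qed
  next
    case xr: (Inr i)
    show ?thesis
      using y
    proof (cases rule: verts_O_cases)
      case (Inl v)
      then have "q y * q x \<doteq> 0" using xr split_vert_Inl_Inr[of v i] by simp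
      then show ?thesis by (rule mult_null_swap[OF _ star[OF y] star[OF x]])
    next
      case (Inr j)
      have "i \<noteq> j" using xr(1) Inr(1) \<open>x \<noteq> y\<close> by simp
      then have "\<E> i \<inter> \<E> j = {}" using block_unique[OF xr(2) Inr(2)] by blast
      then show ?thesis using range[OF xr(2) Inr(2)] xr(1) Inr(1) by simp
    qed
  qed
qed

lemma split_edge_range:
  assumes x: "x \<in> edges H\<^sub>O"
  shows "poly_star (sum q (rng H\<^sub>O x)) \<doteq> sum q (rng H\<^sub>O x)"
    and "sum q (rng H\<^sub>O x) * sum q (rng H\<^sub>O x) \<doteq> sum q (rng H\<^sub>O x)"
  using orthogonal_sum_star[OF split_vert_projections O.rng_subset[OF x]]
    orthogonal_sums[OF split_vert_projections O.rng_subset[OF x] finite_rng_O[OF x]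
      O.rng_subset[OF x] finite_rng_O[OF x]] by simp_all

lemma mult_sum_expand_rng:
  assumes e: "e \<in> edges H"
  shows "s e * sum q (expand (rng H e)) \<doteq> s e"
proof -
  have "s e * sum q (expand (rng H e)) \<doteq> s e * sum p (rng H e)"
    by (intro null_cong_mult null_cong_refl sum_split_vert finite_rng e)
  also have "\<dots> \<doteq> s e" by (rule null_family_mult_range[OF fam e])
  finally show ?thesis .
qed

lemma sum_split_edge:
  assumes e: "e \<in> edges H"
  shows "(\<Sum>i\<in>idx e. t (e, i)) \<doteq> s e"
  using mult_sum_expand_rng[OF e]
  by (simp add: split_edge_def sum_rng_O[OF e] flip: sum_distrib_left)

text \<open>The copies of \<open>e\<close> cut \<open>s e\<close> on the right by projections that
  together act on it as the identity, so their ranges add up to that of \<open>e\<close> and the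
  range sums in (HR2b) are preserved.\<close>

lemma sum_split_edge_ranges:
  assumes F: "F \<subseteq> edges H"
  shows "(\<Sum>x\<in>Sigma F idx. t x * poly_star (t x)) \<doteq> (\<Sum>e\<in>F. s e * poly_star (s e))"
proof -
  have fin: "finite F" using F finite_edges finite_subset by blast
  have "(\<Sum>x\<in>Sigma F idx. t x * poly_star (t x)) = (\<Sum>e\<in>F. \<Sum>i\<in>idx e. t (e, i) * poly_star (t (e, i)))"
    using fin by (simp add: sum.Sigma)
  also have "\<dots> \<doteq> (\<Sum>e\<in>F. s e * poly_star (s e))"
  proof (rule null_cong_sum)
    fix e assume "e \<in> F"
    then have e: "e \<in> edges H" using F by blast
    have "t (e, i) * poly_star (t (e, i)) \<doteq> s e * sum q (rng H\<^sub>O (e, i)) * poly_star (s e)"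
      if i: "i \<in> idx e" for i
    proof -
      have x: "(e, i) \<in> edges H\<^sub>O" using e i by (simp add: edges_O)
      have "t (e, i) * poly_star (t (e, i))
          = s e * (sum q (rng H\<^sub>O (e, i)) * poly_star (sum q (rng H\<^sub>O (e, i)))) * poly_star (s e)"
        by (simp add: split_edge_def mult.assoc del: poly_star_sum)
      also have "\<dots> \<doteq> s e * (sum q (rng H\<^sub>O (e, i)) * sum q (rng H\<^sub>O (e, i))) * poly_star (s e)"
        by (intro null_cong_mult null_cong_refl split_edge_range x)
      also have "\<dots> \<doteq> s e * sum q (rng H\<^sub>O (e, i)) * poly_star (s e)"
        by (intro null_cong_mult null_cong_refl split_edge_range x)
      finally show ?thesis .
    qed
    then have "(\<Sum>i\<in>idx e. t (e, i) * poly_star (t (e, i)))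
        \<doteq> (\<Sum>i\<in>idx e. s e * sum q (rng H\<^sub>O (e, i)) * poly_star (s e))"
      by (rule null_cong_sum)
    also have "\<dots> = s e * sum q (expand (rng H e)) * poly_star (s e)"
      by (simp add: sum_rng_O[OF e] flip: sum_distrib_left sum_distrib_right)
    also have "\<dots> \<doteq> s e * poly_star (s e)"
      by (intro null_cong_mult null_cong_refl mult_sum_expand_rng e)
    finally show "(\<Sum>i\<in>idx e. t (e, i) * poly_star (t (e, i))) \<doteq> s e * poly_star (s e)" .
  qed
  finally show ?thesis .
qed

lemma null_family_split: "null_family H\<^sub>O q t"
proof (rule null_familyI)
  show "orthogonal_projections (verts H\<^sub>O) q" by (rule split_vert_projections)
next
  fix x assume x: "x \<in> edges H\<^sub>O"
  show "t x * sum q (rng H\<^sub>O x) \<doteq> t x"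
    unfolding split_edge_def mult.assoc by (intro null_cong_mult null_cong_refl split_edge_range x)
  obtain e i where ei: "x = (e, i)" "e \<in> edges H" "i \<in> idx e" using x by (auto simp: edges_O)
  have "sum q (src H\<^sub>O x) * s e \<doteq> s e"
  proof (cases "w \<in> src H e")
    case True
    then obtain j where j: "j \<in> {1..n}" "e \<in> \<E> j" using blocks ei by blast
    then show ?thesis using split_vert_Inr_mult[OF j] by (simp add: ei src_O_block)
  next
    case False
    then show ?thesis
      using null_familyD(5)[OF fam ei(2)] ei by (simp add: src_O sum.reindex)
  qed
  then show "sum q (src H\<^sub>O x) * t x \<doteq> t x"
    unfolding split_edge_def ei fst_conv mult.assoc[symmetric]
    by (intro null_cong_mult null_cong_refl)
next
  fix x y assume x: "x \<in> edges H\<^sub>O" and y: "y \<in> edges H\<^sub>O"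
  obtain e i where ei: "x = (e, i)" "e \<in> edges H" "i \<in> idx e" using x by (auto simp: edges_O)
  obtain f j where fj: "y = (f, j)" "f \<in> edges H" "j \<in> idx f" using y by (auto simp: edges_O)
  let ?Qx = "sum q (rng H\<^sub>O x)" and ?Qy = "sum q (rng H\<^sub>O y)"
  have eq: "poly_star (t x) * t y = poly_star ?Qx * (poly_star (s e) * s f) * ?Qy"
    by (simp add: split_edge_def ei fj mult.assoc del: poly_star_sum)
  show "poly_star (t x) * t y \<doteq> (if x = y then ?Qx else 0)"
  proof (cases "e = f")
    case False
    have "poly_star ?Qx * (poly_star (s e) * s f) * ?Qy \<doteq> poly_star ?Qx * 0 * ?Qy"
      by (intro null_cong_mult null_cong_refl null_familyD(4)[OF fam ei(2) fj(2) False])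
    with False eq ei fj show ?thesis by simp
  next
    case True
    have sub: "rng H\<^sub>O x \<subseteq> expand (rng H e)" "rng H\<^sub>O y \<subseteq> expand (rng H e)"
        "expand (rng H e) \<subseteq> verts H\<^sub>O"
      using ei fj True rng_O_subset expand_mono[OF rng_subset[OF ei(2)]] by (auto simp: verts_O)
    have fin: "finite (expand (rng H e))" using finite_rng[OF ei(2)] by simp
    have "poly_star (s e) * s f \<doteq> sum p (rng H e)" using null_familyD(3)[OF fam ei(2)] True by simp
    also have "\<dots> \<doteq> sum q (expand (rng H e))"
      by (rule null_cong_sym[OF sum_split_vert[OF finite_rng[OF ei(2)]]])
    finally have "poly_star ?Qx * (poly_star (s e) * s f) * ?Qy \<doteq> ?Qx * sum q (expand (rng H e)) * ?Qy"
      by (intro null_cong_mult null_cong_refl split_edge_range x)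
    also have "\<dots> \<doteq> sum q (rng H\<^sub>O x \<inter> expand (rng H e)) * ?Qy"
      using sub fin finite_rng_O[OF x]
      by (intro null_cong_mult null_cong_refl orthogonal_sums[OF split_vert_projections]) auto
    also have "rng H\<^sub>O x \<inter> expand (rng H e) = rng H\<^sub>O x" using sub by blast
    \<comment> \<open>For two copies of one edge, (HR1) reduces to the intersection of their ranges,
      which is empty for different indices.\<close>
    also have "?Qx * ?Qy \<doteq> sum q (rng H\<^sub>O x \<inter> rng H\<^sub>O y)"
      using finite_rng_O x y by (intro orthogonal_sums[OF split_vert_projections] O.rng_subset)
    also have "\<dots> = (if x = y then ?Qx else 0)"
      using rng_O_disjoint[of i e j] ei fj True by auto
    finally show ?thesis using eq by simp
  qed
next
  fix x assume x: "x \<in> verts H\<^sub>O" and sink: "\<not> is_sink H\<^sub>O x"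
  show "(\<Sum>y\<in>{y \<in> edges H\<^sub>O. x \<in> src H\<^sub>O y}. t y * poly_star (t y)) * q x \<doteq> q x"
    using x
  proof (cases rule: verts_O_cases)
    case (Inl v)
    note v = Inl(2,3)
    have "(\<Sum>y\<in>Sigma {e \<in> edges H. v \<in> src H e} idx. t y * poly_star (t y)) * p v
        \<doteq> (\<Sum>e\<in>{e \<in> edges H. v \<in> src H e}. s e * poly_star (s e)) * p v"
      by (intro null_cong_mult null_cong_refl sum_split_edge_ranges) auto
    also have "\<dots> \<doteq> p v"
      using v sink Inl by (intro null_familyD(6)[OF fam]) (simp_all add: is_sink_Inl)
    finally show ?thesis using v by (simp add: Inl emitted_Inl)
  next
    case (Inr j)
    note j = Inr(2)
    \<comment> \<open>By the choice of \<open>q (Inr j)\<close>, the range sum at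
      \<open>w\<^sup>j\<close> is this projection itself, and (HR2b) becomes idempotence.\<close>
    have "(\<Sum>y\<in>Sigma (\<E> j) idx. t y * poly_star (t y)) * q (Inr j) \<doteq> q (Inr j) * q (Inr j)"
      unfolding split_vert.simps by (intro null_cong_mult null_cong_refl sum_split_edge_ranges block_subset j)
    also have "\<dots> \<doteq> q (Inr j)"
      using orthogonal_projectionsD(2)[OF split_vert_projections x] Inr by simp
    finally show ?thesis using j by (simp add: Inr emitted_Inr del: split_vert.simps)
  qed
qed

end

end

section \<open>From families for the outsplit hypergraph back\<close>

context outsplitting_seminormed
begin

context
  fixes q :: "'v + nat \<Rightarrow> 'g star_poly" and t :: "'e \<times> nat \<Rightarrow> 'g star_poly"
  assumes fam: "null_family H\<^sub>O q t"
begin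

abbreviation (input) "p \<equiv> merge_vert q"
abbreviation (input) "s \<equiv> merge_edge t"

lemma merge_sum_mult:
  assumes S: "S \<subseteq> verts H\<^sub>O" and T: "T \<subseteq> verts H\<^sub>O"
  shows "sum q S * sum q T \<doteq> sum q (S \<inter> T)"
  using S T finite_subset[OF S O.finite_verts] finite_subset[OF T O.finite_verts]
  by (intro orthogonal_sums[OF null_familyD(1)[OF fam]])

lemma expand_verts: "S \<subseteq> verts H \<Longrightarrow> expand S \<subseteq> verts H\<^sub>O"
  using expand_mono by (simp add: verts_O)

lemma edge_mult_superset:
  assumes x: "x \<in> edges H\<^sub>O" and S: "rng H\<^sub>O x \<subseteq> S" "S \<subseteq> verts H\<^sub>O"
  shows "t x * sum q S \<doteq> t x"
proof -
  note Q = null_family_mult_range[OF fam x]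
  have "t x * sum q S \<doteq> t x * sum q (rng H\<^sub>O x) * sum q S"
    by (rule null_cong_mult_right[OF null_cong_sym[OF Q]])
  also have "\<dots> = t x * (sum q (rng H\<^sub>O x) * sum q S)" by (simp add: mult.assoc)
  also have "\<dots> \<doteq> t x * sum q (rng H\<^sub>O x \<inter> S)"
    by (intro null_cong_mult_left merge_sum_mult O.rng_subset x S)
  also have "rng H\<^sub>O x \<inter> S = rng H\<^sub>O x" using S by blast
  also note Q
  finally show ?thesis .
qed

lemma edge_mult_disjoint:
  assumes x: "x \<in> edges H\<^sub>O" and S: "rng H\<^sub>O x \<inter> S = {}" "S \<subseteq> verts H\<^sub>O"
  shows "t x * sum q S \<doteq> 0"
proof -
  have "t x * sum q S \<doteq> t x * sum q (rng H\<^sub>O x) * sum q S"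
    by (rule null_cong_mult_right[OF null_cong_sym[OF null_family_mult_range[OF fam x]]])
  also have "\<dots> = t x * (sum q (rng H\<^sub>O x) * sum q S)" by (simp add: mult.assoc)
  also have "\<dots> \<doteq> t x * sum q (rng H\<^sub>O x \<inter> S)"
    by (intro null_cong_mult_left merge_sum_mult O.rng_subset x S)
  finally show ?thesis by (simp add: S)
qed

lemma mult_edge_superset:
  assumes x: "x \<in> edges H\<^sub>O" and S: "src H\<^sub>O x \<subseteq> S" "S \<subseteq> verts H\<^sub>O"
  shows "sum q S * t x \<doteq> t x"
proof -
  note P = null_familyD(5)[OF fam x]
  have "sum q S * t x \<doteq> sum q S * (sum q (src H\<^sub>O x) * t x)"
    by (rule null_cong_mult_left[OF null_cong_sym[OF P]])
  also have "\<dots> = sum q S * sum q (src H\<^sub>O x) * t x" by (simp add: mult.assoc)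
  also have "\<dots> \<doteq> sum q (S \<inter> src H\<^sub>O x) * t x"
    by (intro null_cong_mult_right merge_sum_mult O.src_subset x S)
  also have "S \<inter> src H\<^sub>O x = src H\<^sub>O x" using S by blast
  also note P
  finally show ?thesis .
qed

text \<open>(HR1) concerns products with the adjoint on the left. With the adjoint on the right, the
  cross terms vanish because different copies of \<open>e\<close> have disjoint ranges.\<close>

lemma merge_edge_range:
  assumes e: "e \<in> edges H"
  shows "s e * poly_star (s e) \<doteq> (\<Sum>i\<in>idx e. t (e, i) * poly_star (t (e, i)))"
proof -
  have "t (e, i) * poly_star (t (e, j)) \<doteq> (if i = j then t (e, i) * poly_star (t (e, i)) else 0)"
    if i: "i \<in> idx e" and j: "j \<in> idx e" for i j
  proof (cases "i = j")
    case False
    have x: "(e, i) \<in> edges H\<^sub>O" and y: "(e, j) \<in> edges H\<^sub>O" using e i j by (simp_all add: edges_O)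
    let ?Q = "sum q (rng H\<^sub>O (e, j))"
    have "poly_star ?Q \<doteq> ?Q"
      by (rule orthogonal_sum_star[OF null_familyD(1)[OF fam] O.rng_subset[OF y]])
    then have "?Q * poly_star (t (e, j)) \<doteq> poly_star ?Q * poly_star (t (e, j))"
      by (rule null_cong_mult_right[OF null_cong_sym])
    also have "\<dots> = poly_star (t (e, j) * ?Q)" by simp
    also have "\<dots> \<doteq> poly_star (t (e, j))"
      by (rule null_cong_star[OF null_family_mult_range[OF fam y]])
    finally have "t (e, i) * poly_star (t (e, j)) \<doteq> t (e, i) * (?Q * poly_star (t (e, j)))"
      by (rule null_cong_mult_left[OF null_cong_sym])
    also have "\<dots> = t (e, i) * ?Q * poly_star (t (e, j))" by (simp add: mult.assoc)
    also have "\<dots> \<doteq> 0"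
      by (intro null_mult_right edge_mult_disjoint rng_O_disjoint x i j False O.rng_subset y)
    finally show ?thesis using False by simp
  qed simp
  then have "(\<Sum>i\<in>idx e. \<Sum>j\<in>idx e. t (e, i) * poly_star (t (e, j)))
      \<doteq> (\<Sum>i\<in>idx e. \<Sum>j\<in>idx e. if i = j then t (e, i) * poly_star (t (e, i)) else 0)"
    by (intro null_cong_sum)
  also have "\<dots> = (\<Sum>i\<in>idx e. t (e, i) * poly_star (t (e, i)))" by simp
  finally show ?thesis by (simp add: merge_edge_def sum_product)
qed

lemma sum_merge_edge_ranges:
  assumes F: "F \<subseteq> edges H"
  shows "(\<Sum>e\<in>F. s e * poly_star (s e)) \<doteq> (\<Sum>x\<in>Sigma F idx. t x * poly_star (t x))"
proof -
  have fin: "finite F" using F finite_edges finite_subset by blast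
  have "(\<Sum>e\<in>F. s e * poly_star (s e)) \<doteq> (\<Sum>e\<in>F. \<Sum>i\<in>idx e. t (e, i) * poly_star (t (e, i)))"
    using F by (intro null_cong_sum merge_edge_range) blast
  also have "\<dots> = (\<Sum>x\<in>Sigma F idx. t x * poly_star (t x))"
    using fin by (simp add: sum.Sigma)
  finally show ?thesis .
qed

lemma merge_edge_mult:
  assumes e: "e \<in> edges H" and S: "S \<subseteq> verts H"
  shows "rng H e \<subseteq> S \<Longrightarrow> s e * sum p S \<doteq> s e"
    and "src H e \<subseteq> S \<Longrightarrow> sum p S * s e \<doteq> s e"
proof -
  have p: "sum p S = sum q (expand S)"
    using S finite_verts finite_subset by (intro sum_merge_vert) blast
  have x: "(e, i) \<in> edges H\<^sub>O" if "i \<in> idx e" for i using e that by (simp add: edges_O)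
  show "s e * sum p S \<doteq> s e" if "rng H e \<subseteq> S"
    unfolding p merge_edge_def sum_distrib_right
  proof (rule null_cong_sum)
    fix i assume i: "i \<in> idx e"
    show "t (e, i) * sum q (expand S) \<doteq> t (e, i)"
      by (rule edge_mult_superset[OF x[OF i] order_trans[OF rng_O_subset[OF i] expand_mono[OF that]]
            expand_verts[OF S]])
  qed
  show "sum p S * s e \<doteq> s e" if "src H e \<subseteq> S"
    unfolding p merge_edge_def sum_distrib_left
  proof (rule null_cong_sum)
    fix i assume i: "i \<in> idx e"
    show "sum q (expand S) * t (e, i) \<doteq> t (e, i)"
      by (rule mult_edge_superset[OF x[OF i] order_trans[OF src_O_subset[OF e] expand_mono[OF that]]
            expand_verts[OF S]])
  qed
qed

text \<open>(HR2b) at \<open>w\<^sup>j\<close> and (HR2a) for the copies of edges in the block,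
  which all have source \<open>{w\<^sup>j}\<close>, bound \<open>q (Inr j)\<close> and the range sum
  by each other. So \<open>q (Inr j)\<close> can be recovered from the edges.\<close>

lemma block_range_mult:
  assumes j: "j \<in> {1..n}"
  shows "(\<Sum>x\<in>Sigma (\<E> j) idx. t x * poly_star (t x)) * q (Inr j) \<doteq> q (Inr j)"
    and "(\<Sum>x\<in>Sigma (\<E> j) idx. t x * poly_star (t x)) * q (Inr j)
      \<doteq> (\<Sum>x\<in>Sigma (\<E> j) idx. t x * poly_star (t x))"
proof -
  have v: "Inr j \<in> verts H\<^sub>O" using j w_verts by (simp add: verts_O)
  show "(\<Sum>x\<in>Sigma (\<E> j) idx. t x * poly_star (t x)) * q (Inr j) \<doteq> q (Inr j)"
    using null_familyD(6)[OF fam v not_is_sink_Inr[OF j]] unfolding emitted_Inr[OF j] .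
  show "(\<Sum>x\<in>Sigma (\<E> j) idx. t x * poly_star (t x)) * q (Inr j)
      \<doteq> (\<Sum>x\<in>Sigma (\<E> j) idx. t x * poly_star (t x))"
    unfolding sum_distrib_right
  proof (rule null_cong_sum)
    fix x assume "x \<in> Sigma (\<E> j) idx"
    then have x: "x \<in> edges H\<^sub>O" "src H\<^sub>O x = {Inr j}"
      using block_edges[OF j] src_O_block[OF j] by (auto simp: edges_O)
    have "q (Inr j) * t x \<doteq> t x" using null_familyD(5)[OF fam x(1)] x(2) by simp
    then show "t x * poly_star (t x) * q (Inr j) \<doteq> t x * poly_star (t x)"
      by (rule null_family_range_mult_source[OF fam x(1)
            orthogonal_projectionsD(1)[OF null_familyD(1)[OF fam] v]])
  qed
qed

lemma null_family_merge: "null_family H p s"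
proof (rule null_familyI)
  show "orthogonal_projections (verts H) p"
  proof (rule orthogonal_projectionsI)
    fix v assume v: "v \<in> verts H"
    then have *: "expand {v} \<subseteq> verts H\<^sub>O" by (intro expand_verts) simp
    show "poly_star (p v) \<doteq> p v"
      unfolding merge_vert_def by (rule orthogonal_sum_star[OF null_familyD(1)[OF fam] *])
    show "p v * p v \<doteq> p v"
      using merge_sum_mult[OF * *] by (simp add: merge_vert_def)
    fix v' assume v': "v' \<in> verts H" "v \<noteq> v'"
    then have "expand {v'} \<subseteq> verts H\<^sub>O" by (intro expand_verts) simp
    from merge_sum_mult[OF * this] show "p v * p v' \<doteq> 0"
      by (simp add: merge_vert_def expand_disjoint[OF v'(2)])
  qed
next
  fix e assume e: "e \<in> edges H"
  show "s e * sum p (rng H e) \<doteq> s e" "sum p (src H e) * s e \<doteq> s e"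
    by (intro merge_edge_mult e rng_subset src_subset order_refl)+
next
  fix e f assume e: "e \<in> edges H" and f: "f \<in> edges H"
  have "poly_star (t (e, i)) * t (f, j)
      \<doteq> (if e = f then if i = j then sum q (rng H\<^sub>O (e, i)) else 0 else 0)"
    if i: "i \<in> idx e" and j: "j \<in> idx f" for i j
  proof -
    have x: "(e, i) \<in> edges H\<^sub>O" and y: "(f, j) \<in> edges H\<^sub>O" using e f i j by (simp_all add: edges_O)
    show ?thesis
      using null_familyD(3)[OF fam x] null_familyD(4)[OF fam x y] by (cases "e = f \<and> i = j") auto
  qed
  then have "(\<Sum>i\<in>idx e. \<Sum>j\<in>idx f. poly_star (t (e, i)) * t (f, j))
      \<doteq> (\<Sum>i\<in>idx e. \<Sum>j\<in>idx f. if e = f then if i = j then sum q (rng H\<^sub>O (e, i)) else 0 else 0)"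
    by (intro null_cong_sum)
  also have "\<dots> = (if e = f then sum q (expand (rng H e)) else 0)"
    by (simp add: sum_rng_O[OF f])
  also have "sum q (expand (rng H e)) = sum p (rng H e)"
    by (rule sum_merge_vert[OF finite_rng[OF e], symmetric])
  finally show "poly_star (s e) * s f \<doteq> (if e = f then sum p (rng H e) else 0)"
    by (simp add: merge_edge_def sum_product)
next
  fix v assume v: "v \<in> verts H" and sink: "\<not> is_sink H v"
  let ?F = "{e \<in> edges H. v \<in> src H e}"
  let ?T = "\<Sum>x\<in>Sigma ?F idx. t x * poly_star (t x)"
  have "(\<Sum>e\<in>?F. s e * poly_star (s e)) * p v \<doteq> ?T * p v"
    by (intro null_cong_mult_right sum_merge_edge_ranges) blast
  \<comment> \<open>Checked at each vertex over \<open>v\<close>. The case \<open>v = w\<close> is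
    special: a single \<open>w\<^sup>j\<close> may emit fewer edges than enter
    \<open>?T\<close>.\<close>
  also have "?T * p v \<doteq> p v"
    unfolding merge_vert_def sum_distrib_left
  proof (rule null_cong_sum)
    fix x assume x: "x \<in> expand {v}"
    then have xv: "x \<in> verts H\<^sub>O" using v expand_mono[of "{v}" "verts H"] by (auto simp: verts_O)
    show "?T * q x \<doteq> q x"
      using xv
    proof (cases rule: verts_O_cases)
      case (Inl v')
      then have "v' = v" "v \<noteq> w" using x by auto
      then show ?thesis
        using null_familyD(6)[OF fam xv] sink Inl(1) by (simp add: emitted_Inl is_sink_Inl)
    next
      case (Inr j)
      note j = Inr(2)
      have vw: "v = w" using x Inr by simp
      let ?Tj = "\<Sum>x\<in>Sigma (\<E> j) idx. t x * poly_star (t x)"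
      have sub: "\<E> j \<subseteq> ?F" using block_edges[OF j] vw by blast
      have fin: "finite (Sigma ?F idx)" using finite_edges by simp
      \<comment> \<open>The ranges in \<open>?Tj\<close> are among those in \<open>?T\<close>, so
        \<open>?T\<close> absorbs \<open>?Tj\<close>, which in turn fixes
        \<open>q (Inr j)\<close>.\<close>
      have "?T * ?Tj \<doteq> sum (\<lambda>x. t x * poly_star (t x)) (Sigma ?F idx \<inter> Sigma (\<E> j) idx)"
        using sub fin finite_subset[OF Sigma_mono[OF sub order_refl] fin]
        by (intro orthogonal_sums[OF null_family_ranges[OF fam]]) (auto simp: edges_O)
      also have "Sigma ?F idx \<inter> Sigma (\<E> j) idx = Sigma (\<E> j) idx" using sub by blast
      finally have TTj: "?T * ?Tj \<doteq> ?Tj" .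
      have "?T * q (Inr j) \<doteq> ?T * (?Tj * q (Inr j))"
        by (rule null_cong_mult_left[OF null_cong_sym[OF block_range_mult(1)[OF j]]])
      also have "\<dots> = ?T * ?Tj * q (Inr j)" by (simp add: mult.assoc)
      also have "\<dots> \<doteq> ?Tj * q (Inr j)" by (rule null_cong_mult_right[OF TTj])
      also have "\<dots> \<doteq> q (Inr j)" by (rule block_range_mult(1)[OF j])
      finally show ?thesis using Inr(1) by simp
    qed
  qed
  finally show "(\<Sum>e\<in>?F. s e * poly_star (s e)) * p v \<doteq> p v" .
qed

lemma split_vert_merge:
  assumes "x \<in> verts H\<^sub>O"
  shows "split_vert p s x \<doteq> q x"
  using assms
proof (cases rule: verts_O_cases)
  case (Inl v)
  then have "expand {v} = {Inl v}" by (simp add: expand_def)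
  with Inl show ?thesis by (simp add: merge_vert_def)
next
  case (Inr j)
  let ?Tj = "\<Sum>x\<in>Sigma (\<E> j) idx. t x * poly_star (t x)"
  have "split_vert p s (Inr j) \<doteq> ?Tj"
    unfolding split_vert.simps by (rule sum_merge_edge_ranges[OF block_subset[OF Inr(2)]])
  also have "?Tj \<doteq> ?Tj * q (Inr j)" by (rule null_cong_sym[OF block_range_mult(2)[OF Inr(2)]])
  also have "\<dots> \<doteq> q (Inr j)" by (rule block_range_mult(1)[OF Inr(2)])
  finally show ?thesis using Inr(1) by simp
qed

lemma split_edge_merge:
  assumes x: "x \<in> edges H\<^sub>O"
  shows "split_edge p s x \<doteq> t x"
proof -
  obtain e i where ei: "x = (e, i)" "e \<in> edges H" "i \<in> idx e" using x by (auto simp: edges_O)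
  have "split_edge p s x = s e * sum (split_vert p s) (rng H\<^sub>O x)"
    by (simp add: split_edge_def ei)
  also have "\<dots> \<doteq> s e * sum q (rng H\<^sub>O x)"
    using O.rng_subset[OF x] by (intro null_cong_mult_left null_cong_sum split_vert_merge) blast
  also have "\<dots> = (\<Sum>k\<in>idx e. t (e, k) * sum q (rng H\<^sub>O x))"
    by (simp add: merge_edge_def sum_distrib_right)
  \<comment> \<open>Cutting the merged edge down to the range of \<open>x\<close> keeps the summand
    of \<open>x\<close> and annihilates the other copies.\<close>
  also have "\<dots> \<doteq> (\<Sum>k\<in>idx e. if i = k then t (e, k) else 0)"
  proof (rule null_cong_sum)
    fix k assume k: "k \<in> idx e"
    then have y: "(e, k) \<in> edges H\<^sub>O" using ei by (simp add: edges_O)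
    show "t (e, k) * sum q (rng H\<^sub>O x) \<doteq> (if i = k then t (e, k) else 0)"
      using null_family_mult_range[OF fam y] edge_mult_disjoint[OF y _ O.rng_subset[OF x]]
        rng_O_disjoint[OF k ei(3)] ei(1) by auto
  qed
  also have "\<dots> = t x" using ei by simp
  finally show ?thesis .
qed

end

lemma merge_vert_split:
  assumes "null_family H a b"
  shows "merge_vert (split_vert a b) v \<doteq> a v"
  unfolding merge_vert_def by (rule sum_split_vert_singleton[OF assms])

lemma merge_edge_split:
  assumes "null_family H a b" "e \<in> edges H"
  shows "merge_edge (split_edge a b) e \<doteq> b e"
  unfolding merge_edge_def by (rule sum_split_edge[OF assms])

end

section \<open>The isomorphism on generators\<close>

context outsplitting
begin

definition merge_gen :: "('v, 'e) hgen \<Rightarrow> ('v + nat, 'e \<times> nat) hgen star_poly" where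
  "merge_gen g = (case g of Vert v \<Rightarrow> merge_vert (gen \<circ> Vert) v | Edge e \<Rightarrow> merge_edge (gen \<circ> Edge) e)"

definition split_gen :: "('v + nat, 'e \<times> nat) hgen \<Rightarrow> ('v, 'e) hgen star_poly" where
  "split_gen g = (case g of Vert x \<Rightarrow> split_vert (gen \<circ> Vert) (gen \<circ> Edge) x
    | Edge x \<Rightarrow> split_edge (gen \<circ> Vert) (gen \<circ> Edge) x)"

lemma merge_gen_comp: "merge_gen \<circ> Vert = merge_vert (gen \<circ> Vert)" "merge_gen \<circ> Edge = merge_edge (gen \<circ> Edge)"
  and split_gen_comp: "split_gen \<circ> Vert = split_vert (gen \<circ> Vert) (gen \<circ> Edge)"
    "split_gen \<circ> Edge = split_edge (gen \<circ> Vert) (gen \<circ> Edge)"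
  by (simp_all add: merge_gen_def split_gen_def fun_eq_iff)

text \<open>The translations are built from sums, products and adjoints, which substitutions
  preserve. A composite of the two substitutions thus becomes a composite of the translations,
  evaluated at the generators.\<close>

lemma poly_subst_split_vert:
  "poly_subst f (split_vert p s x) = split_vert (poly_subst f \<circ> p) (poly_subst f \<circ> s) x"
  by (cases x) simp_all

lemma poly_subst_split_edge:
  "poly_subst f (split_edge p s x) = split_edge (poly_subst f \<circ> p) (poly_subst f \<circ> s) x"
  by (simp add: split_edge_def poly_subst_split_vert)

lemma poly_subst_merge_vert: "poly_subst f (merge_vert q v) = merge_vert (poly_subst f \<circ> q) v"
  by (simp add: merge_vert_def)

lemma poly_subst_merge_edge: "poly_subst f (merge_edge t e) = merge_edge (poly_subst f \<circ> t) e"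
  by (simp add: merge_edge_def)

lemma poly_subst_comp_gen: "poly_subst f \<circ> (gen \<circ> c) = f \<circ> c"
  by (simp add: fun_eq_iff)

lemma merge_gen_in:
  assumes "g \<in> hgens H"
  shows "merge_gen g \<in> free_star_alg (hgens H\<^sub>O)"
proof (cases g)
  case (Vert v)
  then have "expand {v} \<subseteq> verts H\<^sub>O" using assms expand_mono[of "{v}" "verts H"] by (auto simp: verts_O)
  then have "sum (gen \<circ> Vert) (expand {v}) \<in> free_star_alg (hgens H\<^sub>O)"
    by (intro free_star_alg_sum) auto
  with Vert show ?thesis by (simp add: merge_gen_def merge_vert_def)
next
  case (Edge e)
  then have "\<And>i. i \<in> idx e \<Longrightarrow> (e, i) \<in> edges H\<^sub>O" using assms by (auto simp: edges_O)
  then have "(\<Sum>i\<in>idx e. (gen \<circ> Edge) (e, i)) \<in> free_star_alg (hgens H\<^sub>O)"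
    by (intro free_star_alg_sum) simp
  with Edge show ?thesis by (simp add: merge_gen_def merge_edge_def)
qed

lemma split_vert_in:
  assumes "x \<in> verts H\<^sub>O"
  shows "split_vert (gen \<circ> Vert) (gen \<circ> Edge) x \<in> free_star_alg (hgens H)"
  using assms
proof (cases rule: verts_O_cases)
  case (Inl v)
  then show ?thesis by simp
next
  case (Inr j)
  have "gen (Edge e) * poly_star (gen (Edge e)) \<in> free_star_alg (hgens H)" if "e \<in> \<E> j" for e
    using block_edges[OF Inr(2) that] by (intro free_star_alg_mult free_star_alg_star) simp_all
  then have "(\<Sum>e\<in>\<E> j. gen (Edge e) * poly_star (gen (Edge e))) \<in> free_star_alg (hgens H)"
    by (intro free_star_alg_sum)
  with Inr(1) show ?thesis by simp
qed

lemma split_gen_in: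
  assumes "g \<in> hgens H\<^sub>O"
  shows "split_gen g \<in> free_star_alg (hgens H)"
proof (cases g)
  case (Vert x)
  then show ?thesis using assms split_vert_in by (auto simp: split_gen_def)
next
  case (Edge x)
  then have x: "x \<in> edges H\<^sub>O" using assms by auto
  then have "fst x \<in> edges H" by (auto simp: edges_O)
  then have "gen (Edge (fst x)) \<in> free_star_alg (hgens H)" by simp
  moreover have "sum (split_vert (gen \<circ> Vert) (gen \<circ> Edge)) (rng H\<^sub>O x) \<in> free_star_alg (hgens H)"
    using O.rng_subset[OF x] by (intro free_star_alg_sum split_vert_in) blast
  ultimately show ?thesis using Edge by (simp add: split_gen_def split_edge_def)
qed

lemma hypergraph_cstar_outsplit: "hypergraph_cstar H \<cong>\<^sub>* hypergraph_cstar H\<^sub>O"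
proof (rule hypergraph_cstar_isoI[where f = merge_gen and f' = split_gen])
  show "finite_hypergraph H" "finite_hypergraph H\<^sub>O"
    by (rule finite_hypergraph_axioms O.finite_hypergraph_axioms)+
  show "merge_gen g \<in> free_star_alg (hgens H\<^sub>O)" if "g \<in> hgens H" for g
    using that by (rule merge_gen_in)
  show "split_gen g \<in> free_star_alg (hgens H)" if "g \<in> hgens H\<^sub>O" for g
    using that by (rule split_gen_in)
next
  fix N :: "('v + nat, 'e \<times> nat) hgen star_poly \<Rightarrow> real"
  assume N: "cstar_seminormed N" and fam: "cstar_seminormed.null_family N H\<^sub>O (gen \<circ> Vert) (gen \<circ> Edge)"
  interpret outsplitting_seminormed H w n \<E> N
    by (rule outsplitting_seminormed.intro[OF outsplitting_axioms N])
  show "null_family H (merge_gen \<circ> Vert) (merge_gen \<circ> Edge)"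
    unfolding merge_gen_comp by (rule null_family_merge[OF fam])
  fix g assume g: "g \<in> hgens H\<^sub>O"
  show "null_cong (poly_subst merge_gen (split_gen g)) (gen g)"
  proof (cases g)
    case (Vert x)
    then have "x \<in> verts H\<^sub>O" using g by auto
    from split_vert_merge[OF fam this] show ?thesis
      by (simp add: Vert split_gen_def poly_subst_split_vert poly_subst_comp_gen merge_gen_comp)
  next
    case (Edge x)
    then have "x \<in> edges H\<^sub>O" using g by auto
    from split_edge_merge[OF fam this] show ?thesis
      by (simp add: Edge split_gen_def poly_subst_split_edge poly_subst_comp_gen merge_gen_comp)
  qed
next
  fix N :: "('v, 'e) hgen star_poly \<Rightarrow> real"
  assume N: "cstar_seminormed N" and fam: "cstar_seminormed.null_family N H (gen \<circ> Vert) (gen \<circ> Edge)"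
  interpret outsplitting_seminormed H w n \<E> N
    by (rule outsplitting_seminormed.intro[OF outsplitting_axioms N])
  show "null_family H\<^sub>O (split_gen \<circ> Vert) (split_gen \<circ> Edge)"
    unfolding split_gen_comp by (rule null_family_split[OF fam])
  fix g assume g: "g \<in> hgens H"
  show "null_cong (poly_subst split_gen (merge_gen g)) (gen g)"
  proof (cases g)
    case (Vert v)
    from merge_vert_split[OF fam, of v] show ?thesis
      by (simp add: Vert merge_gen_def poly_subst_merge_vert poly_subst_comp_gen split_gen_comp)
  next
    case (Edge e)
    then have "e \<in> edges H" using g by auto
    from merge_edge_split[OF fam this] show ?thesis
      by (simp add: Edge merge_gen_def poly_subst_merge_edge poly_subst_comp_gen split_gen_comp)
  qed
qed

end

theorem proposition6p9:
  fixes H :: "('v, 'e) hypergraph" and w :: 'v and n :: nat and \<E> :: "nat \<Rightarrow> 'e set"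
  assumes "finite_hypergraph H"
    and "w \<in> verts H"
    and "\<not> is_sink H w"
    and "locally_ultra H w"
    and "{e \<in> edges H. w \<in> src H e} = (\<Union>j\<in>{1..n}. \<E> j)"
    and "disjoint_family_on \<E> {1..n}"
    and "\<forall>j\<in>{1..n}. \<E> j \<noteq> {}"
  shows "hypergraph_cstar H \<cong>\<^sub>* hypergraph_cstar (outsplit H w n \<E>)"
proof -
  interpret outsplitting H w n \<E>
    using assms by (intro outsplitting.intro outsplitting_axioms.intro)
  show ?thesis by (rule hypergraph_cstar_outsplit)
qed

end
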